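(* Let $X$ and $Y$ be multilinearly stable sequence classes such that $X(\mathbb{K})^n\hookrightarrow Y(\mathbb{K})$ for every $n\in\mathbb{N}$. Then $(\mathcal{P}_{X;Y},\|\cdot\|_{X;Y;2})$ is a $\left(\frac{n^n}{n!},\frac{n^n}{n!}\right)_{n=1}^\infty$-polynomial Banach two-sided ideal.
   Context: All Banach spaces are over $\mathbb{K} = \mathbb{R}$ or $\mathbb{C}$. $\mathcal{L}(E_1,\ldots,E_n;F)$ (written $\mathcal{L}(^nE;F)$ if all $E_i=E$) is the Banach space of continuous $n$-linear operators and $\mathcal{P}(^nE;F)$ the Banach space of continuous $n$-homogeneous polynomials, with their usual sup norms. $\check P$ denotes the unique symmetric $n$-linear operator with $\check P(x,\ldots,x)=P(x)$. **Sequence class.** $E \hookrightarrow F$ means that the Banach space $E$ is a linear subspace of the Banach space $F$ and $\|x\|_F \le \|x\|_E$ for all $x\in E$. $c_{00}(E)$ is the space of eventually null $E$-valued sequences, $\ell_\infty(E)$ the Banach space of bounded $E$-valued sequences with the sup norm, and $e_j$ the $j$-th canonical scalar sequence. A sequence class is a rule $E\mapsto X(E)$ assigning to each Banach space $E$ a Banach space $X(E)$ of $E$-valued sequences (coordinatewise operations) such that $c_{00}(E)\subseteq X(E)$, $X(E)\hookrightarrow \ell_\infty(E)$ and $\|e_j\|_{X(\mathbb{K})}=1$ for every $j\in\mathbb{N}$. **Multilinearly stable.** $X$ is multilinearly stable if for all $n\in\mathbb{N}$, Banach spaces $E_1,\ldots,E_n,F$ and $A\in\mathcal{L}(E_1,\ldots,E_n;F)$,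 $(A(x_j^1,\ldots,x_j^n))_{j=1}^\infty\in X(F)$ whenever $(x_j^m)_{j=1}^\infty\in X(E_m)$, $m=1,\ldots,n$, and the induced $n$-linear operator $\widetilde A\colon X(E_1)\times\cdots\times X(E_n)\to X(F)$, $\widetilde A((x^1_j)_j,\ldots,(x^n_j)_j)=(A(x_j^1,\ldots,x_j^n))_j$, is continuous with $\|\widetilde A\|=\|A\|$. **Compatibility.** $X(\mathbb{K})^n\hookrightarrow Y(\mathbb{K})$ means: whenever $(\lambda_j^m)_{j=1}^\infty\in X(\mathbb{K})$, $m=1,\ldots,n$, one has $(\lambda_j^1\cdots\lambda_j^n)_{j=1}^\infty\in Y(\mathbb{K})$ and $\|(\lambda_j^1\cdots\lambda_j^n)_j\|_{Y(\mathbb{K})}\le\prod_{m=1}^n\|(\lambda_j^m)_j\|_{X(\mathbb{K})}$. **$(X;Y)$-summing operators and polynomials.** $A\in\mathcal{L}(^nE;F)$ belongs to $\mathcal{L}_{X;Y}(^nE;F)$ if $(A(x_j^1,\ldots,x_j^n))_j\in Y(F)$ whenever $(x_j^m)_j\in X(E)$, $m=1,\ldots,n$; then the induced $n$-linear operator $\widetilde A\colon X(E)^n\to Y(F)$, defined coordinatewise, is continuous and $\|A\|_{X;Y}:=\|\widetilde A\|$. A polynomial $P\in\mathcal{P}(^nE;F)$ belongs to $\mathcal{P}_{X;Y}(^nE;F)$ if $(P(x_j))_j\in Y(F)$ whenever $(x_j)_j\in X(E)$; equivalently, $\check P\in\mathcal{L}_{X;Y}(^nE;F)$. In this case $\|P\|_{X;Y;2}:=\|\check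 P\|_{X;Y}$. **$(C_n,K_n)_{n=1}^\infty$-polynomial Banach two-sided ideal.** Let $C_n,K_n\ge1$ for every $n$ and $C_1=K_1=1$. Let $\mathcal{Q}$ be a subclass of the class of continuous homogeneous polynomials between Banach spaces and $\|\cdot\|_{\mathcal{Q}}\colon\mathcal{Q}\to\mathbb{R}$ such that, for all $n$ and Banach spaces $E,F$, the component $\mathcal{Q}(^nE;F):=\mathcal{P}(^nE;F)\cap\mathcal{Q}$ is a linear subspace of $\mathcal{P}(^nE;F)$ containing the polynomials of finite type (linear combinations of $x\mapsto\varphi(x)^nb$, $\varphi\in E^*$, $b\in F$), on which $\|\cdot\|_{\mathcal{Q}}$ is a complete norm, and $\widehat I_n\colon\mathbb{K}\to\mathbb{K}$, $\widehat I_n(\lambda)=\lambda^n$, satisfies $\|\widehat I_n\|_{\mathcal{Q}}=1$. The pair $(\mathcal{Q},\|\cdot\|_{\mathcal{Q}})$ is a $(C_n,K_n)_{n=1}^\infty$-polynomial Banach two-sided ideal if for all $m,n,r\in\mathbb{N}$, Banach spaces $E,F,G,H$, $P\in\mathcal{Q}(^nE;F)$, $Q\in\mathcal{P}(^mG;E)$ and $R\in\mathcal{P}(^rF;H)$, one has $R\circ P\circ Q\in\mathcal{Q}(^{rmn}G;H)$ and $\|R\circ P\circ Q\|_{\mathcal{Q}}\le K_r\cdot C_m^{rn}\cdot\|R\|\cdot\|P\|_{\mathcal{Q}}^r\cdot\|Q\|^{rn}$. *)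

theory Defs
  imports "HOL-Analysis.Analysis" "HOL-Algebra.Module"
begin

section \<open>Banach spaces on carrier sets\<close>

text \<open>
  Sequence classes and ideals of polynomials are rules on the class of all Banach spaces, so Banach
  spaces have to be values and not types. A Banach space is a module (in the sense of HOL-Algebra)
  over the scalar field together with a complete norm. The record of modules extends that of rings;
  its ring multiplication and ring unit play no role and are never mentioned in an axiom.

  The scalar field is a type \<open>'k\<close> of sort \<open>{real_normed_field, banach}\<close>, i.e. a complete normed field
  extension of the reals; by the Gelfand-Mazur theorem these are exactly \<open>\<real>\<close> and \<open>\<complex>\<close>.
\<close>

record ('k, 'a) normed_module = "('k, 'a) module" +
  nrm :: "'a \<Rightarrow> real"

definition scalar_ring :: "'k :: field ring" where
  "scalar_ring = \<lparr>carrier = UNIV, monoid.mult = (*), one = 1, ring.zero = 0, add = (+)\<rparr>"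

text \<open>
  The value \<open>0\<close> outside the carrier is due to the locale \<open>Metric_space\<close>, which requires
  nonnegativity and symmetry for all elements of the type.
\<close>

definition ndist :: "('k, 'a) normed_module \<Rightarrow> 'a \<Rightarrow> 'a \<Rightarrow> real" where
  "ndist E x y = (if x \<in> carrier E \<and> y \<in> carrier E then nrm E (x \<ominus>\<^bsub>E\<^esub> y) else 0)"

definition ntop :: "('k, 'a) normed_module \<Rightarrow> 'a topology" where
  "ntop E = Metric_space.mtopology (carrier E) (ndist E)"

locale banach_space =
  module "scalar_ring :: 'k ring" E
  for E :: "('k :: {real_normed_field, banach}, 'a) normed_module" (structure) +
  assumes nrm_eq_0_iff: "x \<in> carrier E \<Longrightarrow> nrm E x = 0 \<longleftrightarrow> x = \<zero>"
    and nrm_nonneg: "x \<in> carrier E \<Longrightarrow> 0 \<le> nrm E x"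
    and nrm_smult: "x \<in> carrier E \<Longrightarrow> nrm E (a \<odot> x) = norm a * nrm E x"
    and nrm_triangle: "x \<in> carrier E \<Longrightarrow> y \<in> carrier E \<Longrightarrow> nrm E (x \<oplus> y) \<le> nrm E x + nrm E y"
    and complete: "Metric_space.mcomplete (carrier E) (ndist E)"

text \<open>
  The spaces on which sequence classes and ideals are defined have carriers contained in
  \<open>'k + 'u\<close>, where \<open>'u\<close> is an arbitrary type: the first summand makes room for the scalar field as a
  Banach space over itself, and the second one for spaces of any size.
\<close>

type_synonym ('k, 'u) bspace = "('k, 'k + 'u) normed_module"

definition scalar_space :: "('k :: {real_normed_field, banach}, 'u) bspace" where
  "scalar_space =
    \<lparr>carrier = range Inl, monoid.mult = undefined, one = undefined, ring.zero = Inl 0,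
     add = (\<lambda>x y. Inl (projl x + projl y)), smult = (\<lambda>a x. Inl (a * projl x)),
     nrm = (\<lambda>x. norm (projl x))\<rparr>"

text \<open>\<open>V \<hookrightarrow> W\<close>: \<open>V\<close> is a linear subspace of \<open>W\<close> whose norm dominates that of \<open>W\<close>.\<close>

definition norm_embedded :: "('k, 'a) normed_module \<Rightarrow> ('k, 'a) normed_module \<Rightarrow> bool" where
  "norm_embedded V W \<longleftrightarrow>
    carrier V \<subseteq> carrier W \<and>
    \<zero>\<^bsub>V\<^esub> = \<zero>\<^bsub>W\<^esub> \<and>
    (\<forall>x\<in>carrier V. \<forall>y\<in>carrier V. x \<oplus>\<^bsub>V\<^esub> y = x \<oplus>\<^bsub>W\<^esub> y) \<and>
    (\<forall>a. \<forall>x\<in>carrier V. a \<odot>\<^bsub>V\<^esub> x = a \<odot>\<^bsub>W\<^esub> x) \<and>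
    (\<forall>x\<in>carrier V. nrm W x \<le> nrm V x)"

section \<open>Continuous multilinear operators and homogeneous polynomials\<close>

text \<open>
  The elements of \<open>E\<^sub>1 \<times> \<dots> \<times> E\<^sub>n\<close> are the extensional functions in
  \<open>PiE {..<n} (\<lambda>i. carrier (E i))\<close>. Operators and polynomials are extensional as well, so
  that equality of operators is equality on their domains.
\<close>

definition multilinear ::
    "nat \<Rightarrow> (nat \<Rightarrow> ('k, 'a) normed_module) \<Rightarrow> ('k, 'b) normed_module \<Rightarrow> ((nat \<Rightarrow> 'a) \<Rightarrow> 'b) set"
where
  "multilinear n E F =
    {A \<in> (\<Pi>\<^sub>E i\<in>{..<n}. carrier (E i)) \<rightarrow>\<^sub>E carrier F.
       \<forall>x \<in> \<Pi>\<^sub>E i\<in>{..<n}. carrier (E i). \<forall>i<n.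
         (\<forall>y\<in>carrier (E i). A (x(i := x i \<oplus>\<^bsub>E i\<^esub> y)) = A x \<oplus>\<^bsub>F\<^esub> A (x(i := y))) \<and>
         (\<forall>a. A (x(i := a \<odot>\<^bsub>E i\<^esub> x i)) = a \<odot>\<^bsub>F\<^esub> A x)}"

definition cmultilinear ::
    "nat \<Rightarrow> (nat \<Rightarrow> ('k, 'a) normed_module) \<Rightarrow> ('k, 'b) normed_module \<Rightarrow> ((nat \<Rightarrow> 'a) \<Rightarrow> 'b) set"
where
  "cmultilinear n E F =
    {A \<in> multilinear n E F.
       continuous_map (product_topology (\<lambda>i. ntop (E i)) {..<n}) (ntop F) A}"

definition multilinear_norm ::
    "nat \<Rightarrow> (nat \<Rightarrow> ('k, 'a) normed_module) \<Rightarrow> ('k, 'b) normed_module \<Rightarrow> ((nat \<Rightarrow> 'a) \<Rightarrow> 'b) \<Rightarrow> real"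
where
  "multilinear_norm n E F A =
    (SUP x \<in> {x \<in> \<Pi>\<^sub>E i\<in>{..<n}. carrier (E i). \<forall>i<n. nrm (E i) (x i) \<le> 1}. nrm F (A x))"

definition symmetric_operator ::
    "nat \<Rightarrow> ('k, 'a) normed_module \<Rightarrow> ((nat \<Rightarrow> 'a) \<Rightarrow> 'b) \<Rightarrow> bool"
where
  "symmetric_operator n E A \<longleftrightarrow>
    (\<forall>\<sigma>. \<sigma> permutes {..<n} \<longrightarrow> (\<forall>x \<in> {..<n} \<rightarrow>\<^sub>E carrier E. A (x \<circ> \<sigma>) = A x))"

text \<open>The normed space of continuous \<open>n\<close>-homogeneous polynomials from \<open>E\<close> to \<open>F\<close>.\<close>

definition poly_space ::
    "nat \<Rightarrow> ('k, 'a) normed_module \<Rightarrow> ('k, 'b) normed_module \<Rightarrow> ('k, 'a \<Rightarrow> 'b) normed_module"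
where
  "poly_space n E F =
    \<lparr>carrier =
       {P \<in> carrier E \<rightarrow>\<^sub>E carrier F.
          (\<exists>A \<in> multilinear n (\<lambda>_. E) F. \<forall>x\<in>carrier E. P x = A (\<lambda>_\<in>{..<n}. x)) \<and>
          continuous_map (ntop E) (ntop F) P},
     monoid.mult = undefined, one = undefined,
     ring.zero = (\<lambda>x\<in>carrier E. \<zero>\<^bsub>F\<^esub>),
     add = (\<lambda>P Q. \<lambda>x\<in>carrier E. P x \<oplus>\<^bsub>F\<^esub> Q x),
     smult = (\<lambda>a P. \<lambda>x\<in>carrier E. a \<odot>\<^bsub>F\<^esub> P x),
     nrm = (\<lambda>P. SUP x \<in> {x \<in> carrier E. nrm E x \<le> 1}. nrm F (P x))\<rparr>"

definition symmetric_of ::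
    "nat \<Rightarrow> ('k, 'a) normed_module \<Rightarrow> ('k, 'b) normed_module \<Rightarrow> ('a \<Rightarrow> 'b) \<Rightarrow> (nat \<Rightarrow> 'a) \<Rightarrow> 'b"
where
  "symmetric_of n E F P =
    (THE A. A \<in> multilinear n (\<lambda>_. E) F \<and> symmetric_operator n E A \<and>
            (\<forall>x\<in>carrier E. A (\<lambda>_\<in>{..<n}. x) = P x))"

definition dual :: "('k :: real_normed_field, 'a) normed_module \<Rightarrow> ('a \<Rightarrow> 'k) set" where
  "dual E =
    {\<phi>. (\<forall>x\<in>carrier E. \<forall>y\<in>carrier E. \<phi> (x \<oplus>\<^bsub>E\<^esub> y) = \<phi> x + \<phi> y) \<and>
        (\<forall>a. \<forall>x\<in>carrier E. \<phi> (a \<odot>\<^bsub>E\<^esub> x) = a * \<phi> x) \<and>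
        continuous_map (ntop E) euclidean \<phi>}"

definition finite_type_polys ::
    "nat \<Rightarrow> ('k :: real_normed_field, 'a) normed_module \<Rightarrow> ('k, 'b) normed_module \<Rightarrow> ('a \<Rightarrow> 'b) set"
where
  "finite_type_polys n E F =
    {finsum (poly_space n E F)
       (\<lambda>i. c i \<odot>\<^bsub>poly_space n E F\<^esub> (\<lambda>x\<in>carrier E. (\<phi> i x ^ n) \<odot>\<^bsub>F\<^esub> b i)) {..<N}
     |(N::nat) c \<phi> b. \<forall>i<N. \<phi> i \<in> dual E \<and> b i \<in> carrier F}"

section \<open>Sequence classes\<close>

definition c00 :: "('k, 'a) normed_module \<Rightarrow> (nat \<Rightarrow> 'a) set" where
  "c00 E = {x. range x \<subseteq> carrier E \<and> (\<forall>\<^sub>F j in sequentially. x j = \<zero>\<^bsub>E\<^esub>)}"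

definition linfty :: "('k, 'a) normed_module \<Rightarrow> ('k, nat \<Rightarrow> 'a) normed_module" where
  "linfty E =
    \<lparr>carrier = {x. range x \<subseteq> carrier E \<and> bdd_above (range (\<lambda>j. nrm E (x j)))},
     monoid.mult = undefined, one = undefined,
     ring.zero = (\<lambda>j. \<zero>\<^bsub>E\<^esub>),
     add = (\<lambda>x y j. x j \<oplus>\<^bsub>E\<^esub> y j),
     smult = (\<lambda>a x j. a \<odot>\<^bsub>E\<^esub> x j),
     nrm = (\<lambda>x. SUP j. nrm E (x j))\<rparr>"

type_synonym ('k, 'u) seq_rule = "('k, 'u) bspace \<Rightarrow> ('k, nat \<Rightarrow> 'k + 'u) normed_module"

definition unit_seq :: "nat \<Rightarrow> nat \<Rightarrow> 'k :: {real_normed_field, banach} + 'u" where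
  "unit_seq j = (\<lambda>i. Inl (if i = j then 1 else 0))"

text \<open>The operations of \<open>X E\<close> are coordinatewise because \<open>X E\<close> is a linear subspace of \<open>linfty E\<close>.\<close>

definition sequence_class :: "('k :: {real_normed_field, banach}, 'u) seq_rule \<Rightarrow> bool" where
  "sequence_class X \<longleftrightarrow>
    (\<forall>E. banach_space E \<longrightarrow>
       banach_space (X E) \<and> c00 E \<subseteq> carrier (X E) \<and> norm_embedded (X E) (linfty E)) \<and>
    (\<forall>j. nrm (X scalar_space) (unit_seq j) = 1)"

text \<open>The operator acting coordinatewise on sequences from the spaces \<open>S 0, \<dots>, S (n - 1)\<close>.\<close>

definition induced ::
    "nat \<Rightarrow> (nat \<Rightarrow> ('k, nat \<Rightarrow> 'a) normed_module) \<Rightarrow> ((nat \<Rightarrow> 'a) \<Rightarrow> 'b)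
      \<Rightarrow> (nat \<Rightarrow> nat \<Rightarrow> 'a) \<Rightarrow> nat \<Rightarrow> 'b"
where
  "induced n S A = (\<lambda>x \<in> \<Pi>\<^sub>E m\<in>{..<n}. carrier (S m). \<lambda>j. A (\<lambda>m\<in>{..<n}. x m j))"

definition multilinearly_stable :: "('k :: {real_normed_field, banach}, 'u) seq_rule \<Rightarrow> bool" where
  "multilinearly_stable X \<longleftrightarrow>
    (\<forall>n\<ge>1. \<forall>E F. (\<forall>m<n. banach_space (E m)) \<longrightarrow> banach_space F \<longrightarrow>
      (\<forall>A \<in> cmultilinear n E F.
         (\<forall>x \<in> \<Pi>\<^sub>E m\<in>{..<n}. carrier (X (E m)). (\<lambda>j. A (\<lambda>m\<in>{..<n}. x m j)) \<in> carrier (X F)) \<and>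
         induced n (\<lambda>m. X (E m)) A \<in> cmultilinear n (\<lambda>m. X (E m)) (X F) \<and>
         multilinear_norm n (\<lambda>m. X (E m)) (X F) (induced n (\<lambda>m. X (E m)) A)
           = multilinear_norm n E F A))"

text \<open>\<open>X(\<bbbK>)\<^sup>n \<hookrightarrow> Y(\<bbbK>)\<close>.\<close>

definition power_embedded ::
    "nat \<Rightarrow> ('k :: {real_normed_field, banach}, 'u) seq_rule \<Rightarrow> ('k, 'u) seq_rule \<Rightarrow> bool"
where
  "power_embedded n X Y \<longleftrightarrow>
    (\<forall>l. (\<forall>m<n. l m \<in> carrier (X scalar_space)) \<longrightarrow>
       (\<lambda>j. Inl (\<Prod>m<n. projl (l m j))) \<in> carrier (Y scalar_space) \<and>
       nrm (Y scalar_space) (\<lambda>j. Inl (\<Prod>m<n. projl (l m j)))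
         \<le> (\<Prod>m<n. nrm (X scalar_space) (l m)))"

section \<open>Classes of polynomials and two-sided ideals\<close>

text \<open>
  A class of continuous homogeneous polynomials is given by the sets \<open>Q E F\<close> of its members from
  \<open>E\<close> to \<open>F\<close>, of all degrees \<open>n \<ge> 1\<close>, and its norm by the functions \<open>q E F\<close>.
\<close>

type_synonym ('k, 'u) poly_class = "('k, 'u) bspace \<Rightarrow> ('k, 'u) bspace \<Rightarrow> ('k + 'u \<Rightarrow> 'k + 'u) set"
type_synonym ('k, 'u) poly_class_norm =
  "('k, 'u) bspace \<Rightarrow> ('k, 'u) bspace \<Rightarrow> ('k + 'u \<Rightarrow> 'k + 'u) \<Rightarrow> real"

definition homogeneous_polys :: "('k :: {real_normed_field, banach}, 'u) poly_class" where
  "homogeneous_polys E F = (\<Union>n\<in>{1..}. carrier (poly_space n E F))"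

definition component ::
    "('k, 'u) poly_class \<Rightarrow> ('k, 'u) poly_class_norm \<Rightarrow> nat \<Rightarrow> ('k, 'u) bspace \<Rightarrow> ('k, 'u) bspace
      \<Rightarrow> ('k, 'k + 'u \<Rightarrow> 'k + 'u) normed_module"
where
  "component Q q n E F =
    (poly_space n E F)\<lparr>carrier := carrier (poly_space n E F) \<inter> Q E F, nrm := q E F\<rparr>"

definition power_poly :: "nat \<Rightarrow> 'k :: {real_normed_field, banach} + 'u \<Rightarrow> 'k + 'u" where
  "power_poly n = (\<lambda>x \<in> carrier scalar_space. Inl (projl x ^ n))"

definition polynomial_banach_two_sided_ideal ::
    "(nat \<Rightarrow> real) \<Rightarrow> (nat \<Rightarrow> real) \<Rightarrow> ('k :: {real_normed_field, banach}, 'u) poly_class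
      \<Rightarrow> ('k, 'u) poly_class_norm \<Rightarrow> bool"
where
  "polynomial_banach_two_sided_ideal C K Q q \<longleftrightarrow>
    (\<forall>n\<ge>1. 1 \<le> C n \<and> 1 \<le> K n) \<and> C 1 = 1 \<and> K 1 = 1 \<and>
    (\<forall>E F. banach_space E \<longrightarrow> banach_space F \<longrightarrow> Q E F \<subseteq> homogeneous_polys E F) \<and>
    (\<forall>n\<ge>1. \<forall>E F. banach_space E \<longrightarrow> banach_space F \<longrightarrow>
       banach_space (component Q q n E F) \<and>
       finite_type_polys n E F \<subseteq> carrier (component Q q n E F)) \<and>
    (\<forall>n\<ge>1. q scalar_space scalar_space (power_poly n) = 1) \<and>
    (\<forall>m\<ge>1. \<forall>n\<ge>1. \<forall>r\<ge>1. \<forall>E F G H.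
       banach_space E \<longrightarrow> banach_space F \<longrightarrow> banach_space G \<longrightarrow> banach_space H \<longrightarrow>
       (\<forall>P \<in> carrier (component Q q n E F). \<forall>S \<in> carrier (poly_space m G E).
          \<forall>R \<in> carrier (poly_space r F H).
            compose (carrier G) R (compose (carrier G) P S)
              \<in> carrier (component Q q (r * m * n) G H) \<and>
            q G H (compose (carrier G) R (compose (carrier G) P S))
              \<le> K r * C m ^ (r * n) * nrm (poly_space r F H) R * q E F P ^ r
                  * nrm (poly_space m G E) S ^ (r * n)))"

section \<open>Summing polynomials\<close>

definition summing_polys ::
    "('k :: {real_normed_field, banach}, 'u) seq_rule \<Rightarrow> ('k, 'u) seq_rule \<Rightarrow> ('k, 'u) poly_class"
where
  "summing_polys X Y E F =
    {P \<in> homogeneous_polys E F. \<forall>x \<in> carrier (X E). (\<lambda>j. P (x j)) \<in> carrier (Y F)}"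

definition summing_operator_norm ::
    "('k, 'u) seq_rule \<Rightarrow> ('k, 'u) seq_rule \<Rightarrow> nat \<Rightarrow> ('k, 'u) bspace \<Rightarrow> ('k, 'u) bspace
      \<Rightarrow> ((nat \<Rightarrow> 'k + 'u) \<Rightarrow> 'k + 'u) \<Rightarrow> real"
where
  "summing_operator_norm X Y n E F A =
    multilinear_norm n (\<lambda>_. X E) (Y F) (induced n (\<lambda>_. X E) A)"

text \<open>
  A nonzero homogeneous polynomial has exactly one degree. The zero polynomial has all degrees, and
  its symmetric operator is zero whichever degree is used.
\<close>

definition poly_degree :: "('k, 'u) bspace \<Rightarrow> ('k, 'u) bspace \<Rightarrow> ('k + 'u \<Rightarrow> 'k + 'u) \<Rightarrow> nat" where
  "poly_degree E F P = (LEAST n. 1 \<le> n \<and> P \<in> carrier (poly_space n E F))"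

definition summing_poly_norm ::
    "('k :: {real_normed_field, banach}, 'u) seq_rule \<Rightarrow> ('k, 'u) seq_rule \<Rightarrow> ('k, 'u) poly_class_norm"
where
  "summing_poly_norm X Y E F P =
    (let n = poly_degree E F P in summing_operator_norm X Y n E F (symmetric_of n E F P))"

end

theory Submission
  imports Defs
begin

text \<open>
  By the polarization formula, a polynomial \<open>P\<close> is \<open>(X; Y)\<close>-summing iff its symmetric operator \<open>A\<close> is,
  because the coordinatewise polarization takes place in the linear spaces \<open>X E\<close> and \<open>Y F\<close>; the
  induced operator on sequences is then bounded by a uniform version of the closed graph theorem, applied
  in one variable at a time. Stability, applied to \<open>\<lambda> \<mapsto> \<lambda> v\<close>, shows that the sequence
  \<open>(v, 0, 0, \<dots>)\<close> has norm at most that of \<open>v\<close>, so the summing norm dominates the operator norm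
  and the limits of Cauchy sequences of summing polynomials can be computed coordinatewise. Finally
  \<open>R \<circ> P \<circ> Q\<close> is the restriction to the diagonal of the operator obtained by plugging the symmetric
  operators of \<open>Q\<close>, \<open>P\<close> and \<open>R\<close> into each other. Those of \<open>Q\<close> and \<open>R\<close> act boundedly on \<open>X\<close> and on \<open>Y\<close> by
  stability, with the constants \<open>m\<^sup>m / m!\<close> and \<open>r\<^sup>r / r!\<close> of the polarization inequality, and averaging
  over permutations does not increase the norm.
\<close>

section \<open>Normed modules\<close>

text \<open>Membership in the class only says that certain sequences lie in \<open>Y F\<close>,
  whereas the norm is a supremum of reals that is meaningless before the induced operator is known
  to be bounded. A closed graph argument in each variable separately would give separate continuity
  only. It is therefore run for a whole pointwise bounded family of linear maps at once, merging the
  closed graph theorem with the uniform boundedness principle: the bound for the variables already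
  treated is the pointwise bound for the next one. After that, estimates go through
  \<open>summing_by\<close>, which joins membership to a constant and is stable under sums,
  composition and symmetrization. The norm of \<open>P\<close> is by definition that of its
  symmetric operator, so only the two arbitrary factors are polarized; the operator of the
  composition contains one copy of the outer operator and r * n copies of the innermost one, whence
  the exponents. The compatibility of \<open>X\<close> and \<open>Y\<close> on scalars enters
  through powers of functionals: it makes polynomials of finite type summing and bounds the norm of
  \<lambda> \<mapsto> \<lambda>^n by 1.\<close>

locale normed_space =
  module "scalar_ring :: 'k ring" E
  for E :: "('k :: {real_normed_field, banach}, 'a) normed_module" (structure) +
  assumes nrm_eq_0_iff: "x \<in> carrier E \<Longrightarrow> nrm E x = 0 \<longleftrightarrow> x = \<zero>"
    and nrm_nonneg: "x \<in> carrier E \<Longrightarrow> 0 \<le> nrm E x"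
    and nrm_smult: "x \<in> carrier E \<Longrightarrow> nrm E (a \<odot> x) = norm a * nrm E x"
    and nrm_triangle: "x \<in> carrier E \<Longrightarrow> y \<in> carrier E \<Longrightarrow> nrm E (x \<oplus> y) \<le> nrm E x + nrm E y"
begin

lemma add_cl: "x \<in> carrier E \<Longrightarrow> y \<in> carrier E \<Longrightarrow> x \<oplus> y \<in> carrier E"
  by (rule a_closed)

lemma zero_cl: "\<zero> \<in> carrier E"
  by simp

lemma smult_cl: "x \<in> carrier E \<Longrightarrow> a \<odot> x \<in> carrier E"
  by (rule smult_closed) (simp_all add: scalar_ring_def)

lemma smult_add_right: "x \<in> carrier E \<Longrightarrow> y \<in> carrier E \<Longrightarrow> a \<odot> (x \<oplus> y) = a \<odot> x \<oplus> a \<odot> y"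
  by (rule smult_r_distr) (simp_all add: scalar_ring_def)

lemma smult_add_left: "x \<in> carrier E \<Longrightarrow> (a + b) \<odot> x = a \<odot> x \<oplus> b \<odot> x"
  using smult_l_distr[of a b x] by (simp add: scalar_ring_def)

lemma smult_smult: "x \<in> carrier E \<Longrightarrow> a \<odot> (b \<odot> x) = (a * b) \<odot> x"
  using smult_assoc1[of a b x] by (simp add: scalar_ring_def)

lemma smult_1: "x \<in> carrier E \<Longrightarrow> 1 \<odot> x = x"
  using smult_one[of x] by (simp add: scalar_ring_def)

lemma smult_0: "x \<in> carrier E \<Longrightarrow> 0 \<odot> x = \<zero>"
  using smult_l_null[of x] by (simp add: scalar_ring_def)

lemma smult_zero: "a \<odot> \<zero> = \<zero>"
  using smult_r_null[of a] by (simp add: scalar_ring_def)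

lemma neg_eq: "x \<in> carrier E \<Longrightarrow> \<ominus> x = (-1) \<odot> x"
proof -
  assume x: "x \<in> carrier E"
  have "(-1) \<odot> x \<oplus> x = (-1 + 1) \<odot> x" by (subst smult_add_left) (simp_all add: x smult_1)
  also have "\<dots> = \<zero>" using x smult_0 by simp
  finally show ?thesis using x smult_cl by (simp add: minus_equality)
qed

lemma diff_eq: "x \<in> carrier E \<Longrightarrow> y \<in> carrier E \<Longrightarrow> x \<ominus> y = x \<oplus> (-1) \<odot> y"
  by (simp add: a_minus_def neg_eq)

lemma diff_cl: "x \<in> carrier E \<Longrightarrow> y \<in> carrier E \<Longrightarrow> x \<ominus> y \<in> carrier E"
  by simp

lemma smult_diff: "x \<in> carrier E \<Longrightarrow> y \<in> carrier E \<Longrightarrow> a \<odot> (x \<ominus> y) = a \<odot> x \<ominus> a \<odot> y"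
  by (simp add: diff_eq smult_cl smult_add_right smult_smult)

lemma diff_add_diff:
  "x \<in> carrier E \<Longrightarrow> y \<in> carrier E \<Longrightarrow> z \<in> carrier E \<Longrightarrow> (x \<ominus> y) \<oplus> (y \<ominus> z) = x \<ominus> z"
  by (simp add: a_minus_def M.a_ac M.r_neg1 M.r_neg2)

lemma add_diff_add:
  "x \<in> carrier E \<Longrightarrow> y \<in> carrier E \<Longrightarrow> u \<in> carrier E \<Longrightarrow> v \<in> carrier E
    \<Longrightarrow> (x \<oplus> y) \<ominus> (u \<oplus> v) = (x \<ominus> u) \<oplus> (y \<ominus> v)"
  by (simp add: a_minus_def M.a_ac M.minus_add)

lemma diff_self: "x \<in> carrier E \<Longrightarrow> x \<ominus> x = \<zero>"
  by (simp add: a_minus_def M.r_neg)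

lemma diff_zero: "x \<in> carrier E \<Longrightarrow> x \<ominus> \<zero> = x"
  by (simp add: a_minus_def)

lemma diff_add_cancel: "x \<in> carrier E \<Longrightarrow> y \<in> carrier E \<Longrightarrow> (x \<ominus> y) \<oplus> y = x"
  by (simp add: a_minus_def M.a_assoc M.l_neg)

lemma diff_0D: "x \<in> carrier E \<Longrightarrow> y \<in> carrier E \<Longrightarrow> x \<ominus> y = \<zero> \<Longrightarrow> x = y"
  by (metis diff_add_cancel l_zero)

lemma nrm_zero: "nrm E \<zero> = 0"
  using nrm_eq_0_iff by simp

lemma nrm_diff_commute: "x \<in> carrier E \<Longrightarrow> y \<in> carrier E \<Longrightarrow> nrm E (x \<ominus> y) = nrm E (y \<ominus> x)"
proof -
  assume x: "x \<in> carrier E" and y: "y \<in> carrier E"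
  have "x \<ominus> y = (-1) \<odot> (y \<ominus> x)"
    using x y by (simp add: diff_eq smult_cl smult_add_right smult_smult smult_1 a_comm)
  then show ?thesis using nrm_smult[of "y \<ominus> x" "-1"] x y by simp
qed

lemma nrm_diff_triangle:
  "x \<in> carrier E \<Longrightarrow> y \<in> carrier E \<Longrightarrow> z \<in> carrier E
    \<Longrightarrow> nrm E (x \<ominus> z) \<le> nrm E (x \<ominus> y) + nrm E (y \<ominus> z)"
  by (metis diff_add_diff nrm_triangle diff_cl)

lemma nrm_diff_le: "x \<in> carrier E \<Longrightarrow> y \<in> carrier E \<Longrightarrow> nrm E (x \<ominus> y) \<le> nrm E x + nrm E y"
  using nrm_triangle[of x "(-1) \<odot> y"] nrm_smult[of y "-1"] by (simp add: diff_eq smult_cl)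

lemma nrm_le_diff: "x \<in> carrier E \<Longrightarrow> y \<in> carrier E \<Longrightarrow> nrm E x \<le> nrm E (x \<ominus> y) + nrm E y"
  using nrm_diff_triangle[of x y "\<zero>"] by (simp add: diff_zero)

lemma nrm_finsum_le:
  assumes "finite I" "g \<in> I \<rightarrow> carrier E"
  shows "nrm E (finsum E g I) \<le> (\<Sum>i\<in>I. nrm E (g i))"
  using assms
proof (induction I)
  case empty
  then show ?case by (simp add: nrm_zero)
next
  case (insert i I)
  then have "g i \<in> carrier E" "g \<in> I \<rightarrow> carrier E" by auto
  with insert nrm_triangle[of "g i" "finsum E g I"] show ?case by auto
qed

lemma smult_finsum:
  assumes "finite I" "g \<in> I \<rightarrow> carrier E"
  shows "a \<odot> finsum E g I = finsum E (\<lambda>i. a \<odot> g i) I"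
  using assms
proof (induction I)
  case empty
  then show ?case by (simp add: smult_zero)
next
  case (insert i I)
  then have "g i \<in> carrier E" "g \<in> I \<rightarrow> carrier E" by auto
  with insert show ?case by (simp add: smult_add_right Pi_def smult_cl)
qed

lemma finsum_smult_left:
  assumes "finite I" "x \<in> carrier E"
  shows "finsum E (\<lambda>i. c i \<odot> x) I = sum c I \<odot> x"
  using assms
proof (induction I)
  case empty
  then show ?case by (simp add: smult_0)
next
  case (insert i I)
  then show ?case by (simp add: smult_add_left Pi_def smult_cl)
qed

lemma metric: "Metric_space (carrier E) (ndist E)"
proof
  fix x y z
  show "0 \<le> ndist E x y" by (simp add: ndist_def nrm_nonneg)
  show "ndist E x y = ndist E y x" by (simp add: ndist_def nrm_diff_commute)
  show "ndist E x y = 0 \<longleftrightarrow> x = y" if "x \<in> carrier E" "y \<in> carrier E"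
    using that diff_0D by (auto simp: ndist_def nrm_eq_0_iff diff_self nrm_zero)
  show "ndist E x z \<le> ndist E x y + ndist E y z"
    if "x \<in> carrier E" "y \<in> carrier E" "z \<in> carrier E"
    using that nrm_diff_triangle by (simp add: ndist_def)
qed

sublocale met: Metric_space "carrier E" "ndist E"
  by (rule metric)

lemma topspace_ntop: "topspace (ntop E) = carrier E"
  by (simp add: ntop_def)

text \<open>Convergence is expressed by real null sequences of norms, so that limits of vectors
  reduce to limits of real numbers. Here the triangle inequality through \<open>u k\<close> bounds
  the distance of the two limits by a null sequence.\<close>

lemma tendsto_unique:
  assumes "\<And>k. u k \<in> carrier E" "l \<in> carrier E" "l' \<in> carrier E"
    and "(\<lambda>k. nrm E (u k \<ominus> l)) \<longlonglongrightarrow> 0" "(\<lambda>k. nrm E (u k \<ominus> l')) \<longlonglongrightarrow> 0"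
  shows "l = l'"
proof -
  have "(\<lambda>k. nrm E (u k \<ominus> l) + nrm E (u k \<ominus> l')) \<longlonglongrightarrow> 0"
    using tendsto_add[OF assms(4,5)] by simp
  moreover have "nrm E (l \<ominus> l') \<le> nrm E (u k \<ominus> l) + nrm E (u k \<ominus> l')" for k
    using nrm_diff_triangle[of l "u k" l'] nrm_diff_commute[of l "u k"] assms(1-3) by simp
  ultimately have "nrm E (l \<ominus> l') \<le> 0"
    by (intro LIMSEQ_le_const) auto
  moreover have cl: "l \<ominus> l' \<in> carrier E"
    using assms by (intro diff_cl)
  ultimately have "l \<ominus> l' = \<zero>"
    using nrm_nonneg[OF cl] nrm_eq_0_iff[OF cl] by linarith
  then show ?thesis
    by (rule diff_0D[OF assms(2,3)])
qed

lemma tendsto_add: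
  assumes "\<And>k. u k \<in> carrier E" "\<And>k. v k \<in> carrier E" "l \<in> carrier E" "l' \<in> carrier E"
    and "(\<lambda>k. nrm E (u k \<ominus> l)) \<longlonglongrightarrow> 0" "(\<lambda>k. nrm E (v k \<ominus> l')) \<longlonglongrightarrow> 0"
  shows "(\<lambda>k. nrm E ((u k \<oplus> v k) \<ominus> (l \<oplus> l'))) \<longlonglongrightarrow> 0"
proof (rule tendsto_sandwich[OF _ _ tendsto_const])
  show "(\<lambda>k. nrm E (u k \<ominus> l) + nrm E (v k \<ominus> l')) \<longlonglongrightarrow> 0"
    using Limits.tendsto_add[OF assms(5,6)] by simp
qed (use assms in \<open>auto intro!: always_eventually simp: nrm_nonneg nrm_triangle add_diff_add\<close>)

lemma tendsto_smult:
  assumes "\<And>k. u k \<in> carrier E" "l \<in> carrier E" and "(\<lambda>k. nrm E (u k \<ominus> l)) \<longlonglongrightarrow> 0"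
  shows "(\<lambda>k. nrm E (a \<odot> u k \<ominus> a \<odot> l)) \<longlonglongrightarrow> 0"
proof -
  have "nrm E (a \<odot> u k \<ominus> a \<odot> l) = norm a * nrm E (u k \<ominus> l)" for k
    using assms smult_diff[of "u k" l a] nrm_smult[of "u k \<ominus> l" a] by simp
  then show ?thesis using tendsto_mult_right_zero[OF assms(3)] by simp
qed

text \<open>Closed balls are closed under limits. The bound is asked for from \<open>N\<close> on,
  which is the form in which a Cauchy estimate passes to the limit.\<close>

lemma tendsto_nrm_diff_le:
  assumes "\<And>k. u k \<in> carrier E" "l \<in> carrier E" "x \<in> carrier E"
    and "(\<lambda>k. nrm E (u k \<ominus> l)) \<longlonglongrightarrow> 0" and "\<And>k. k \<ge> N \<Longrightarrow> nrm E (u k \<ominus> x) \<le> C"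
  shows "nrm E (l \<ominus> x) \<le> C"
proof -
  have "(\<lambda>k. nrm E (u k \<ominus> l) + C) \<longlonglongrightarrow> 0 + C"
    by (intro Limits.tendsto_add assms tendsto_const)
  moreover have "nrm E (l \<ominus> x) \<le> nrm E (u k \<ominus> l) + C" if "k \<ge> N" for k
    using nrm_diff_triangle[of l "u k" x] nrm_diff_commute[of l "u k"] assms(1-3) assms(5)[OF that]
    by simp
  ultimately show ?thesis by (intro LIMSEQ_le_const) auto
qed

end

sublocale banach_space \<subseteq> normed_space
  by unfold_locales (fact nrm_eq_0_iff nrm_nonneg nrm_smult nrm_triangle)+

context banach_space
begin

text \<open>Restated because facts inherited from \<open>normed_space\<close> have no name qualified by \<open>banach_space\<close>.\<close>

lemmas zero_cl = zero_cl and smult_cl = smult_cl and metric = metric and nrm_zero = nrm_zero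
  and topspace_ntop = topspace_ntop and diff_self = diff_self
  and nrm_diff_commute = nrm_diff_commute and nrm_le_diff = nrm_le_diff

lemma cauchy_convergent:
  assumes u: "\<And>k. u k \<in> carrier E"
    and cauchy: "\<And>\<epsilon>. 0 < \<epsilon> \<Longrightarrow> \<exists>M. \<forall>k\<ge>M. \<forall>l\<ge>M. nrm E (u k \<ominus> u l) < \<epsilon>"
  obtains l where "l \<in> carrier E" "(\<lambda>k. nrm E (u k \<ominus> l)) \<longlonglongrightarrow> 0"
proof -
  have "met.MCauchy u"
    unfolding met.MCauchy_def using u cauchy by (simp add: ndist_def image_subset_iff)
  then obtain l where "limitin met.mtopology u l sequentially"
    using complete met.mcomplete_def by blast
  then have "l \<in> carrier E" and l: "\<forall>\<epsilon>>0. \<exists>N. \<forall>n\<ge>N. ndist E (u n) l < \<epsilon>"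
    unfolding met.limit_metric_sequentially by (blast, meson)
  moreover have "(\<lambda>k. nrm E (u k \<ominus> l)) \<longlonglongrightarrow> 0"
    using l u \<open>l \<in> carrier E\<close> by (auto simp: LIMSEQ_iff ndist_def nrm_nonneg)
  ultimately show ?thesis using that by blast
qed

end

section \<open>Banach spaces from explicit operations\<close>

lemma cring_scalar_ring: "cring (scalar_ring :: 'k :: field ring)"
proof (rule cringI)
  show "abelian_group (scalar_ring :: 'k ring)"
    by (rule abelian_groupI) (auto simp: scalar_ring_def add.assoc add.commute intro: exI[of _ "- _"])
  show "comm_monoid (scalar_ring :: 'k ring)"
    by (rule comm_monoidI) (auto simp: scalar_ring_def mult.assoc mult.commute)
qed (auto simp: scalar_ring_def algebra_simps)

text \<open>Inverses exist as multiples by -1, which yields the group laws. Completeness is phrased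
  with \<open>x \<oplus> (-1) \<odot> y\<close> because subtraction in a record goes through its
  additive inverse, which is awkward to compute before the group laws are available.\<close>

lemma banach_spaceI:
  fixes E :: "('k :: {real_normed_field, banach}, 'a) normed_module" (structure)
  assumes "\<zero> \<in> carrier E"
    and "\<And>x y. x \<in> carrier E \<Longrightarrow> y \<in> carrier E \<Longrightarrow> x \<oplus> y \<in> carrier E"
    and "\<And>a x. x \<in> carrier E \<Longrightarrow> a \<odot> x \<in> carrier E"
    and "\<And>x y z. x \<in> carrier E \<Longrightarrow> y \<in> carrier E \<Longrightarrow> z \<in> carrier E \<Longrightarrow> (x \<oplus> y) \<oplus> z = x \<oplus> (y \<oplus> z)"
    and "\<And>x y. x \<in> carrier E \<Longrightarrow> y \<in> carrier E \<Longrightarrow> x \<oplus> y = y \<oplus> x"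
    and "\<And>x. x \<in> carrier E \<Longrightarrow> \<zero> \<oplus> x = x"
    and smult_add_left: "\<And>a b x. x \<in> carrier E \<Longrightarrow> (a + b) \<odot> x = a \<odot> x \<oplus> b \<odot> x"
    and "\<And>a x y. x \<in> carrier E \<Longrightarrow> y \<in> carrier E \<Longrightarrow> a \<odot> (x \<oplus> y) = a \<odot> x \<oplus> a \<odot> y"
    and "\<And>a b x. x \<in> carrier E \<Longrightarrow> (a * b) \<odot> x = a \<odot> (b \<odot> x)"
    and smult_1: "\<And>x. x \<in> carrier E \<Longrightarrow> 1 \<odot> x = x" and smult_0: "\<And>x. x \<in> carrier E \<Longrightarrow> 0 \<odot> x = \<zero>"
    and "\<And>x. x \<in> carrier E \<Longrightarrow> nrm E x = 0 \<longleftrightarrow> x = \<zero>"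
    and "\<And>x. x \<in> carrier E \<Longrightarrow> 0 \<le> nrm E x"
    and "\<And>a x. x \<in> carrier E \<Longrightarrow> nrm E (a \<odot> x) = norm a * nrm E x"
    and "\<And>x y. x \<in> carrier E \<Longrightarrow> y \<in> carrier E \<Longrightarrow> nrm E (x \<oplus> y) \<le> nrm E x + nrm E y"
    and complete: "\<And>u. (\<And>k. u k \<in> carrier E)
      \<Longrightarrow> (\<And>\<epsilon>. 0 < \<epsilon> \<Longrightarrow> \<exists>M. \<forall>k\<ge>M. \<forall>l\<ge>M. nrm E (u k \<oplus> (-1) \<odot> u l) < \<epsilon>)
      \<Longrightarrow> \<exists>l\<in>carrier E. (\<lambda>k. nrm E (u k \<oplus> (-1) \<odot> l)) \<longlonglongrightarrow> 0"
  shows "banach_space E"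
proof -
  have inv: "\<exists>y\<in>carrier E. y \<oplus> x = \<zero>" if x: "x \<in> carrier E" for x
  proof
    have "(-1) \<odot> x \<oplus> x = (-1 + 1) \<odot> x" unfolding smult_add_left[OF x] smult_1[OF x] ..
    then show "(-1) \<odot> x \<oplus> x = \<zero>" by (simp add: smult_0[OF x])
  qed (rule assms(3)[OF x])
  \<comment> \<open>The norm laws alone already supply the metric, so completeness can be checked
    inside this interpretation.\<close>
  interpret normed_space E
  proof (intro normed_space.intro normed_space_axioms.intro)
    have "abelian_group E" by (rule abelian_groupI[OF assms(2,1,4,5,6) inv])
    then show "module scalar_ring E"
      by (intro moduleI cring_scalar_ring) (simp_all add: scalar_ring_def assms)
  qed (fact assms)+
  have "met.mcomplete"
    unfolding met.mcomplete_def
  proof (intro allI impI)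
    fix u assume u: "met.MCauchy u"
    then have cl: "u k \<in> carrier E" for k by (auto simp: met.MCauchy_def)
    have cauchy: "\<exists>M. \<forall>k\<ge>M. \<forall>l\<ge>M. nrm E (u k \<oplus> (-1) \<odot> u l) < \<epsilon>" if "0 < \<epsilon>" for \<epsilon>
      using u that cl by (simp add: met.MCauchy_def ndist_def diff_eq)
    obtain l where l: "l \<in> carrier E" "(\<lambda>k. nrm E (u k \<oplus> (-1) \<odot> l)) \<longlonglongrightarrow> 0"
      by (rule bexE[OF complete[OF cl cauchy]])
    have lim: "\<exists>N. \<forall>n\<ge>N. ndist E (u n) l < \<epsilon>" if "0 < \<epsilon>" for \<epsilon>
      using order_tendstoD(2)[OF l(2) that] cl l(1) by (simp add: ndist_def diff_eq eventually_sequentially)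
    show "\<exists>l. limitin met.mtopology u l sequentially"
      by (rule exI[of _ l]) (simp add: met.limit_metric_sequentially l(1) cl lim)
  qed
  then show ?thesis
    by (intro banach_space.intro banach_space_axioms.intro module_axioms
        nrm_eq_0_iff nrm_nonneg nrm_smult nrm_triangle)
qed

section \<open>Bounded multilinear operators\<close>

lemma (in abelian_monoid) finsum_swap:
  assumes "finite A" "finite B" "\<And>a b. a \<in> A \<Longrightarrow> b \<in> B \<Longrightarrow> g a b \<in> carrier G"
  shows "finsum G (\<lambda>a. finsum G (g a) B) A = finsum G (\<lambda>b. finsum G (\<lambda>a. g a b) A) B"
  using assms(1,3)
proof (induction A)
  case empty
  then show ?case by (simp add: finsum_zero)
next
  case (insert a A)
  have "finsum G (\<lambda>a. finsum G (g a) B) (insert a A)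
      = finsum G (g a) B \<oplus> finsum G (\<lambda>a. finsum G (g a) B) A"
    using insert by (subst finsum_insert) (auto intro!: finsum_closed)
  also have "\<dots> = finsum G (g a) B \<oplus> finsum G (\<lambda>b. finsum G (\<lambda>a. g a b) A) B"
    using insert by simp
  also have "\<dots> = finsum G (\<lambda>b. g a b \<oplus> finsum G (\<lambda>a. g a b) A) B"
    using insert by (subst finsum_addf) (auto intro!: finsum_closed)
  also have "\<dots> = finsum G (\<lambda>b. finsum G (\<lambda>a. g a b) (insert a A)) B"
    using insert by (intro finsum_cong') (auto intro!: finsum_closed)
  finally show ?case .
qed

lemma (in abelian_monoid) finsum_Times:
  assumes "finite A" "finite B" "g \<in> A \<times> B \<rightarrow> carrier G"
  shows "finsum G (\<lambda>a. finsum G (\<lambda>b. g (a, b)) B) A = finsum G g (A \<times> B)"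
  using assms(1,3)
proof (induction A)
  case empty
  then show ?case by simp
next
  case (insert a A)
  have eq: "insert a A \<times> B = Pair a ` B \<union> A \<times> B" by auto
  have "finsum G g (insert a A \<times> B) = finsum G g (Pair a ` B) \<oplus> finsum G g (A \<times> B)"
    unfolding eq using insert assms(2) by (intro finsum_Un_disjoint) auto
  also have "finsum G g (Pair a ` B) = finsum G (\<lambda>b. g (a, b)) B"
    using insert by (intro finsum_reindex) (auto simp: inj_on_def)
  moreover have "g \<in> A \<times> B \<rightarrow> carrier G" using insert by auto
  ultimately show ?case
    using insert by (subst finsum_insert) (auto intro!: finsum_closed)
qed

section \<open>Algebra of multilinear operators on tuples\<close>

abbreviation tuples :: "nat \<Rightarrow> (nat \<Rightarrow> ('k, 'a) normed_module) \<Rightarrow> (nat \<Rightarrow> 'a) set" where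
  "tuples n E \<equiv> \<Pi>\<^sub>E i\<in>{..<n}. carrier (E i)"

text \<open>The estimate is homogeneous in every entry rather than restricted to unit balls, so that
  constants multiply under composition. For \<open>n = 0\<close> the product is 1 and the condition
  bounds a single value.\<close>

definition bounded_by ::
    "nat \<Rightarrow> (nat \<Rightarrow> ('k, 'a) normed_module) \<Rightarrow> ('k, 'b) normed_module \<Rightarrow> ((nat \<Rightarrow> 'a) \<Rightarrow> 'b) \<Rightarrow> real \<Rightarrow> bool"
where
  "bounded_by n E F A C \<longleftrightarrow> (\<forall>x\<in>tuples n E. nrm F (A x) \<le> C * (\<Prod>i<n. nrm (E i) (x i)))"

locale multilinear_operator =
  fixes n :: nat and E :: "nat \<Rightarrow> ('k :: {real_normed_field, banach}, 'a) normed_module"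
    and F :: "('k, 'b) normed_module" and A
  assumes dom: "\<And>i. i < n \<Longrightarrow> banach_space (E i)" and cod: "banach_space F"
    and multilinear: "A \<in> multilinear n E F"
begin

sublocale cod: banach_space F
  by (rule cod)

lemma op_cl: "x \<in> tuples n E \<Longrightarrow> A x \<in> carrier F"
  using multilinear by (auto simp: multilinear_def)

lemma op_ext: "A \<in> extensional (tuples n E)"
  using multilinear by (auto simp: multilinear_def PiE_def)

lemma upd_cl: "x \<in> tuples n E \<Longrightarrow> i < n \<Longrightarrow> u \<in> carrier (E i) \<Longrightarrow> x(i := u) \<in> tuples n E"
  by (auto simp: PiE_def extensional_def)

lemma entry_cl: "x \<in> tuples n E \<Longrightarrow> i < n \<Longrightarrow> x i \<in> carrier (E i)"
  by (auto simp: PiE_def)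

text \<open>In \<open>multilinear\<close> the new vector is added to the entry already present.
  Overwriting slot \<open>i\<close> by \<open>u\<close> first gives this form, in which neither
  summand refers to the old entry.\<close>

lemma op_add:
  assumes "x \<in> tuples n E" "i < n" "u \<in> carrier (E i)" "v \<in> carrier (E i)"
  shows "A (x(i := u \<oplus>\<^bsub>E i\<^esub> v)) = A (x(i := u)) \<oplus>\<^bsub>F\<^esub> A (x(i := v))"
proof -
  have "\<forall>y\<in>carrier (E i). A ((x(i := u))(i := (x(i := u)) i \<oplus>\<^bsub>E i\<^esub> y))
      = A (x(i := u)) \<oplus>\<^bsub>F\<^esub> A ((x(i := u))(i := y))"
    using multilinear upd_cl[OF assms(1-3)] assms(2) unfolding multilinear_def by blast
  then show ?thesis using assms(4) by simp
qed

lemma op_smult: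
  assumes "x \<in> tuples n E" "i < n" "u \<in> carrier (E i)"
  shows "A (x(i := a \<odot>\<^bsub>E i\<^esub> u)) = a \<odot>\<^bsub>F\<^esub> A (x(i := u))"
proof -
  have "A ((x(i := u))(i := a \<odot>\<^bsub>E i\<^esub> (x(i := u)) i)) = a \<odot>\<^bsub>F\<^esub> A (x(i := u))"
    using multilinear upd_cl[OF assms(1-3)] assms(2) unfolding multilinear_def by blast
  then show ?thesis by simp
qed

lemma op_diff:
  assumes "x \<in> tuples n E" "i < n" "u \<in> carrier (E i)" "v \<in> carrier (E i)"
  shows "A (x(i := u \<ominus>\<^bsub>E i\<^esub> v)) = A (x(i := u)) \<ominus>\<^bsub>F\<^esub> A (x(i := v))"
proof -
  interpret Ei: banach_space "E i" by (rule dom[OF assms(2)])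
  show ?thesis
    using assms
    by (simp add: Ei.diff_eq cod.diff_eq op_add op_smult Ei.smult_cl op_cl upd_cl)
qed

lemma op_zero_upd:
  assumes "x \<in> tuples n E" "i < n"
  shows "A (x(i := \<zero>\<^bsub>E i\<^esub>)) = \<zero>\<^bsub>F\<^esub>"
proof -
  interpret Ei: banach_space "E i" by (rule dom[OF assms(2)])
  have "A (x(i := 0 \<odot>\<^bsub>E i\<^esub> \<zero>\<^bsub>E i\<^esub>)) = 0 \<odot>\<^bsub>F\<^esub> A (x(i := \<zero>\<^bsub>E i\<^esub>))"
    by (rule op_smult[OF assms Ei.zero_cl])
  then show ?thesis
    using cod.smult_0[OF op_cl[OF upd_cl[OF assms Ei.zero_cl]]] by (simp add: Ei.smult_zero)
qed

lemma op_zero: "x \<in> tuples n E \<Longrightarrow> i < n \<Longrightarrow> x i = \<zero>\<^bsub>E i\<^esub> \<Longrightarrow> A x = \<zero>\<^bsub>F\<^esub>"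
  using op_zero_upd[of x i] by (metis fun_upd_triv)

lemma op_finsum:
  assumes "finite I" "g \<in> I \<rightarrow> carrier (E i)" "x \<in> tuples n E" "i < n"
  shows "A (x(i := finsum (E i) g I)) = finsum F (\<lambda>j. A (x(i := g j))) I"
proof -
  interpret Ei: banach_space "E i" by (rule dom[OF assms(4)])
  show ?thesis using assms(1,2)
  proof (induction I)
    case empty
    then show ?case using op_zero_upd[OF assms(3,4)] by (simp add: fun_upd_def)
  next
    case (insert j I)
    then have "finsum (E i) g I \<in> carrier (E i)" by (intro Ei.finsum_closed) auto
    moreover have "g j \<in> carrier (E i)" "(\<lambda>j. A (x(i := g j))) \<in> I \<rightarrow> carrier F"
      using insert assms(3,4) by (auto intro!: op_cl upd_cl)
    moreover have "finsum (E i) g (insert j I) = g j \<oplus>\<^bsub>E i\<^esub> finsum (E i) g I"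
      using insert by (intro Ei.finsum_insert) auto
    moreover have "finsum F (\<lambda>j. A (x(i := g j))) (insert j I)
        = A (x(i := g j)) \<oplus>\<^bsub>F\<^esub> finsum F (\<lambda>j. A (x(i := g j))) I"
      using insert.prems
      by (intro cod.finsum_insert insert.hyps) (auto intro!: op_cl upd_cl[OF assms(3,4)])
    moreover have "A (x(i := finsum (E i) g I)) = finsum F (\<lambda>j. A (x(i := g j))) I"
      by (rule insert.IH) (use insert.prems in auto)
    ultimately show ?case
      by (simp only: op_add[OF assms(3,4)])
  qed
qed

lemma op_smult_all:
  assumes x: "x \<in> tuples n E"
  shows "A (\<lambda>i\<in>{..<n}. c i \<odot>\<^bsub>E i\<^esub> x i) = (\<Prod>i<n. c i) \<odot>\<^bsub>F\<^esub> A x"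
proof -
  \<comment> \<open>Hybrid tuple with the slots below \<open>m\<close> scaled: consecutive ones
    differ only in slot \<open>m\<close>, so the scalars come out one at a time.\<close>
  define h where "h m = (\<lambda>i\<in>{..<n}. if i < m then c i \<odot>\<^bsub>E i\<^esub> x i else x i)" for m
  have h: "h m \<in> tuples n E" for m
    using x dom by (auto simp: h_def PiE_iff intro!: banach_space.smult_cl)
  have "A (h m) = (\<Prod>i<m. c i) \<odot>\<^bsub>F\<^esub> A x" if "m \<le> n" for m
    using that
  proof (induction m)
    case 0
    have "h 0 = x" using x by (auto simp: h_def PiE_def extensional_def)
    then show ?case using x by (simp add: cod.smult_1 op_cl)
  next
    case (Suc m)
    then have m: "m < n" by simp
    have "h (Suc m) = (h m)(m := c m \<odot>\<^bsub>E m\<^esub> x m)" and 2: "(h m)(m := x m) = h m"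
      using m by (auto simp: h_def fun_eq_iff)
    then have "A (h (Suc m)) = c m \<odot>\<^bsub>F\<^esub> A (h m)"
      using op_smult[OF h[of m] m, of "x m" "c m"] m x by auto
    then show ?case using Suc x by (simp add: cod.smult_smult op_cl mult.commute)
  qed
  from this[of n] have "A (h n) = (\<Prod>i<n. c i) \<odot>\<^bsub>F\<^esub> A x" by simp
  moreover have "h n = (\<lambda>i\<in>{..<n}. c i \<odot>\<^bsub>E i\<^esub> x i)" by (auto simp: h_def fun_eq_iff)
  ultimately show ?thesis by simp
qed

lemma zero_tuple: "(\<lambda>i\<in>{..<n}. \<zero>\<^bsub>E i\<^esub>) \<in> tuples n E"
proof -
  have "\<zero>\<^bsub>E i\<^esub> \<in> carrier (E i)" if "i < n" for i
    using banach_space.zero_cl[OF dom[OF that]] .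
  then show ?thesis by auto
qed

lemma nrm_entry_nonneg: "x \<in> tuples n E \<Longrightarrow> i < n \<Longrightarrow> 0 \<le> nrm (E i) (x i)"
  using banach_space.nrm_nonneg[OF dom] by auto

text \<open>Normalizing every entry moves a tuple into the unit ball, and homogeneity in all slots
  moves the estimate back. A zero entry cannot be normalized, but then both sides vanish.\<close>

lemma bounded_by_unit_ball:
  assumes ball: "\<And>x. x \<in> tuples n E \<Longrightarrow> (\<And>i. i < n \<Longrightarrow> nrm (E i) (x i) \<le> 1) \<Longrightarrow> nrm F (A x) \<le> C"
  shows "bounded_by n E F A C"
  unfolding bounded_by_def
proof
  fix x assume x: "x \<in> tuples n E"
  show "nrm F (A x) \<le> C * (\<Prod>i<n. nrm (E i) (x i))"
  proof (cases "\<exists>i<n. x i = \<zero>\<^bsub>E i\<^esub>")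
    case True
    then obtain i where i: "i < n" "x i = \<zero>\<^bsub>E i\<^esub>" by blast
    then have "nrm (E i) (x i) = 0" by (simp add: banach_space.nrm_zero[OF dom])
    then have "(\<Prod>i<n. nrm (E i) (x i)) = 0" using i(1) by (auto intro!: prod_zero)
    then show ?thesis by (simp only: op_zero[OF x i] cod.nrm_zero)
  next
    case False
    have pos: "0 < nrm (E i) (x i)" if "i < n" for i
      using False that nrm_entry_nonneg[OF x that] banach_space.nrm_eq_0_iff[OF dom[OF that], of "x i"] x
      by (metis entry_cl less_eq_real_def)
    let ?c = "\<lambda>i. of_real (inverse (nrm (E i) (x i))) :: 'k"
    let ?y = "\<lambda>i\<in>{..<n}. ?c i \<odot>\<^bsub>E i\<^esub> x i"
    have y: "?y \<in> tuples n E"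
      using x dom by (auto simp: PiE_iff intro!: banach_space.smult_cl)
    have "nrm F (A ?y) \<le> C"
    proof (rule ball[OF y])
      fix i assume i: "i < n"
      have "nrm (E i) (?y i) = norm (?c i) * nrm (E i) (x i)"
        using i banach_space.nrm_smult[OF dom[OF i] entry_cl[OF x i]] by simp
      also have "\<dots> = 1"
        unfolding norm_of_real using pos[OF i] by simp
      finally show "nrm (E i) (?y i) \<le> 1" by simp
    qed
    then have "norm (\<Prod>i<n. ?c i) * nrm F (A x) \<le> C"
      unfolding op_smult_all[OF x] by (simp only: cod.nrm_smult[OF op_cl[OF x]])
    also have "norm (\<Prod>i<n. ?c i) = inverse (\<Prod>i<n. nrm (E i) (x i))"
      unfolding prod_norm[symmetric] norm_of_real prod_inversef[symmetric]
      by (rule prod.cong) (use pos in \<open>auto simp: less_imp_le\<close>)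
    finally show ?thesis
      using prod_pos[of "{..<n}" "\<lambda>i. nrm (E i) (x i)"] pos by (simp add: field_simps)
  qed
qed

section \<open>Boundedness and continuity\<close>

lemma topspace_tuples: "topspace (product_topology (\<lambda>i. ntop (E i)) {..<n}) = tuples n E"
  unfolding topspace_product_topology
  by (rule PiE_cong) (simp add: banach_space.topspace_ntop[OF dom])

text \<open>A basic neighbourhood of the zero tuple is mapped into the unit ball around the value
  there. A common radius \<open>\<delta>\<close> fits into all its factors, and shrinking the unit
  ball by \<open>\<delta>\<close> multiplies values by \<open>\<delta> ^ n\<close>. The value at the
  zero tuple stays in the constant because it need not vanish when \<open>n = 0\<close>.\<close>

lemma continuous_imp_bounded_by:
  assumes "A \<in> cmultilinear n E F"
  obtains C where "0 \<le> C" "bounded_by n E F A C"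
proof -
  let ?T = "product_topology (\<lambda>i. ntop (E i)) {..<n}"
  let ?z = "\<lambda>i\<in>{..<n}. \<zero>\<^bsub>E i\<^esub>"
  note top = topspace_tuples
  have "continuous_map ?T (ntop F) A" using assms by (simp add: cmultilinear_def)
  then have "openin ?T {x \<in> topspace ?T. A x \<in> cod.met.mball (A ?z) 1}" (is "openin _ ?S")
    by (rule openin_continuous_map_preimage) (simp add: ntop_def)
  then have "\<forall>x\<in>?S. \<exists>U. finite {i \<in> {..<n}. U i \<noteq> topspace (ntop (E i))} \<and>
      (\<forall>i\<in>{..<n}. openin (ntop (E i)) (U i)) \<and> x \<in> PiE {..<n} U \<and> PiE {..<n} U \<subseteq> ?S"
    by (simp only: openin_product_topology_alt)
  moreover have "?z \<in> ?S"
    unfolding top using zero_tuple op_cl[OF zero_tuple] cod.met.centre_in_mball_iff by simp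
  ultimately obtain U where U: "\<And>i. i < n \<Longrightarrow> openin (ntop (E i)) (U i)" "?z \<in> PiE {..<n} U"
      "PiE {..<n} U \<subseteq> ?S"
    by (metis (no_types, lifting) lessThan_iff)
  have "\<exists>r>0. \<forall>v\<in>carrier (E i). nrm (E i) v < r \<longrightarrow> v \<in> U i" if i: "i < n" for i
  proof -
    interpret Ei: banach_space "E i" by (rule dom[OF i])
    have "\<zero>\<^bsub>E i\<^esub> \<in> U i" using U(2) i by (force simp: PiE_iff)
    then obtain r where "r > 0" "Ei.met.mball \<zero>\<^bsub>E i\<^esub> r \<subseteq> U i"
      using U(1)[OF i] by (auto simp: ntop_def Ei.met.openin_mtopology)
    moreover have "v \<in> Ei.met.mball \<zero>\<^bsub>E i\<^esub> r" if "v \<in> carrier (E i)" "nrm (E i) v < r" for v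
      using that Ei.nrm_diff_commute[of v "\<zero>\<^bsub>E i\<^esub>"] by (simp add: ndist_def Ei.diff_zero)
    ultimately show ?thesis by blast
  qed
  then obtain r where r: "\<And>i. i < n \<Longrightarrow> r i > 0"
      "\<And>i v. i < n \<Longrightarrow> v \<in> carrier (E i) \<Longrightarrow> nrm (E i) v < r i \<Longrightarrow> v \<in> U i"
    by metis
  \<comment> \<open>The inserted 1 keeps the minimum defined when \<open>n = 0\<close>; halving
    makes \<open>\<delta>\<close> strictly smaller than every radius.\<close>
  define \<delta> where "\<delta> = Min (insert 1 (r ` {..<n})) / 2"
  have \<delta>: "\<delta> > 0" "\<And>i. i < n \<Longrightarrow> \<delta> < r i"
  proof -
    have "Min (insert 1 (r ` {..<n})) > 0" using r(1) by (subst Min_gr_iff) auto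
    then show "\<delta> > 0" by (simp add: \<delta>_def)
    fix i assume "i < n"
    then have "Min (insert 1 (r ` {..<n})) \<le> r i" by (intro Min_le) auto
    then show "\<delta> < r i" using \<open>\<delta> > 0\<close> unfolding \<delta>_def by linarith
  qed
  define C where "C = (1 + nrm F (A ?z)) / \<delta> ^ n"
  have "bounded_by n E F A C"
  proof (rule bounded_by_unit_ball)
    fix x assume x: "x \<in> tuples n E" and le: "\<And>i. i < n \<Longrightarrow> nrm (E i) (x i) \<le> 1"
    let ?y = "\<lambda>i\<in>{..<n}. of_real \<delta> \<odot>\<^bsub>E i\<^esub> x i"
    have "?y i \<in> U i" if i: "i < n" for i
    proof (rule r(2)[OF i])
      show "?y i \<in> carrier (E i)"
        using x i dom by (auto intro!: banach_space.smult_cl)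
      have "nrm (E i) (?y i) = \<delta> * nrm (E i) (x i)"
        using i \<delta>(1) banach_space.nrm_smult[OF dom[OF i] entry_cl[OF x i]] by simp
      also have "\<dots> \<le> \<delta>" using \<delta>(1) le[OF i] by simp
      finally show "nrm (E i) (?y i) < r i" using \<delta>(2)[OF i] by simp
    qed
    then have "?y \<in> ?S" using U(3) by (intro subsetD[OF U(3)]) auto
    then have ball: "A ?y \<in> carrier F" "nrm F (A ?z \<ominus>\<^bsub>F\<^esub> A ?y) < 1"
      by (auto simp: ndist_def split: if_splits)
    have "nrm F (A ?y) \<le> nrm F (A ?y \<ominus>\<^bsub>F\<^esub> A ?z) + nrm F (A ?z)"
      by (intro cod.nrm_le_diff ball op_cl zero_tuple)
    also have "\<dots> \<le> 1 + nrm F (A ?z)"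
      using ball cod.nrm_diff_commute[OF ball(1) op_cl[OF zero_tuple]] by simp
    finally have "\<delta> ^ n * nrm F (A x) \<le> 1 + nrm F (A ?z)"
      unfolding op_smult_all[OF x] cod.nrm_smult[OF op_cl[OF x]] using \<delta>(1)
      by (simp add: norm_power)
    then show "nrm F (A x) \<le> C"
      using \<delta>(1) by (simp add: C_def field_simps)
  qed
  moreover have "0 \<le> C"
    using \<delta>(1) cod.nrm_nonneg[OF op_cl[OF zero_tuple]] by (simp add: C_def)
  ultimately show ?thesis using that by blast
qed

text \<open>The difference telescopes over tuples whose first \<open>m\<close> entries are those of
  \<open>y\<close> and the others those of \<open>x\<close>. Each step changes one slot and costs at
  most \<open>C * R ^ (n - 1) * \<delta>\<close>; the condition \<open>1 \<le> R\<close> rounds the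
  exponent up to \<open>n\<close>.\<close>

lemma bounded_by_diff:
  fixes C R \<delta> :: real
  assumes bound: "bounded_by n E F A C" and C: "0 \<le> C" and R: "1 \<le> R"
    and x: "x \<in> tuples n E" and y: "y \<in> tuples n E"
    and xR: "\<And>i. i < n \<Longrightarrow> nrm (E i) (x i) \<le> R" and yR: "\<And>i. i < n \<Longrightarrow> nrm (E i) (y i) \<le> R"
    and \<delta>: "\<And>i. i < n \<Longrightarrow> nrm (E i) (y i \<ominus>\<^bsub>E i\<^esub> x i) \<le> \<delta>"
  shows "nrm F (A y \<ominus>\<^bsub>F\<^esub> A x) \<le> n * (C * R ^ n * \<delta>)"
proof -
  define h where "h m = (\<lambda>i\<in>{..<n}. if i < m then y i else x i)" for m
  have h: "h m \<in> tuples n E" for m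
    using x y by (auto simp: h_def PiE_iff)
  have h0: "h 0 = x" and hn: "h n = y"
    using x y by (auto simp: h_def PiE_def extensional_def)
  have step: "nrm F (A (h (Suc m)) \<ominus>\<^bsub>F\<^esub> A (h m)) \<le> C * R ^ n * \<delta>" if m: "m < n" for m
  proof -
    interpret Em: banach_space "E m" by (rule dom[OF m])
    have ym: "y m \<in> carrier (E m)" and xm: "x m \<in> carrier (E m)" using x y m by auto
    let ?d = "(h m)(m := y m \<ominus>\<^bsub>E m\<^esub> x m)"
    have "h (Suc m) = (h m)(m := y m)" and "(h m)(m := x m) = h m"
      using m by (auto simp: h_def fun_eq_iff)
    then have "A (h (Suc m)) \<ominus>\<^bsub>F\<^esub> A (h m) = A ?d"
      using op_diff[OF h m ym xm] by simp
    moreover have "nrm F (A ?d) \<le> C * (\<Prod>i<n. nrm (E i) (?d i))"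
      using bound upd_cl[OF h m Em.diff_cl[OF ym xm]] by (simp only: bounded_by_def)
    moreover have "(\<Prod>i<n. nrm (E i) (?d i)) \<le> R ^ n * \<delta>"
    proof -
      have "0 \<le> \<delta>" using \<delta>[OF m] Em.nrm_nonneg[OF Em.diff_cl[OF ym xm]] by simp
      have "(\<Prod>i<n. nrm (E i) (?d i))
          = nrm (E m) (y m \<ominus>\<^bsub>E m\<^esub> x m) * (\<Prod>i\<in>{..<n} - {m}. nrm (E i) (?d i))"
        using m by (subst prod.remove[of _ m]) auto
      also have "\<dots> \<le> \<delta> * (\<Prod>i\<in>{..<n} - {m}. R)"
      proof (intro mult_mono prod_mono conjI)
        show "0 \<le> (\<Prod>i\<in>{..<n} - {m}. nrm (E i) (?d i))"
          using nrm_entry_nonneg[OF h] by (intro prod_nonneg) auto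
      qed (use \<delta> m xR yR nrm_entry_nonneg[OF h] \<open>0 \<le> \<delta>\<close> in \<open>auto simp: h_def\<close>)
      also have "\<dots> \<le> \<delta> * R ^ n"
        using R m \<open>0 \<le> \<delta>\<close>
        by (intro mult_left_mono) (auto simp: card_Diff_singleton intro!: power_increasing)
      finally show ?thesis by (simp add: mult.commute)
    qed
    ultimately show ?thesis using C by (smt (verit) mult.assoc mult_left_mono)
  qed
  have "nrm F (A (h m) \<ominus>\<^bsub>F\<^esub> A x) \<le> m * (C * R ^ n * \<delta>)" if "m \<le> n" for m
    using that
  proof (induction m)
    case 0
    then show ?case using h0 x by (simp add: cod.diff_self op_cl cod.nrm_zero)
  next
    case (Suc m)
    have "nrm F (A (h (Suc m)) \<ominus>\<^bsub>F\<^esub> A x)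
        \<le> nrm F (A (h (Suc m)) \<ominus>\<^bsub>F\<^esub> A (h m)) + nrm F (A (h m) \<ominus>\<^bsub>F\<^esub> A x)"
      by (intro cod.nrm_diff_triangle op_cl h x)
    also have "\<dots> \<le> C * R ^ n * \<delta> + m * (C * R ^ n * \<delta>)"
      using Suc step[of m] by simp
    finally show ?case by (simp add: algebra_simps)
  qed
  from this[of n] show ?thesis by (simp add: hn)
qed

text \<open>A bounded operator is Lipschitz on bounded sets, and a product of small balls is an open
  neighbourhood in the finite product topology.\<close>

lemma bounded_by_imp_continuous:
  assumes bound: "bounded_by n E F A C" and C: "0 \<le> C"
  shows "A \<in> cmultilinear n E F"
proof -
  let ?T = "product_topology (\<lambda>i. ntop (E i)) {..<n}"
  note top = topspace_tuples
  have "continuous_map ?T (ntop F) A"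
    unfolding ntop_def cod.met.continuous_map_to_metric unfolding ntop_def[symmetric] top
  proof (intro ballI allI impI)
    fix x and \<epsilon> :: real assume x: "x \<in> tuples n E" and \<epsilon>: "0 < \<epsilon>"
    define R where "R = 1 + (\<Sum>i<n. nrm (E i) (x i))"
    \<comment> \<open>The bound 1 keeps neighbours of \<open>x\<close> within radius
      \<open>R\<close>; the quotient makes the Lipschitz estimate at most
      \<open>\<epsilon> / 2\<close>. The summand 1 in the denominator rules out division by
      zero.\<close>
    define \<delta> where "\<delta> = min 1 (\<epsilon> / (2 * (1 + n * (C * R ^ n))))"
    have xle: "nrm (E i) (x i) \<le> R - 1" if "i < n" for i
      using member_le_sum[of i "{..<n}" "\<lambda>i. nrm (E i) (x i)"] that nrm_entry_nonneg[OF x]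
      by (simp add: R_def)
    have R: "1 \<le> R" using nrm_entry_nonneg[OF x] by (auto simp: R_def intro!: sum_nonneg)
    have pos: "0 < 1 + n * (C * R ^ n)" using C R by (simp add: add_pos_nonneg)
    then have \<delta>: "0 < \<delta>" "\<delta> \<le> 1" using \<epsilon> by (auto simp: \<delta>_def)
    have small: "n * (C * R ^ n * \<delta>) < \<epsilon>"
    proof -
      have half: "D * (\<epsilon> / (2 * D)) = \<epsilon> / 2" if "0 < D" for D :: real
        using that by simp
      have "n * (C * R ^ n * \<delta>) \<le> (1 + n * (C * R ^ n)) * \<delta>"
        using \<delta>(1) by (simp add: algebra_simps)
      also have "\<dots> \<le> (1 + n * (C * R ^ n)) * (\<epsilon> / (2 * (1 + n * (C * R ^ n))))"
        using pos by (intro mult_left_mono) (auto simp: \<delta>_def)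
      also have "\<dots> = \<epsilon> / 2" by (rule half[OF pos])
      finally show ?thesis using \<epsilon> by simp
    qed
    let ?U = "\<Pi>\<^sub>E i\<in>{..<n}. Metric_space.mball (carrier (E i)) (ndist (E i)) (x i) \<delta>"
    have memU: "y \<in> ?U \<longleftrightarrow> y \<in> tuples n E \<and> (\<forall>i<n. nrm (E i) (x i \<ominus>\<^bsub>E i\<^esub> y i) < \<delta>)" for y
      using x by (auto simp: PiE_iff Metric_space.in_mball[OF banach_space.metric[OF dom]] ndist_def)
    have "openin ?T ?U"
      unfolding ntop_def
      by (subst openin_PiE) (auto intro!: Metric_space.openin_mball banach_space.metric dom)
    moreover have "nrm (E i) (x i \<ominus>\<^bsub>E i\<^esub> x i) = 0" if "i < n" for i
      by (simp only: banach_space.diff_self[OF dom[OF that] entry_cl[OF x that]]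
          banach_space.nrm_zero[OF dom[OF that]])
    then have "x \<in> ?U"
      unfolding memU using x \<delta>(1) by simp
    moreover have "A y \<in> cod.met.mball (A x) \<epsilon>" if "y \<in> ?U" for y
    proof -
      have y: "y \<in> tuples n E" and d: "\<And>i. i < n \<Longrightarrow> nrm (E i) (x i \<ominus>\<^bsub>E i\<^esub> y i) < \<delta>"
        using that memU by auto
      have d': "nrm (E i) (y i \<ominus>\<^bsub>E i\<^esub> x i) \<le> \<delta>" if i: "i < n" for i
        using d[OF i] banach_space.nrm_diff_commute[OF dom[OF i] entry_cl[OF x i] entry_cl[OF y i]]
        by simp
      have "nrm F (A y \<ominus>\<^bsub>F\<^esub> A x) \<le> n * (C * R ^ n * \<delta>)"
      proof (rule bounded_by_diff[OF bound C R x y _ _ d'])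
        fix i assume i: "i < n"
        show "nrm (E i) (x i) \<le> R" using xle[OF i] by simp
        show "nrm (E i) (y i) \<le> R"
          using banach_space.nrm_le_diff[OF dom[OF i] entry_cl[OF y i] entry_cl[OF x i]] d'[OF i]
            xle[OF i] \<delta>(2) by simp
      qed
      then show ?thesis
        using small op_cl[OF x] op_cl[OF y] by (simp add: ndist_def cod.nrm_diff_commute)
    qed
    ultimately show "\<exists>U. openin ?T U \<and> x \<in> U \<and> (\<forall>y\<in>U. A y \<in> cod.met.mball (A x) \<epsilon>)"
      by blast
  qed
  then show ?thesis using multilinear by (simp add: cmultilinear_def)
qed

text \<open>Some bound \<open>C\<close> has to be given, since a supremum of reals behaves as one
  only for sets bounded above. The operator norm is then itself an admissible constant and lies
  below every nonnegative one.\<close>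

lemma multilinear_norm_nonneg_bound:
  assumes "bounded_by n E F A C" "0 \<le> C"
  shows "multilinear_norm n E F A \<le> C" "0 \<le> multilinear_norm n E F A"
    "bounded_by n E F A (multilinear_norm n E F A)"
proof -
  let ?B = "{x \<in> tuples n E. \<forall>i<n. nrm (E i) (x i) \<le> 1}"
  have z: "(\<lambda>i\<in>{..<n}. \<zero>\<^bsub>E i\<^esub>) \<in> ?B"
    using zero_tuple by (auto simp: banach_space.nrm_zero[OF dom])
  have le: "nrm F (A x) \<le> C" if "x \<in> ?B" for x
  proof -
    have "nrm F (A x) \<le> C * (\<Prod>i<n. nrm (E i) (x i))"
      using assms(1) that by (auto simp: bounded_by_def)
    also have "(\<Prod>i<n. nrm (E i) (x i)) \<le> 1"
      using that nrm_entry_nonneg by (intro prod_le_1) auto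
    then have "C * (\<Prod>i<n. nrm (E i) (x i)) \<le> C"
      using assms(2) by (simp add: mult_left_le)
    finally show ?thesis .
  qed
  then have bdd: "bdd_above ((\<lambda>x. nrm F (A x)) ` ?B)" by (auto intro!: bdd_aboveI2)
  show "multilinear_norm n E F A \<le> C"
    unfolding multilinear_norm_def by (rule cSUP_least) (use z le in blast)+
  have "0 \<le> nrm F (A (\<lambda>i\<in>{..<n}. \<zero>\<^bsub>E i\<^esub>))" using op_cl[OF zero_tuple] by (rule cod.nrm_nonneg)
  also have "\<dots> \<le> multilinear_norm n E F A"
    unfolding multilinear_norm_def by (rule cSUP_upper[OF z bdd])
  finally show "0 \<le> multilinear_norm n E F A" .
  show "bounded_by n E F A (multilinear_norm n E F A)"
  proof (rule bounded_by_unit_ball)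
    fix x assume "x \<in> tuples n E" "\<And>i. i < n \<Longrightarrow> nrm (E i) (x i) \<le> 1"
    then have "x \<in> ?B" by simp
    then show "nrm F (A x) \<le> multilinear_norm n E F A"
      unfolding multilinear_norm_def by (rule cSUP_upper[OF _ bdd])
  qed
qed

end

section \<open>Polarization\<close>

text \<open>With \<open>c i\<close> the size of the fibre of \<open>f\<close> over \<open>i\<close>,
  each summand is the product of the powers \<open>\<epsilon> i ^ Suc (c i)\<close>, so the sum
  factors into the numbers \<open>1 + (-1) ^ Suc (c i)\<close>. A surjective \<open>f\<close> has
  all fibres of size 1 and every factor is 2; otherwise an empty fibre gives a factor 0.\<close>

lemma sum_sign_products:
  assumes f: "f \<in> {..<n} \<rightarrow> {..<n}"
  shows "(\<Sum>\<epsilon>\<in>{..<n} \<rightarrow>\<^sub>E {1, -1}. (\<Prod>i<n. \<epsilon> i) * (\<Prod>k<n. \<epsilon> (f k)))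
    = (if f ` {..<n} = {..<n} then 2 ^ n else (0 :: 'k :: field_char_0))"
proof -
  define c where "c i = card {k \<in> {..<n}. f k = i}" for i
  have "(\<Prod>k<n. \<epsilon> (f k)) = (\<Prod>i<n. \<epsilon> i ^ c i)" for \<epsilon> :: "nat \<Rightarrow> 'k"
  proof -
    have "(\<Prod>k<n. \<epsilon> (f k)) = (\<Prod>i<n. \<Prod>k\<in>{k \<in> {..<n}. f k = i}. \<epsilon> (f k))"
      using f by (intro prod.group[symmetric]) auto
    also have "\<dots> = (\<Prod>i<n. \<epsilon> i ^ c i)"
      by (intro prod.cong) (auto simp: c_def)
    finally show ?thesis .
  qed
  then have "(\<Sum>\<epsilon>\<in>{..<n} \<rightarrow>\<^sub>E {1, -1}. (\<Prod>i<n. \<epsilon> i) * (\<Prod>k<n. \<epsilon> (f k)))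
      = (\<Sum>\<epsilon>\<in>{..<n} \<rightarrow>\<^sub>E {1, -1 :: 'k}. \<Prod>i<n. \<epsilon> i ^ Suc (c i))"
    by (simp add: prod.distrib)
  also have "\<dots> = (\<Prod>i<n. \<Sum>e\<in>{1, -1 :: 'k}. e ^ Suc (c i))"
    by (rule prod_sum_PiE[symmetric]) auto
  also have "\<dots> = (\<Prod>i<n. 1 + (-1 :: 'k) ^ Suc (c i))"
    by (intro prod.cong) auto
  also have "\<dots> = (if f ` {..<n} = {..<n} then 2 ^ n else 0)"
  proof (cases "f ` {..<n} = {..<n}")
    case True
    then have inj: "inj_on f {..<n}" by (intro eq_card_imp_inj_on) auto
    have "c i = 1" if "i < n" for i
    proof -
      from that obtain k where "k < n" "f k = i" using True by (metis imageE lessThan_iff)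
      then have "{k \<in> {..<n}. f k = i} = {k}" using inj by (auto simp: inj_on_def)
      then show ?thesis by (simp add: c_def)
    qed
    then show ?thesis using True by simp
  next
    case False
    then obtain i where "i < n" "i \<notin> f ` {..<n}" using f by auto
    then have "c i = 0" by (auto simp: c_def)
    with \<open>i < n\<close> have "(\<Prod>i<n. 1 + (-1 :: 'k) ^ Suc (c i)) = 0"
      by (intro prod_zero) (auto intro!: bexI[of _ i])
    with False show ?thesis by simp
  qed
  finally show ?thesis .
qed

text \<open>A surjective self-map of a finite set is a permutation. The two encodings differ outside
  \<open>{..<n}\<close>, where extensional functions are \<open>undefined\<close> and permutations
  are the identity; the bijection converts one default into the other.\<close>

lemma card_surjective_selfmaps:
  "card {f \<in> {..<n} \<rightarrow>\<^sub>E {..<n}. f ` {..<n} = {..<n}} = fact n" (is "card ?S = _")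
proof -
  have "bij_betw (\<lambda>\<sigma>. restrict \<sigma> {..<n}) {\<sigma>. \<sigma> permutes {..<n}} ?S"
  proof (rule bij_betw_byWitness[where f' = "\<lambda>f i. if i < n then f i else i"])
    show "\<forall>\<sigma>\<in>{\<sigma>. \<sigma> permutes {..<n}}. (\<lambda>i. if i < n then restrict \<sigma> {..<n} i else i) = \<sigma>"
      by (auto simp: fun_eq_iff permutes_def)
    show "\<forall>f\<in>?S. restrict (\<lambda>i. if i < n then f i else i) {..<n} = f"
      by (auto simp: fun_eq_iff PiE_def extensional_def)
    show "(\<lambda>\<sigma>. restrict \<sigma> {..<n}) ` {\<sigma>. \<sigma> permutes {..<n}} \<subseteq> ?S"
    proof (rule image_subsetI)
      fix \<sigma> assume "\<sigma> \<in> {\<sigma>. \<sigma> permutes {..<n}}"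
      then have "\<sigma> ` {..<n} = {..<n}" by (simp add: permutes_image)
      then show "restrict \<sigma> {..<n} \<in> ?S" by auto
    qed
    show "(\<lambda>f i. if i < n then f i else i) ` ?S \<subseteq> {\<sigma>. \<sigma> permutes {..<n}}"
    proof (rule image_subsetI)
      fix f assume f: "f \<in> ?S"
      then have "inj_on f {..<n}" by (intro eq_card_imp_inj_on) auto
      then have "bij_betw f {..<n} {..<n}" using f by (simp add: bij_betw_def)
      then have "bij_betw (\<lambda>i. if i < n then f i else i) {..<n} {..<n}"
        by (subst bij_betw_cong[of _ _ f]) auto
      then have "(\<lambda>i. if i < n then f i else i) permutes {..<n}"
        by (rule bij_imp_permutes) simp
      then show "(\<lambda>i. if i < n then f i else i) \<in> {\<sigma>. \<sigma> permutes {..<n}}"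
        unfolding mem_Collect_eq .
    qed
  qed
  then have "card ?S = card {\<sigma>. \<sigma> permutes {..<n}}" by (simp add: bij_betw_same_card)
  then show ?thesis by (simp add: card_permutations)
qed

section \<open>Expansion on the diagonal and the polarization formula\<close>

abbreviation const_tuple :: "nat \<Rightarrow> 'a \<Rightarrow> nat \<Rightarrow> 'a" where
  "const_tuple n v \<equiv> (\<lambda>_\<in>{..<n}. v)"

definition symmetrize ::
    "nat \<Rightarrow> ('k :: {real_normed_field, banach}, 'a) normed_module \<Rightarrow> ('k, 'b) normed_module \<Rightarrow> ((nat \<Rightarrow> 'a) \<Rightarrow> 'b)
      \<Rightarrow> (nat \<Rightarrow> 'a) \<Rightarrow> 'b"
where
  "symmetrize n E F A = (\<lambda>x\<in>tuples n (\<lambda>_. E).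
     inverse (fact n) \<odot>\<^bsub>F\<^esub> finsum F (\<lambda>\<sigma>. A (x \<circ> \<sigma>)) {\<sigma>. \<sigma> permutes {..<n}})"

locale multilinear_power =
  dom: banach_space E + multilinear_operator n "\<lambda>_. E" F A
  for n :: nat and E :: "('k :: {real_normed_field, banach}, 'a) normed_module"
    and F :: "('k, 'b) normed_module" and A

lemma multilinear_powerI:
  "banach_space E \<Longrightarrow> banach_space F \<Longrightarrow> A \<in> multilinear n (\<lambda>_. E) F \<Longrightarrow> multilinear_power n E F A"
  by (simp add: multilinear_power_def multilinear_operator_def)

context multilinear_power
begin

text \<open>Multilinear expansion of a diagonal value: \<open>f\<close> records which summand is
  chosen in each slot. Choices that symmetry would merge into multinomial coefficients are kept
  apart.\<close>

lemma op_finsum_all: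
  fixes I :: "'i set"
  assumes I: "finite I" and x: "x \<in> I \<rightarrow> carrier E"
  shows "A (const_tuple n (finsum E x I)) = finsum F (\<lambda>f. A (\<lambda>k\<in>{..<n}. x (f k))) ({..<n} \<rightarrow>\<^sub>E I)"
proof -
  have s: "finsum E x I \<in> carrier E" using x by (rule dom.finsum_closed)
  \<comment> \<open>Only the first \<open>m\<close> slots hold the sum. The tuple \<open>u\<close>
    in the other slots is arbitrary, so that in the induction it can absorb the sum in slot
    \<open>m\<close>, which is expanded afterwards.\<close>
  have gen: "A (\<lambda>k\<in>{..<n}. if k < m then finsum E x I else u k)
      = finsum F (\<lambda>f. A (\<lambda>k\<in>{..<n}. if k < m then x (f k) else u k)) ({..<m} \<rightarrow>\<^sub>E I)"
    if "m \<le> n" "u \<in> tuples n (\<lambda>_. E)" for m u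
    using that
  proof (induction m arbitrary: u)
    case 0
    then have "A (restrict u {..<n}) \<in> carrier F" by (intro op_cl) auto
    have single: "finsum F g {a} = g a" if "g a \<in> carrier F" for g and a :: "nat \<Rightarrow> 'i"
      using that by (subst cod.finsum_insert) auto
    have "(\<lambda>k\<in>{..<n}. if k < 0 then v k else u k) = restrict u {..<n}" for v
      by (auto simp: fun_eq_iff)
    then show ?case
      unfolding lessThan_0 PiE_empty_domain
      using single[of "\<lambda>_. A (restrict u {..<n})" "\<lambda>_. undefined"] \<open>A (restrict u {..<n}) \<in> carrier F\<close>
      by (simp only:)
  next
    case (Suc m)
    then have m: "m < n" by simp
    let ?t = "\<lambda>f. \<lambda>k\<in>{..<n}. if k < m then x (f k) else u k"
    let ?t' = "\<lambda>f. \<lambda>k\<in>{..<n}. if k < Suc m then x (f k) else u k"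
    have t: "?t f \<in> tuples n (\<lambda>_. E)" if "f \<in> {..<m} \<rightarrow>\<^sub>E I" for f
      using that Suc.prems x by (auto simp: PiE_iff Pi_def)
    have step_cl: "A ((?t f)(m := x i)) \<in> carrier F" if "f \<in> {..<m} \<rightarrow>\<^sub>E I" "i \<in> I" for f i
      using x that(2) by (intro op_cl upd_cl[OF t[OF that(1)] m]) (rule funcset_mem)
    have tupd: "?t' ((snd p)(m := fst p)) = (?t (snd p))(m := x (fst p))" for p
      using m by (auto simp: fun_eq_iff)
    have u': "u(m := finsum E x I) \<in> tuples n (\<lambda>_. E)" by (rule upd_cl[OF Suc.prems(2) m s])
    have "(\<lambda>k\<in>{..<n}. if k < Suc m then finsum E x I else u k)
        = (\<lambda>k\<in>{..<n}. if k < m then finsum E x I else (u(m := finsum E x I)) k)"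
      by (auto simp: fun_eq_iff)
    then have "A (\<lambda>k\<in>{..<n}. if k < Suc m then finsum E x I else u k)
        = finsum F (\<lambda>f. A (\<lambda>k\<in>{..<n}. if k < m then x (f k) else (u(m := finsum E x I)) k)) ({..<m} \<rightarrow>\<^sub>E I)"
      using Suc.IH[OF _ u'] m by (simp only: less_imp_le)
    also have "\<dots> = finsum F (\<lambda>f. finsum F (\<lambda>i. A ((?t f)(m := x i))) I) ({..<m} \<rightarrow>\<^sub>E I)"
    proof (rule cod.finsum_cong'[OF refl])
      fix f assume f: "f \<in> {..<m} \<rightarrow>\<^sub>E I"
      have "(\<lambda>k\<in>{..<n}. if k < m then x (f k) else (u(m := finsum E x I)) k) = (?t f)(m := finsum E x I)"
        using m by (auto simp: fun_eq_iff)
      then show "A (\<lambda>k\<in>{..<n}. if k < m then x (f k) else (u(m := finsum E x I)) k)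
          = finsum F (\<lambda>i. A ((?t f)(m := x i))) I"
        using op_finsum[OF I x t[OF f] m] by simp
    qed (intro Pi_I cod.finsum_closed step_cl; assumption)
    also have "\<dots> = finsum F (\<lambda>i. finsum F (\<lambda>f. A ((?t f)(m := x i))) ({..<m} \<rightarrow>\<^sub>E I)) I"
      using I by (intro cod.finsum_swap step_cl finite_PiE) auto
    also have "\<dots> = finsum F (\<lambda>(i, f). A ((?t f)(m := x i))) (I \<times> ({..<m} \<rightarrow>\<^sub>E I))"
      using I step_cl by (subst cod.finsum_Times[symmetric]) (auto intro!: finite_PiE simp del: restrict_apply)
    \<comment> \<open>A choice for slot \<open>m\<close> together with choices for the slots below
      it is re-encoded as one function on \<open>Suc m\<close> slots; extensionality makes this
      injective.\<close>
    also have "\<dots> = finsum F (\<lambda>p. A (?t' ((snd p)(m := fst p)))) (I \<times> ({..<m} \<rightarrow>\<^sub>E I))"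
    proof (rule cod.finsum_cong'[OF refl])
      fix p assume p: "p \<in> I \<times> ({..<m} \<rightarrow>\<^sub>E I)"
      show "(case p of (i, f) \<Rightarrow> A ((?t f)(m := x i))) = A (?t' ((snd p)(m := fst p)))"
        by (simp only: case_prod_beta tupd)
    next
      show "(\<lambda>p. A (?t' ((snd p)(m := fst p)))) \<in> I \<times> ({..<m} \<rightarrow>\<^sub>E I) \<rightarrow> carrier F"
        unfolding tupd using step_cl by (intro Pi_I) (simp only: mem_Times_iff)
    qed
    also have "\<dots> = finsum F (\<lambda>f. A (?t' f)) ((\<lambda>p. (snd p)(m := fst p)) ` (I \<times> ({..<m} \<rightarrow>\<^sub>E I)))"
    proof (rule cod.finsum_reindex[symmetric])
      show "inj_on (\<lambda>p. (snd p)(m := fst p)) (I \<times> ({..<m} \<rightarrow>\<^sub>E I))"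
      proof (rule inj_onI)
        fix p q assume p: "p \<in> I \<times> ({..<m} \<rightarrow>\<^sub>E I)" and q: "q \<in> I \<times> ({..<m} \<rightarrow>\<^sub>E I)"
          and eq: "(snd p)(m := fst p) = (snd q)(m := fst q)"
        have "fst p = fst q" using fun_cong[OF eq, of m] by simp
        moreover have "snd p k = snd q k" for k
          using fun_cong[OF eq, of k] p q by (cases "k = m") (auto simp: PiE_def extensional_def)
        ultimately show "p = q" by (simp add: prod_eq_iff fun_eq_iff)
      qed
      show "(\<lambda>f. A (?t' f)) \<in> (\<lambda>p. (snd p)(m := fst p)) ` (I \<times> ({..<m} \<rightarrow>\<^sub>E I)) \<rightarrow> carrier F"
      proof (intro Pi_I, elim imageE)
        fix f p assume "f = (snd p)(m := fst p)" "p \<in> I \<times> ({..<m} \<rightarrow>\<^sub>E I)"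
        then show "A (?t' f) \<in> carrier F" using step_cl by (simp only: tupd mem_Times_iff)
      qed
    qed
    also have "(\<lambda>p. (snd p)(m := fst p)) ` (I \<times> ({..<m} \<rightarrow>\<^sub>E I)) = {..<Suc m} \<rightarrow>\<^sub>E I"
      by (simp add: lessThan_Suc PiE_insert_eq case_prod_beta)
    finally show ?case .
  qed
  have e: "(\<lambda>k\<in>{..<n}. if k < n then g k else u k) = restrict g {..<n}" for g u :: "nat \<Rightarrow> 'a"
    by (auto simp: fun_eq_iff)
  have c: "const_tuple n (finsum E x I) \<in> tuples n (\<lambda>_. E)" using s by auto
  show ?thesis using gen[OF order_refl c] unfolding e .
qed

end

locale symmetric_power = multilinear_power n E F A
  for n :: nat and E :: "('k :: {real_normed_field, banach}, 'a) normed_module"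
    and F :: "('k, 'b) normed_module" and A +
  assumes symmetric: "symmetric_operator n E A"
begin

lemma op_perm: "\<sigma> permutes {..<n} \<Longrightarrow> x \<in> tuples n (\<lambda>_. E) \<Longrightarrow> A (x \<circ> \<sigma>) = A x"
  using symmetric by (simp add: symmetric_operator_def)

lemma op_surj:
  assumes x: "x \<in> tuples n (\<lambda>_. E)" and f: "f ` {..<n} = {..<n}"
  shows "A (\<lambda>k\<in>{..<n}. x (f k)) = A x"
proof -
  have "inj_on f {..<n}" using f by (intro eq_card_imp_inj_on) auto
  then have "bij_betw f {..<n} {..<n}" using f by (simp add: bij_betw_def)
  then have "bij_betw (\<lambda>i. if i < n then f i else i) {..<n} {..<n}"
    by (subst bij_betw_cong[of _ _ f]) auto
  then have "(\<lambda>i. if i < n then f i else i) permutes {..<n}"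
    by (rule bij_imp_permutes) simp
  moreover have "(\<lambda>k\<in>{..<n}. x (f k)) = x \<circ> (\<lambda>i. if i < n then f i else i)"
    using x by (auto simp: fun_eq_iff PiE_def extensional_def)
  ultimately show ?thesis using op_perm x by simp
qed

text \<open>After expansion on the diagonal, the sum over signs annihilates every choice function
  that is not surjective. Each of the \<open>fact n\<close> surjective ones contributes
  \<open>2 ^ n\<close> times a permuted value, which symmetry turns into \<open>A x\<close>.\<close>

lemma polarization:
  assumes x: "x \<in> tuples n (\<lambda>_. E)"
  shows "finsum F (\<lambda>\<epsilon>. (\<Prod>i<n. \<epsilon> i) \<odot>\<^bsub>F\<^esub> A (const_tuple n (finsum E (\<lambda>i. \<epsilon> i \<odot>\<^bsub>E\<^esub> x i) {..<n})))
      ({..<n} \<rightarrow>\<^sub>E {1, -1}) = (2 ^ n * fact n) \<odot>\<^bsub>F\<^esub> A x"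
proof -
  let ?S = "{..<n} \<rightarrow>\<^sub>E {1, -1 :: 'k}" and ?P = "{..<n} \<rightarrow>\<^sub>E {..<n}"
  have x': "x i \<in> carrier E" if "i < n" for i using x that by auto
  have xf: "A (\<lambda>k\<in>{..<n}. x (f k)) \<in> carrier F" if "f \<in> ?P" for f
    using that x' by (intro op_cl) auto
  have fin: "finite ?S" "finite ?P" by (auto intro!: finite_PiE)
  have expand: "A (const_tuple n (finsum E (\<lambda>i. \<epsilon> i \<odot>\<^bsub>E\<^esub> x i) {..<n}))
      = finsum F (\<lambda>f. (\<Prod>k<n. \<epsilon> (f k)) \<odot>\<^bsub>F\<^esub> A (\<lambda>k\<in>{..<n}. x (f k))) ?P" for \<epsilon>
  proof -
    have "A (const_tuple n (finsum E (\<lambda>i. \<epsilon> i \<odot>\<^bsub>E\<^esub> x i) {..<n}))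
        = finsum F (\<lambda>f. A (\<lambda>k\<in>{..<n}. \<epsilon> (f k) \<odot>\<^bsub>E\<^esub> x (f k))) ?P"
      using x' by (intro op_finsum_all) (auto intro!: dom.smult_cl)
    also have "\<dots> = finsum F (\<lambda>f. (\<Prod>k<n. \<epsilon> (f k)) \<odot>\<^bsub>F\<^esub> A (\<lambda>k\<in>{..<n}. x (f k))) ?P"
    proof (rule cod.finsum_cong'[OF refl])
      fix f assume f: "f \<in> ?P"
      then have "(\<lambda>k\<in>{..<n}. x (f k)) \<in> tuples n (\<lambda>_. E)" using x' by auto
      from op_smult_all[OF this, of "\<lambda>k. \<epsilon> (f k)"]
      show "A (\<lambda>k\<in>{..<n}. \<epsilon> (f k) \<odot>\<^bsub>E\<^esub> x (f k)) = (\<Prod>k<n. \<epsilon> (f k)) \<odot>\<^bsub>F\<^esub> A (\<lambda>k\<in>{..<n}. x (f k))"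
        by (simp cong: restrict_cong)
    qed (use xf in \<open>auto intro!: cod.smult_cl\<close>)
    finally show ?thesis .
  qed
  have "finsum F (\<lambda>\<epsilon>. (\<Prod>i<n. \<epsilon> i) \<odot>\<^bsub>F\<^esub> A (const_tuple n (finsum E (\<lambda>i. \<epsilon> i \<odot>\<^bsub>E\<^esub> x i) {..<n}))) ?S
      = finsum F (\<lambda>\<epsilon>. finsum F (\<lambda>f. ((\<Prod>i<n. \<epsilon> i) * (\<Prod>k<n. \<epsilon> (f k))) \<odot>\<^bsub>F\<^esub> A (\<lambda>k\<in>{..<n}. x (f k))) ?P) ?S"
  proof (rule cod.finsum_cong'[OF refl])
    fix \<epsilon>
    have "(\<Prod>i<n. \<epsilon> i) \<odot>\<^bsub>F\<^esub> A (const_tuple n (finsum E (\<lambda>i. \<epsilon> i \<odot>\<^bsub>E\<^esub> x i) {..<n}))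
        = finsum F (\<lambda>f. (\<Prod>i<n. \<epsilon> i) \<odot>\<^bsub>F\<^esub> ((\<Prod>k<n. \<epsilon> (f k)) \<odot>\<^bsub>F\<^esub> A (\<lambda>k\<in>{..<n}. x (f k)))) ?P"
      unfolding expand using fin xf by (intro cod.smult_finsum) (auto intro!: cod.smult_cl)
    also have "\<dots> = finsum F (\<lambda>f. ((\<Prod>i<n. \<epsilon> i) * (\<Prod>k<n. \<epsilon> (f k))) \<odot>\<^bsub>F\<^esub> A (\<lambda>k\<in>{..<n}. x (f k))) ?P"
      using xf by (intro cod.finsum_cong'[OF refl]) (auto intro!: cod.smult_cl simp: cod.smult_smult)
    finally show "(\<Prod>i<n. \<epsilon> i) \<odot>\<^bsub>F\<^esub> A (const_tuple n (finsum E (\<lambda>i. \<epsilon> i \<odot>\<^bsub>E\<^esub> x i) {..<n})) = \<dots>" .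
  qed (use xf in \<open>auto intro!: cod.smult_cl cod.finsum_closed\<close>)
  also have "\<dots> = finsum F (\<lambda>f. finsum F (\<lambda>\<epsilon>. ((\<Prod>i<n. \<epsilon> i) * (\<Prod>k<n. \<epsilon> (f k))) \<odot>\<^bsub>F\<^esub> A (\<lambda>k\<in>{..<n}. x (f k))) ?S) ?P"
    by (rule cod.finsum_swap[OF fin]) (use xf in \<open>auto intro!: cod.smult_cl\<close>)
  also have "\<dots> = finsum F (\<lambda>f. (if f ` {..<n} = {..<n} then 2 ^ n else 0) \<odot>\<^bsub>F\<^esub> A x) ?P"
  proof (rule cod.finsum_cong'[OF refl])
    fix f assume f: "f \<in> ?P"
    have "finsum F (\<lambda>\<epsilon>. ((\<Prod>i<n. \<epsilon> i) * (\<Prod>k<n. \<epsilon> (f k))) \<odot>\<^bsub>F\<^esub> A (\<lambda>k\<in>{..<n}. x (f k))) ?S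
        = (if f ` {..<n} = {..<n} then 2 ^ n else 0) \<odot>\<^bsub>F\<^esub> A (\<lambda>k\<in>{..<n}. x (f k))"
    proof -
      have "f \<in> {..<n} \<rightarrow> {..<n}" using f by (simp add: PiE_def)
      then show ?thesis
        by (simp only: cod.finsum_smult_left[OF fin(1) xf[OF f]] sum_sign_products)
    qed
    also have "\<dots> = (if f ` {..<n} = {..<n} then 2 ^ n else 0) \<odot>\<^bsub>F\<^esub> A x"
      using op_surj[OF x] cod.smult_0 xf[OF f] op_cl[OF x] by auto
    finally show "finsum F (\<lambda>\<epsilon>. ((\<Prod>i<n. \<epsilon> i) * (\<Prod>k<n. \<epsilon> (f k))) \<odot>\<^bsub>F\<^esub> A (\<lambda>k\<in>{..<n}. x (f k))) ?S = \<dots>" .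
  qed (use op_cl[OF x] in \<open>auto intro!: cod.smult_cl\<close>)
  also have "\<dots> = (\<Sum>f\<in>?P. if f ` {..<n} = {..<n} then 2 ^ n else 0) \<odot>\<^bsub>F\<^esub> A x"
    by (rule cod.finsum_smult_left[OF fin(2) op_cl[OF x]])
  also have "(\<Sum>f\<in>?P. if f ` {..<n} = {..<n} then 2 ^ n else (0 :: 'k))
      = (\<Sum>f\<in>{f \<in> ?P. f ` {..<n} = {..<n}}. 2 ^ n)"
    by (rule sum.inter_filter[symmetric, OF fin(2)])
  also have "\<dots> = 2 ^ n * fact n"
    by (simp only: sum_constant card_surjective_selfmaps of_nat_fact mult.commute)
  finally show ?thesis .
qed

text \<open>The form that expresses all values through the diagonal; it serves uniqueness as well as
  the passage from polynomials to operators on sequences.\<close>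

lemma op_eq_polar:
  assumes x: "x \<in> tuples n (\<lambda>_. E)"
  shows "A x = inverse (2 ^ n * fact n) \<odot>\<^bsub>F\<^esub> finsum F (\<lambda>\<epsilon>. (\<Prod>i<n. \<epsilon> i)
    \<odot>\<^bsub>F\<^esub> A (const_tuple n (finsum E (\<lambda>i. \<epsilon> i \<odot>\<^bsub>E\<^esub> x i) {..<n}))) ({..<n} \<rightarrow>\<^sub>E {1, -1})"
proof -
  have "inverse (2 ^ n * fact n) * (2 ^ n * fact n) = (1 :: 'k)"
    by (rule left_inverse) simp
  then show ?thesis
    unfolding polarization[OF x] cod.smult_smult[OF op_cl[OF x]] by (simp add: cod.smult_1 op_cl[OF x])
qed

text \<open>Origin of \<open>n ^ n / n!\<close>: for \<open>x\<close> in the unit ball each signed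
  sum has norm at most \<open>n\<close>, so each of the \<open>2 ^ n\<close> terms of the
  polarization formula is bounded by \<open>M * n ^ n\<close>; dividing by
  \<open>2 ^ n * fact n\<close> leaves the constant.\<close>

lemma bounded_by_polarization:
  assumes M: "0 \<le> M" and le: "\<And>v. v \<in> carrier E \<Longrightarrow> nrm F (A (const_tuple n v)) \<le> M * nrm E v ^ n"
  shows "bounded_by n (\<lambda>_. E) F A (real n ^ n / fact n * M)"
proof (rule bounded_by_unit_ball)
  fix x assume x: "x \<in> tuples n (\<lambda>_. E)" and ball: "\<And>i. i < n \<Longrightarrow> nrm E (x i) \<le> 1"
  let ?S = "{..<n} \<rightarrow>\<^sub>E {1, -1 :: 'k}"
  let ?s = "\<lambda>\<epsilon>. finsum E (\<lambda>i. \<epsilon> i \<odot>\<^bsub>E\<^esub> x i) {..<n}"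
  have x': "x i \<in> carrier E" if "i < n" for i using x that by auto
  have s: "?s \<epsilon> \<in> carrier E" for \<epsilon> using x' by (intro dom.finsum_closed) (auto intro!: dom.smult_cl)
  have cl: "A (const_tuple n (?s \<epsilon>)) \<in> carrier F" for \<epsilon> using s by (intro op_cl) auto
  have fin: "finite ?S" by (auto intro!: finite_PiE)
  have "norm (2 ^ n * fact n :: 'k) * nrm F (A x)
      \<le> (\<Sum>\<epsilon>\<in>?S. nrm F ((\<Prod>i<n. \<epsilon> i) \<odot>\<^bsub>F\<^esub> A (const_tuple n (?s \<epsilon>))))"
    unfolding cod.nrm_smult[OF op_cl[OF x], symmetric] polarization[OF x, symmetric]
    using cl by (intro cod.nrm_finsum_le fin) (auto intro!: cod.smult_cl)
  also have "\<dots> \<le> (\<Sum>\<epsilon>\<in>?S. M * real n ^ n)"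
  proof (rule sum_mono)
    fix \<epsilon> assume \<epsilon>: "\<epsilon> \<in> ?S"
    then have n1: "norm (\<epsilon> i) = 1" if "i < n" for i
    proof -
      have "\<epsilon> i \<in> {1, -1}" using \<epsilon> that by blast
      then show ?thesis by auto
    qed
    have "nrm E (?s \<epsilon>) \<le> (\<Sum>i<n. nrm E (\<epsilon> i \<odot>\<^bsub>E\<^esub> x i))"
      using x' by (intro dom.nrm_finsum_le) (auto intro!: dom.smult_cl)
    also have "\<dots> \<le> (\<Sum>i<n. 1)"
      using n1 x' ball by (intro sum_mono) (auto simp: dom.nrm_smult)
    finally have sn: "nrm E (?s \<epsilon>) \<le> real n" by simp
    have "nrm F ((\<Prod>i<n. \<epsilon> i) \<odot>\<^bsub>F\<^esub> A (const_tuple n (?s \<epsilon>))) = nrm F (A (const_tuple n (?s \<epsilon>)))"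
      using n1 by (simp add: cod.nrm_smult[OF cl] prod_norm[symmetric])
    also have "\<dots> \<le> M * nrm E (?s \<epsilon>) ^ n" by (rule le[OF s])
    also have "\<dots> \<le> M * real n ^ n"
      using M sn dom.nrm_nonneg[OF s] by (intro mult_left_mono power_mono) auto
    finally show "nrm F ((\<Prod>i<n. \<epsilon> i) \<odot>\<^bsub>F\<^esub> A (const_tuple n (?s \<epsilon>))) \<le> M * real n ^ n" .
  qed
  also have "\<dots> = 2 ^ n * (M * real n ^ n)"
    by (simp add: card_PiE numeral_eq_Suc)
  finally have "fact n * nrm F (A x) \<le> M * real n ^ n"
    by (simp add: norm_mult norm_power)
  then show "nrm F (A x) \<le> real n ^ n / fact n * M"
    by (simp add: field_simps)
qed

end

text \<open>Both values at \<open>x\<close> are the same polarization sum of diagonal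
  values.\<close>

lemma symmetric_power_unique:
  assumes "symmetric_power n E F A" "symmetric_power n E F B"
    and eq: "\<And>v. v \<in> carrier E \<Longrightarrow> A (const_tuple n v) = B (const_tuple n v)"
  shows "A = B"
proof -
  interpret A: symmetric_power n E F A by fact
  interpret B: symmetric_power n E F B by fact
  show ?thesis
  proof (rule extensionalityI[OF A.op_ext B.op_ext])
    fix x assume x: "x \<in> tuples n (\<lambda>_. E)"
    have "A (const_tuple n (finsum E (\<lambda>i. \<epsilon> i \<odot>\<^bsub>E\<^esub> x i) {..<n}))
        = B (const_tuple n (finsum E (\<lambda>i. \<epsilon> i \<odot>\<^bsub>E\<^esub> x i) {..<n}))" for \<epsilon>
      using x by (intro eq A.dom.finsum_closed) (auto intro!: A.dom.smult_cl)
    then show "A x = B x"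
      by (subst A.op_eq_polar[OF x], subst B.op_eq_polar[OF x]) simp
  qed
qed

section \<open>Symmetrization\<close>

context multilinear_power
begin

lemma perm_cl: "\<sigma> permutes {..<n} \<Longrightarrow> x \<in> tuples n (\<lambda>_. E) \<Longrightarrow> x \<circ> \<sigma> \<in> tuples n (\<lambda>_. E)"
  using permutes_in_image[of \<sigma> "{..<n}"] by (auto simp: PiE_iff extensional_def)

lemma op_perm_cl: "\<sigma> permutes {..<n} \<Longrightarrow> x \<in> tuples n (\<lambda>_. E) \<Longrightarrow> A (x \<circ> \<sigma>) \<in> carrier F"
  by (intro op_cl perm_cl)

lemma finite_perms: "finite {\<sigma>. \<sigma> permutes {..<n}}"
  by (rule finite_permutations) simp

text \<open>Updating slot \<open>i\<close> of \<open>x\<close> amounts to updating, in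
  \<open>x \<circ> \<sigma>\<close>, the slot that \<open>\<sigma>\<close> sends to
  \<open>i\<close>; hence every summand is linear in slot \<open>i\<close> of
  \<open>x\<close>.\<close>

lemma symmetrize_multilinear: "symmetrize n E F A \<in> multilinear n (\<lambda>_. E) F"
  unfolding multilinear_def
proof (intro CollectI conjI ballI allI impI)
  let ?P = "{\<sigma>. \<sigma> permutes {..<n}}"
  let ?c = "inverse (fact n) :: 'k"
  have sum_cl: "finsum F (\<lambda>\<sigma>. A (x \<circ> \<sigma>)) ?P \<in> carrier F" if "x \<in> tuples n (\<lambda>_. E)" for x
    using that by (intro cod.finsum_closed) (auto intro!: op_perm_cl)
  show "symmetrize n E F A \<in> tuples n (\<lambda>_. E) \<rightarrow>\<^sub>E carrier F"
    using sum_cl by (auto simp: symmetrize_def intro!: cod.smult_cl)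
  fix x i assume x: "x \<in> tuples n (\<lambda>_. E)" and i: "i < n"
  have upd: "x(i := v) \<circ> \<sigma> = (x \<circ> \<sigma>)(inv_into UNIV \<sigma> i := v)" if "\<sigma> permutes {..<n}" for v \<sigma>
    using permutes_inverses[OF that] by (auto simp: fun_eq_iff)
  have inv_lt: "inv_into UNIV \<sigma> i < n" if "\<sigma> permutes {..<n}" for \<sigma>
    using permutes_in_image[OF permutes_inv[OF that], of i] i by simp
  have xi: "x i \<in> carrier E" using x i by auto
  {
    fix y assume y: "y \<in> carrier E"
    have "finsum F (\<lambda>\<sigma>. A (x(i := x i \<oplus>\<^bsub>E\<^esub> y) \<circ> \<sigma>)) ?P
        = finsum F (\<lambda>\<sigma>. A (x \<circ> \<sigma>) \<oplus>\<^bsub>F\<^esub> A (x(i := y) \<circ> \<sigma>)) ?P"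
    proof (rule cod.finsum_cong'[OF refl])
      fix \<sigma> assume "\<sigma> \<in> ?P"
      then have \<sigma>: "\<sigma> permutes {..<n}" by simp
      have "A (x \<circ> \<sigma>) = A ((x \<circ> \<sigma>)(inv_into UNIV \<sigma> i := x i))"
        using upd[OF \<sigma>, of "x i"] by simp
      then show "A (x(i := x i \<oplus>\<^bsub>E\<^esub> y) \<circ> \<sigma>) = A (x \<circ> \<sigma>) \<oplus>\<^bsub>F\<^esub> A (x(i := y) \<circ> \<sigma>)"
        unfolding upd[OF \<sigma>] by (simp only: op_add[OF perm_cl[OF \<sigma> x] inv_lt[OF \<sigma>] xi y])
    qed (use x i y upd_cl in \<open>auto intro!: cod.add_cl op_perm_cl\<close>)
    also have "\<dots> = finsum F (\<lambda>\<sigma>. A (x \<circ> \<sigma>)) ?P \<oplus>\<^bsub>F\<^esub> finsum F (\<lambda>\<sigma>. A (x(i := y) \<circ> \<sigma>)) ?P"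
      using x i y upd_cl by (intro cod.finsum_addf) (auto intro!: op_perm_cl)
    finally show "symmetrize n E F A (x(i := x i \<oplus>\<^bsub>E\<^esub> y))
        = symmetrize n E F A x \<oplus>\<^bsub>F\<^esub> symmetrize n E F A (x(i := y))"
      using x upd_cl[OF x i] xi y sum_cl
      by (simp add: symmetrize_def cod.smult_add_right del: fun_upd_apply)
  }
  fix a
  have "finsum F (\<lambda>\<sigma>. A (x(i := a \<odot>\<^bsub>E\<^esub> x i) \<circ> \<sigma>)) ?P = finsum F (\<lambda>\<sigma>. a \<odot>\<^bsub>F\<^esub> A (x \<circ> \<sigma>)) ?P"
  proof (rule cod.finsum_cong'[OF refl])
    fix \<sigma> assume "\<sigma> \<in> ?P"
    then have \<sigma>: "\<sigma> permutes {..<n}" by simp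
    have "A (x \<circ> \<sigma>) = A ((x \<circ> \<sigma>)(inv_into UNIV \<sigma> i := x i))"
      using upd[OF \<sigma>, of "x i"] by simp
    then show "A (x(i := a \<odot>\<^bsub>E\<^esub> x i) \<circ> \<sigma>) = a \<odot>\<^bsub>F\<^esub> A (x \<circ> \<sigma>)"
      unfolding upd[OF \<sigma>] by (simp only: op_smult[OF perm_cl[OF \<sigma> x] inv_lt[OF \<sigma>] xi])
  qed (use x in \<open>auto intro!: cod.smult_cl op_perm_cl\<close>)
  also have "\<dots> = a \<odot>\<^bsub>F\<^esub> finsum F (\<lambda>\<sigma>. A (x \<circ> \<sigma>)) ?P"
    using x by (intro cod.smult_finsum[symmetric] finite_perms) (auto intro!: op_perm_cl)
  finally show "symmetrize n E F A (x(i := a \<odot>\<^bsub>E\<^esub> x i)) = a \<odot>\<^bsub>F\<^esub> symmetrize n E F A x"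
    using x upd_cl[OF x i dom.smult_cl[OF xi]] sum_cl
    by (simp add: symmetrize_def cod.smult_smult mult.commute del: fun_upd_apply)
qed

text \<open>Composing with \<open>\<tau>\<close> on the left permutes the group of permutations,
  hence only reorders the sum.\<close>

lemma symmetrize_symmetric: "symmetric_operator n E (symmetrize n E F A)"
  unfolding symmetric_operator_def
proof (intro allI impI ballI)
  fix \<tau> x assume \<tau>: "\<tau> permutes {..<n}" and x: "x \<in> tuples n (\<lambda>_. E)"
  let ?P = "{\<sigma>. \<sigma> permutes {..<n}}"
  have im: "(\<circ>) \<tau> ` ?P = ?P"
    using image_compose_permutations_left[OF \<tau>] by (simp add: image_def Collect_conj_eq) blast
  have inj: "inj_on ((\<circ>) \<tau>) ?P"
    using permutes_inj[OF \<tau>] by (auto intro!: inj_onI simp: fun_eq_iff inj_eq)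
  have "finsum F (\<lambda>\<sigma>. A (x \<circ> \<sigma>)) ((\<circ>) \<tau> ` ?P) = finsum F (\<lambda>\<sigma>. A (x \<circ> (\<tau> \<circ> \<sigma>))) ?P"
    by (rule cod.finsum_reindex[OF _ inj]) (unfold im, use x in \<open>auto intro!: op_perm_cl\<close>)
  then have "finsum F (\<lambda>\<sigma>. A ((x \<circ> \<tau>) \<circ> \<sigma>)) ?P = finsum F (\<lambda>\<sigma>. A (x \<circ> \<sigma>)) ?P"
    by (simp only: im comp_assoc)
  then show "symmetrize n E F A (x \<circ> \<tau>) = symmetrize n E F A x"
    using x perm_cl[OF \<tau> x] by (simp add: symmetrize_def)
qed

text \<open>On the diagonal all \<open>fact n\<close> summands coincide. Any operator representing a
  polynomial may therefore be replaced by a symmetric one.\<close>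

lemma symmetrize_const:
  assumes v: "v \<in> carrier E"
  shows "symmetrize n E F A (const_tuple n v) = A (const_tuple n v)"
proof -
  let ?P = "{\<sigma>. \<sigma> permutes {..<n}}"
  have t: "const_tuple n v \<in> tuples n (\<lambda>_. E)" using v by auto
  have "finsum F (\<lambda>\<sigma>. A (const_tuple n v \<circ> \<sigma>)) ?P = finsum F (\<lambda>\<sigma>. 1 \<odot>\<^bsub>F\<^esub> A (const_tuple n v)) ?P"
  proof (rule cod.finsum_cong'[OF refl])
    fix \<sigma> assume "\<sigma> \<in> ?P"
    then have "const_tuple n v \<circ> \<sigma> = const_tuple n v"
      using permutes_in_image[of \<sigma> "{..<n}"] by (auto simp: fun_eq_iff)
    then show "A (const_tuple n v \<circ> \<sigma>) = 1 \<odot>\<^bsub>F\<^esub> A (const_tuple n v)"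
      using op_cl[OF t] by (simp add: cod.smult_1)
  qed (use op_cl[OF t] in \<open>auto intro!: cod.smult_cl\<close>)
  also have "\<dots> = (\<Sum>\<sigma>\<in>?P. 1) \<odot>\<^bsub>F\<^esub> A (const_tuple n v)"
    by (rule cod.finsum_smult_left[OF finite_perms op_cl[OF t]])
  also have "(\<Sum>\<sigma>\<in>?P. 1 :: 'k) = fact n"
    by (simp add: card_permutations[of _ n])
  finally show ?thesis
    unfolding symmetrize_def restrict_apply'[OF t]
    using op_cl[OF t] by (simp only: cod.smult_smult) (simp add: cod.smult_1)
qed

lemma symmetrize_symmetric_power: "symmetric_power n E F (symmetrize n E F A)"
  by (intro symmetric_power.intro symmetric_power_axioms.intro multilinear_powerI
      symmetrize_multilinear symmetrize_symmetric) unfold_locales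

end

section \<open>The closed graph theorem and continuous polynomials\<close>

context banach_space
begin

lemma smult_2: "x \<in> carrier E \<Longrightarrow> 2 \<odot> x = x \<oplus> x"
  using smult_add_left[of x 1 1] by (simp add: smult_1)

lemma diff_diff_swap:
  assumes "p \<in> carrier E" "a \<in> carrier E" "q \<in> carrier E" "b \<in> carrier E"
  shows "(p \<ominus> a) \<ominus> (q \<ominus> b) = (p \<ominus> q) \<ominus> (a \<ominus> b)"
  using assms by (simp add: diff_eq smult_cl smult_add_right smult_smult smult_1 M.a_ac)

lemma add_diff_diff:
  assumes "x \<in> carrier E" "y \<in> carrier E"
  shows "(y \<oplus> x) \<ominus> (y \<ominus> x) = 2 \<odot> x"
proof -
  have "(y \<oplus> x) \<ominus> (y \<ominus> x) = (y \<ominus> y) \<oplus> (x \<oplus> x)"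
    using assms by (simp add: diff_eq smult_cl smult_add_right smult_smult smult_1 M.a_ac)
  then show ?thesis using assms by (simp add: diff_self smult_2)
qed

end

text \<open>Singletons \<open>T\<close> give the closed graph theorem, and families of continuous
  maps the uniform boundedness principle. The graph condition is stated at 0, which by linearity is
  the general case. By Baire, the set \<open>S k\<close> of points where all maps of
  \<open>T\<close> are bounded by \<open>k\<close> has, for some \<open>k\<close>, a closure with
  interior. As the maps are not known to be continuous, \<open>S k\<close> need not be closed;
  successive approximation by points of shrinking multiples of it makes up for this, and
  \<open>closed\<close> identifies the limit of the images.\<close>

lemma uniform_closed_graph:
  fixes V :: "('k :: {real_normed_field, banach}, 'a) normed_module" and W :: "('k, 'b) normed_module"
  assumes V: "banach_space V" and W: "banach_space W"
    and cl: "\<And>t x. t \<in> T \<Longrightarrow> x \<in> carrier V \<Longrightarrow> t x \<in> carrier W"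
    and add: "\<And>t x y. t \<in> T \<Longrightarrow> x \<in> carrier V \<Longrightarrow> y \<in> carrier V \<Longrightarrow> t (x \<oplus>\<^bsub>V\<^esub> y) = t x \<oplus>\<^bsub>W\<^esub> t y"
    and smult: "\<And>t a x. t \<in> T \<Longrightarrow> x \<in> carrier V \<Longrightarrow> t (a \<odot>\<^bsub>V\<^esub> x) = a \<odot>\<^bsub>W\<^esub> t x"
    and closed: "\<And>t u w. t \<in> T \<Longrightarrow> (\<And>k. u k \<in> carrier V) \<Longrightarrow> (\<lambda>k. nrm V (u k)) \<longlonglongrightarrow> 0
      \<Longrightarrow> w \<in> carrier W \<Longrightarrow> (\<lambda>k. nrm W (t (u k) \<ominus>\<^bsub>W\<^esub> w)) \<longlonglongrightarrow> 0 \<Longrightarrow> w = \<zero>\<^bsub>W\<^esub>"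
    and pointwise: "\<And>x. x \<in> carrier V \<Longrightarrow> \<exists>B. \<forall>t\<in>T. nrm W (t x) \<le> B"
  obtains C where "\<And>t x. t \<in> T \<Longrightarrow> x \<in> carrier V \<Longrightarrow> nrm V x \<le> 1 \<Longrightarrow> nrm W (t x) \<le> C"
proof -
  interpret V: banach_space V by (rule V)
  interpret W: banach_space W by (rule W)
  have diff: "t (x \<ominus>\<^bsub>V\<^esub> y) = t x \<ominus>\<^bsub>W\<^esub> t y" if "t \<in> T" "x \<in> carrier V" "y \<in> carrier V" for t x y
    using that by (simp only: V.diff_eq W.diff_eq cl add smult V.smult_cl)
  define S where "S c = {x \<in> carrier V. \<forall>t\<in>T. nrm W (t x) \<le> c}" for c :: real
  have S_cl: "x \<in> carrier V" if "x \<in> S c" for x c using that by (simp add: S_def)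
  have S_nrm: "nrm W (t x) \<le> c" if "x \<in> S c" "t \<in> T" for x c t using that by (simp add: S_def)
  have S_cover: "(\<Union>k::nat. S (real k)) = carrier V"
  proof
    show "carrier V \<subseteq> (\<Union>k::nat. S (real k))"
    proof
      fix x assume x: "x \<in> carrier V"
      then obtain B where B: "\<forall>t\<in>T. nrm W (t x) \<le> B" using pointwise by blast
      obtain k :: nat where "B \<le> real k" using real_arch_simple by blast
      then have "x \<in> S (real k)" using x B by (force simp: S_def)
      then show "x \<in> (\<Union>k::nat. S (real k))" by blast
    qed
  qed (auto simp: S_def)
  obtain k :: nat and x0 r where x0: "x0 \<in> carrier V" and r: "r > 0"
    and ball: "V.met.mball x0 r \<subseteq> V.met.mtopology closure_of S (real k)"
  proof -
    let ?G = "range (\<lambda>k::nat. V.met.mtopology closure_of S (real k))"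
    \<comment> \<open>Otherwise the countable union of these closed sets, which is all of
      \<open>carrier V\<close>, would have empty interior.\<close>
    have "\<exists>k::nat. V.met.mtopology interior_of (V.met.mtopology closure_of S (real k)) \<noteq> {}"
    proof (rule ccontr)
      assume contra: "\<not> ?thesis"
      have "V.met.mtopology interior_of \<Union>?G = {}"
        by (rule V.met.metric_Baire_category_alt[OF V.complete]) (use contra in auto)
      moreover have "\<Union>?G = carrier V"
      proof
        show "carrier V \<subseteq> \<Union>?G"
        proof -
          have "S (real k) \<subseteq> V.met.mtopology closure_of S (real k)" for k :: nat
            by (rule closure_of_subset) (use S_cl in \<open>auto simp: V.met.topspace_mtopology\<close>)
          then have "(\<Union>k::nat. S (real k)) \<subseteq> \<Union>?G" by (rule UN_mono[OF order_refl])
          then show ?thesis by (simp only: S_cover)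
        qed
        show "\<Union>?G \<subseteq> carrier V"
          using closure_of_subset_topspace[of V.met.mtopology] by auto
      qed
      ultimately have "carrier V = {}"
        by (metis V.met.topspace_mtopology interior_of_topspace)
      then show False using V.zero_cl by simp
    qed
    then obtain k x0 where x0: "x0 \<in> V.met.mtopology interior_of (V.met.mtopology closure_of S (real k))"
      by blast
    have "openin V.met.mtopology (V.met.mtopology interior_of (V.met.mtopology closure_of S (real k)))"
      by simp
    then obtain r where "r > 0"
        "V.met.mball x0 r \<subseteq> V.met.mtopology interior_of (V.met.mtopology closure_of S (real k))"
      using x0 V.met.openin_mtopology by meson
    then show ?thesis
      using that x0 interior_of_subset V.met.centre_in_mball_iff
      by (metis (no_types, lifting) closure_of_subset_topspace subset_iff V.met.topspace_mtopology)
  qed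
  have approx: "\<exists>a\<in>S (real k). nrm V (y \<ominus>\<^bsub>V\<^esub> a) < \<eta>"
    if "y \<in> carrier V" "nrm V (x0 \<ominus>\<^bsub>V\<^esub> y) < r" "0 < \<eta>" for y \<eta>
  proof -
    have "y \<in> V.met.mball x0 r" using that x0 by (simp add: ndist_def)
    then have "y \<in> V.met.mtopology closure_of S (real k)" using ball by blast
    then obtain a where "a \<in> S (real k)" "a \<in> V.met.mball y \<eta>"
      using \<open>0 < \<eta>\<close> unfolding V.met.metric_closure_of by blast
    then show ?thesis by (auto simp: ndist_def intro!: bexI[of _ a])
  qed
  \<comment> \<open>Symmetry and convexity of \<open>S k\<close> move the ball to the origin.\<close>
  have approx0: "\<exists>z\<in>S (real k). nrm V (x \<ominus>\<^bsub>V\<^esub> z) < \<eta>"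
    if x: "x \<in> carrier V" and small: "nrm V x < r" and \<eta>: "0 < \<eta>" for x \<eta>
  proof -
    have p: "x0 \<oplus>\<^bsub>V\<^esub> x \<in> carrier V" and q: "x0 \<ominus>\<^bsub>V\<^esub> x \<in> carrier V"
      using x x0 by (auto intro: V.add_cl V.diff_cl)
    have "x0 \<ominus>\<^bsub>V\<^esub> (x0 \<oplus>\<^bsub>V\<^esub> x) = (-1) \<odot>\<^bsub>V\<^esub> x"
    proof -
      have "x0 \<ominus>\<^bsub>V\<^esub> (x0 \<oplus>\<^bsub>V\<^esub> x) = (x0 \<ominus>\<^bsub>V\<^esub> x0) \<oplus>\<^bsub>V\<^esub> (-1) \<odot>\<^bsub>V\<^esub> x"
        using x x0 by (simp add: V.diff_eq V.smult_cl V.smult_add_right V.a_ac)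
      then show ?thesis using x x0 by (simp add: V.diff_self V.smult_cl)
    qed
    then have "nrm V (x0 \<ominus>\<^bsub>V\<^esub> (x0 \<oplus>\<^bsub>V\<^esub> x)) < r" using x small by (simp add: V.nrm_smult)
    then obtain a where a: "a \<in> S (real k)" "nrm V ((x0 \<oplus>\<^bsub>V\<^esub> x) \<ominus>\<^bsub>V\<^esub> a) < \<eta>"
      using approx[OF p _ \<eta>] by blast
    have "x0 \<ominus>\<^bsub>V\<^esub> (x0 \<ominus>\<^bsub>V\<^esub> x) = x"
    proof -
      have "x0 \<ominus>\<^bsub>V\<^esub> (x0 \<ominus>\<^bsub>V\<^esub> x) = (x0 \<ominus>\<^bsub>V\<^esub> x0) \<oplus>\<^bsub>V\<^esub> x"
        using x x0 by (simp add: V.diff_eq V.smult_cl V.smult_add_right V.smult_smult V.smult_1 V.a_ac)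
      then show ?thesis using x x0 by (simp add: V.diff_self)
    qed
    then have "nrm V (x0 \<ominus>\<^bsub>V\<^esub> (x0 \<ominus>\<^bsub>V\<^esub> x)) < r" using small by simp
    then obtain b where b: "b \<in> S (real k)" "nrm V ((x0 \<ominus>\<^bsub>V\<^esub> x) \<ominus>\<^bsub>V\<^esub> b) < \<eta>"
      using approx[OF q _ \<eta>] by blast
    note ac = S_cl[OF a(1)] and bc = S_cl[OF b(1)]
    let ?h = "inverse 2 :: 'k"
    \<comment> \<open>Here \<open>a\<close> is close to x0 + x and \<open>b\<close> to x0 - x, hence
      half their difference is close to \<open>x\<close>.\<close>
    let ?z = "?h \<odot>\<^bsub>V\<^esub> (a \<ominus>\<^bsub>V\<^esub> b)"
    have h: "norm ?h = 1 / 2" by (simp add: norm_inverse)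
    have "?z \<in> S (real k)"
      unfolding S_def
    proof (intro CollectI conjI ballI)
      show "?z \<in> carrier V" using ac bc by (intro V.smult_cl V.diff_cl)
      fix t assume t: "t \<in> T"
      have "nrm W (t ?z) = 1 / 2 * nrm W (t a \<ominus>\<^bsub>W\<^esub> t b)"
        using t ac bc h by (simp only: smult diff V.diff_cl W.nrm_smult W.diff_cl cl)
      also have "\<dots> \<le> 1 / 2 * (nrm W (t a) + nrm W (t b))"
        using t ac bc by (intro mult_left_mono W.nrm_diff_le cl) auto
      also have "\<dots> \<le> real k" using S_nrm[OF a(1) t] S_nrm[OF b(1) t] by simp
      finally show "nrm W (t ?z) \<le> real k" .
    qed
    moreover have "nrm V (x \<ominus>\<^bsub>V\<^esub> ?z) < \<eta>"
    proof -
      have "x = ?h \<odot>\<^bsub>V\<^esub> ((x0 \<oplus>\<^bsub>V\<^esub> x) \<ominus>\<^bsub>V\<^esub> (x0 \<ominus>\<^bsub>V\<^esub> x))"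
        using x x0 by (simp add: V.add_diff_diff V.smult_smult V.smult_1)
      then have "x \<ominus>\<^bsub>V\<^esub> ?z
          = ?h \<odot>\<^bsub>V\<^esub> (((x0 \<oplus>\<^bsub>V\<^esub> x) \<ominus>\<^bsub>V\<^esub> (x0 \<ominus>\<^bsub>V\<^esub> x)) \<ominus>\<^bsub>V\<^esub> (a \<ominus>\<^bsub>V\<^esub> b))"
        using V.smult_diff[OF V.diff_cl[OF p q] V.diff_cl[OF ac bc], of ?h] by simp
      also have "\<dots> = ?h \<odot>\<^bsub>V\<^esub> (((x0 \<oplus>\<^bsub>V\<^esub> x) \<ominus>\<^bsub>V\<^esub> a) \<ominus>\<^bsub>V\<^esub> ((x0 \<ominus>\<^bsub>V\<^esub> x) \<ominus>\<^bsub>V\<^esub> b))"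
        by (simp only: V.diff_diff_swap[OF p ac q bc])
      finally have "nrm V (x \<ominus>\<^bsub>V\<^esub> ?z)
          = 1 / 2 * nrm V (((x0 \<oplus>\<^bsub>V\<^esub> x) \<ominus>\<^bsub>V\<^esub> a) \<ominus>\<^bsub>V\<^esub> ((x0 \<ominus>\<^bsub>V\<^esub> x) \<ominus>\<^bsub>V\<^esub> b))"
        by (simp only: V.nrm_smult[OF V.diff_cl[OF V.diff_cl[OF p ac] V.diff_cl[OF q bc]]] h)
      also have "\<dots> \<le> 1 / 2 * (nrm V ((x0 \<oplus>\<^bsub>V\<^esub> x) \<ominus>\<^bsub>V\<^esub> a) + nrm V ((x0 \<ominus>\<^bsub>V\<^esub> x) \<ominus>\<^bsub>V\<^esub> b))"
        by (intro mult_left_mono V.nrm_diff_le V.diff_cl p q ac bc) auto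
      also have "\<dots> < \<eta>" using a(2) b(2) by simp
      finally show ?thesis .
    qed
    ultimately show ?thesis by blast
  qed
  \<comment> \<open>Homogeneity: multiplication by \<open>s\<close> carries \<open>S k\<close> into
    \<open>S (s * k)\<close>, so the approximation rescales to the ball of radius
    \<open>s * r\<close>.\<close>
  have approx_scaled: "\<exists>z\<in>S (s * real k). nrm V (x \<ominus>\<^bsub>V\<^esub> z) < \<eta>"
    if x: "x \<in> carrier V" and small: "nrm V x < s * r" and s: "0 < s" and \<eta>: "0 < \<eta>" for x s \<eta>
  proof -
    let ?s = "of_real s :: 'k" and ?i = "of_real (inverse s) :: 'k"
    have si: "?s * ?i = 1" using s by (simp only: of_real_mult[symmetric]) simp
    have xi: "?i \<odot>\<^bsub>V\<^esub> x \<in> carrier V" using x by (rule V.smult_cl)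
    have "nrm V (?i \<odot>\<^bsub>V\<^esub> x) = inverse s * nrm V x"
      using s unfolding V.nrm_smult[OF x] norm_of_real by simp
    also have "\<dots> < r" using small s by (simp add: field_simps)
    finally obtain z where z: "z \<in> S (real k)" "nrm V (?i \<odot>\<^bsub>V\<^esub> x \<ominus>\<^bsub>V\<^esub> z) < \<eta> / s"
      using approx0[OF xi, of "\<eta> / s"] \<eta> s by auto
    note zc = S_cl[OF z(1)]
    have "?s \<odot>\<^bsub>V\<^esub> z \<in> S (s * real k)"
      unfolding S_def using s S_nrm[OF z(1)] zc
      by (auto intro!: V.smult_cl simp: smult W.nrm_smult cl)
    moreover have "nrm V (x \<ominus>\<^bsub>V\<^esub> ?s \<odot>\<^bsub>V\<^esub> z) < \<eta>"
    proof -
      have "x \<ominus>\<^bsub>V\<^esub> ?s \<odot>\<^bsub>V\<^esub> z = ?s \<odot>\<^bsub>V\<^esub> (?i \<odot>\<^bsub>V\<^esub> x \<ominus>\<^bsub>V\<^esub> z)"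
        by (simp only: V.smult_diff[OF xi zc] V.smult_smult[OF x] si V.smult_1[OF x])
      then have "nrm V (x \<ominus>\<^bsub>V\<^esub> ?s \<odot>\<^bsub>V\<^esub> z) = s * nrm V (?i \<odot>\<^bsub>V\<^esub> x \<ominus>\<^bsub>V\<^esub> z)"
        using s by (simp only: V.nrm_smult[OF V.diff_cl[OF xi zc]] norm_of_real abs_of_pos)
      then show ?thesis using z(2) s by (simp add: field_simps)
    qed
    ultimately show ?thesis by blast
  qed
  have bound: "nrm W (t x) \<le> 2 * real k"
    if t: "t \<in> T" and x: "x \<in> carrier V" and small: "nrm V x < r" for t x
  proof -
    \<comment> \<open>Successive approximation: \<open>y n\<close> is the remainder after
      \<open>n\<close> steps, and the point subtracted from it lies in \<open>S (k / 2 ^ n)\<close>.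
      The clause for \<open>n = 0\<close> pins the start of the chosen sequence to
      \<open>x\<close>.\<close>
    have "\<exists>y. \<forall>n. (y n \<in> carrier V \<and> nrm V (y n) < r / 2 ^ n \<and> (n = 0 \<longrightarrow> y n = x))
        \<and> y n \<ominus>\<^bsub>V\<^esub> y (Suc n) \<in> S (real k / 2 ^ n)"
    proof (rule dependent_nat_choice)
      show "\<exists>y. y \<in> carrier V \<and> nrm V y < r / 2 ^ 0 \<and> (0 = (0::nat) \<longrightarrow> y = x)"
        using x small by auto
      fix y n assume "y \<in> carrier V \<and> nrm V y < r / 2 ^ n \<and> (n = 0 \<longrightarrow> y = x)"
      then have y: "y \<in> carrier V" "nrm V y < 1 / 2 ^ n * r" by auto
      obtain z where z: "z \<in> S (1 / 2 ^ n * real k)" "nrm V (y \<ominus>\<^bsub>V\<^esub> z) < r / 2 ^ Suc n"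
        using approx_scaled[OF y, of "r / 2 ^ Suc n"] r by auto
      note zc = S_cl[OF z(1)]
      have "y \<ominus>\<^bsub>V\<^esub> (y \<ominus>\<^bsub>V\<^esub> z) = (y \<ominus>\<^bsub>V\<^esub> y) \<oplus>\<^bsub>V\<^esub> z"
        using y zc by (simp add: V.diff_eq V.smult_cl V.smult_add_right V.smult_smult V.smult_1 V.a_ac)
      then have "y \<ominus>\<^bsub>V\<^esub> (y \<ominus>\<^bsub>V\<^esub> z) = z" using y zc by (simp add: V.diff_self)
      then show "\<exists>y'. (y' \<in> carrier V \<and> nrm V y' < r / 2 ^ Suc n \<and> (Suc n = 0 \<longrightarrow> y' = x))
          \<and> y \<ominus>\<^bsub>V\<^esub> y' \<in> S (real k / 2 ^ n)"
        using z y zc by (intro exI[of _ "y \<ominus>\<^bsub>V\<^esub> z"]) (auto intro!: V.diff_cl)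
    qed
    then obtain y where y: "\<And>n. y n \<in> carrier V" "\<And>n. nrm V (y n) < r / 2 ^ n" "y 0 = x"
      and step: "\<And>n. y n \<ominus>\<^bsub>V\<^esub> y (Suc n) \<in> S (real k / 2 ^ n)"
      by metis
    have ty: "t (y n) \<in> carrier W" for n using cl t y(1) by blast
    have tstep: "nrm W (t (y n) \<ominus>\<^bsub>W\<^esub> t (y (Suc n))) \<le> real k / 2 ^ n" for n
      using S_nrm[OF step t] diff[OF t y(1) y(1)] by metis
    \<comment> \<open>The partial geometric sum, kept in closed form so that the induction goes
      through.\<close>
    have tail: "nrm W (t (y m) \<ominus>\<^bsub>W\<^esub> t (y (m + n))) \<le> 2 * (real k / 2 ^ m) - 2 * (real k / 2 ^ (m + n))" for m n
    proof (induction n)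
      case 0
      then show ?case by (simp add: W.diff_self[OF ty] W.nrm_zero)
    next
      case (Suc n)
      have "nrm W (t (y m) \<ominus>\<^bsub>W\<^esub> t (y (m + Suc n)))
          \<le> nrm W (t (y m) \<ominus>\<^bsub>W\<^esub> t (y (m + n))) + nrm W (t (y (m + n)) \<ominus>\<^bsub>W\<^esub> t (y (Suc (m + n))))"
        using W.nrm_diff_triangle[OF ty ty ty] by simp
      also have "\<dots> \<le> 2 * (real k / 2 ^ m) - 2 * (real k / 2 ^ (m + n)) + real k / 2 ^ (m + n)"
        using Suc tstep by (intro add_mono)
      finally show ?case by simp
    qed
    have tail': "nrm W (t (y m) \<ominus>\<^bsub>W\<^esub> t (y n)) \<le> 2 * (real k / 2 ^ m)" if "m \<le> n" for m n
    proof -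
      have "0 \<le> 2 * (real k / 2 ^ n)" and "m + (n - m) = n" using that by simp_all
      then show ?thesis using tail[of m "n - m"] by (smt (verit))
    qed
    have geo: "(\<lambda>m. c / 2 ^ m) \<longlonglongrightarrow> 0" for c :: real
      using tendsto_mult_right_zero[OF LIMSEQ_realpow_zero[of "1 / 2"], of c]
      by (simp add: power_divide)
    obtain w where w: "w \<in> carrier W" "(\<lambda>n. nrm W (t (y n) \<ominus>\<^bsub>W\<^esub> w)) \<longlonglongrightarrow> 0"
    proof (rule W.cauchy_convergent[OF ty])
      fix \<epsilon> :: real assume "0 < \<epsilon>"
      then have "\<forall>\<^sub>F m in sequentially. 2 * real k / 2 ^ m < \<epsilon>"
        using order_tendstoD(2)[OF geo] by blast
      then obtain M where M: "2 * (real k / 2 ^ m) < \<epsilon>" if "m \<ge> M" for m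
        by (auto simp: eventually_sequentially)
      have "nrm W (t (y m) \<ominus>\<^bsub>W\<^esub> t (y n)) < \<epsilon>" if mn: "m \<ge> M" "n \<ge> M" for m n
      proof (cases "m \<le> n")
        case True
        then show ?thesis using tail' M[OF mn(1)] by fastforce
      next
        case False
        then have "n \<le> m" by simp
        then show ?thesis
          using tail'[of n m] M[OF mn(2)] W.nrm_diff_commute[OF ty[of m] ty[of n]] by simp
      qed
      then show "\<exists>M. \<forall>m\<ge>M. \<forall>n\<ge>M. nrm W (t (y m) \<ominus>\<^bsub>W\<^esub> t (y n)) < \<epsilon>" by blast
    qed blast
    have "(\<lambda>n. nrm V (y n)) \<longlonglongrightarrow> 0"
      by (rule tendsto_sandwich[OF _ _ tendsto_const geo[of r]])
        (use y V.nrm_nonneg in \<open>auto intro!: always_eventually less_imp_le\<close>)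
    \<comment> \<open>The remainders tend to 0 while their images tend to \<open>w\<close>.
      Closedness gives \<open>w = 0\<close>, so \<open>t x\<close>, the image of \<open>y 0\<close>,
      is the full telescoping sum.\<close>
    then have w0: "w = \<zero>\<^bsub>W\<^esub>" by (rule closed[OF t y(1) _ w])
    have "nrm W (t (y j) \<ominus>\<^bsub>W\<^esub> t (y 0)) \<le> 2 * real k" for j
      using tail'[of 0 j] W.nrm_diff_commute[OF ty[of 0] ty[of j]] by simp
    then have "nrm W (\<zero>\<^bsub>W\<^esub> \<ominus>\<^bsub>W\<^esub> t (y 0)) \<le> 2 * real k"
      by (rule W.tendsto_nrm_diff_le[OF ty W.zero_cl ty w(2)[unfolded w0]])
    then show ?thesis
      unfolding W.nrm_diff_commute[OF W.zero_cl ty] W.diff_zero[OF ty] unfolding y(3) .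
  qed
  \<comment> \<open>Scaling by \<open>r / 2\<close> puts the closed unit ball strictly inside the
    ball of radius \<open>r\<close>; dividing the bound \<open>2 * k\<close> by \<open>r / 2\<close>
    gives the constant.\<close>
  have "nrm W (t x) \<le> 4 * real k / r" if t: "t \<in> T" and x: "x \<in> carrier V" and le: "nrm V x \<le> 1" for t x
  proof -
    let ?s = "of_real (r / 2) :: 'k"
    have s: "norm ?s = r / 2" using r by (simp only: norm_of_real)
    have "nrm V (?s \<odot>\<^bsub>V\<^esub> x) = r / 2 * nrm V x" by (simp only: V.nrm_smult[OF x] s)
    also have "\<dots> \<le> r / 2 * 1" using le r by (intro mult_left_mono) auto
    also have "\<dots> < r" using r by simp
    finally have "nrm W (t (?s \<odot>\<^bsub>V\<^esub> x)) \<le> 2 * real k"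
      using bound[OF t V.smult_cl[OF x]] by blast
    then have "r / 2 * nrm W (t x) \<le> 2 * real k"
      by (simp only: smult[OF t x] W.nrm_smult[OF cl[OF t x]] s)
    then show ?thesis using r by (simp add: field_simps)
  qed
  then show ?thesis using that by blast
qed

context multilinear_operator
begin

text \<open>Induction on the number \<open>m\<close> of slots that range over unit balls, the
  remaining ones being frozen at \<open>u\<close>. For fixed \<open>v\<close> in slot
  \<open>m\<close>, the induction hypothesis for \<open>u(m := v)\<close> bounds the family of maps
  in slot \<open>m\<close> pointwise, and the uniform closed graph theorem makes this bound uniform
  over the unit ball of that slot.\<close>

lemma closed_graph_bounded_by:
  assumes closed: "\<And>x i u w. x \<in> tuples n E \<Longrightarrow> i < n \<Longrightarrow> (\<And>k. u k \<in> carrier (E i))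
      \<Longrightarrow> (\<lambda>k. nrm (E i) (u k)) \<longlonglongrightarrow> 0 \<Longrightarrow> w \<in> carrier F
      \<Longrightarrow> (\<lambda>k. nrm F (A (x(i := u k)) \<ominus>\<^bsub>F\<^esub> w)) \<longlonglongrightarrow> 0 \<Longrightarrow> w = \<zero>\<^bsub>F\<^esub>"
  obtains C where "0 \<le> C" "bounded_by n E F A C"
proof -
  let ?X = "\<lambda>m u. {x \<in> tuples n E. (\<forall>i<m. nrm (E i) (x i) \<le> 1) \<and> (\<forall>i. m \<le> i \<longrightarrow> i < n \<longrightarrow> x i = u i)}"
  have "\<exists>B. \<forall>x\<in>?X m u. nrm F (A x) \<le> B" if "m \<le> n" "u \<in> tuples n E" for m u
    using that
  proof (induction m arbitrary: u)
    case 0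
    have "x = u" if "x \<in> ?X 0 u" for x
      using that 0 by (intro PiE_ext[of x "{..<n}" "\<lambda>i. carrier (E i)" u]) auto
    then show ?case by blast
  next
    case (Suc m)
    then have m: "m < n" by simp
    interpret Em: banach_space "E m" by (rule dom[OF m])
    \<comment> \<open>The map belonging to \<open>x\<close> overwrites slot \<open>m\<close>; taking
      \<open>v = x m\<close> recovers \<open>A x\<close> at the end.\<close>
    let ?T = "(\<lambda>x v. A (x(m := v))) ` ?X (Suc m) u"
    have cl: "t v \<in> carrier F" if "t \<in> ?T" "v \<in> carrier (E m)" for t v
      using that by (auto intro!: op_cl upd_cl[OF _ m] simp del: fun_upd_apply)
    obtain C where C: "\<And>t v. t \<in> ?T \<Longrightarrow> v \<in> carrier (E m) \<Longrightarrow> nrm (E m) v \<le> 1 \<Longrightarrow> nrm F (t v) \<le> C"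
    proof (rule uniform_closed_graph[OF Em.banach_space_axioms cod, of ?T])
      show "t v \<in> carrier F" if "t \<in> ?T" "v \<in> carrier (E m)" for t v
        by (rule cl[OF that])
      show "t (v \<oplus>\<^bsub>E m\<^esub> w) = t v \<oplus>\<^bsub>F\<^esub> t w"
        if "t \<in> ?T" "v \<in> carrier (E m)" "w \<in> carrier (E m)" for t v w
        using that(1) op_add[OF _ m that(2,3)] by blast
      show "t (a \<odot>\<^bsub>E m\<^esub> v) = a \<odot>\<^bsub>F\<^esub> t v" if "t \<in> ?T" "v \<in> carrier (E m)" for t a v
        using that(1) op_smult[OF _ m that(2)] by blast
      show "w = \<zero>\<^bsub>F\<^esub>" if t: "t \<in> ?T" and v: "\<And>k. v k \<in> carrier (E m)"
        and lim: "(\<lambda>k. nrm (E m) (v k)) \<longlonglongrightarrow> 0" and w: "w \<in> carrier F"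
          "(\<lambda>k. nrm F (t (v k) \<ominus>\<^bsub>F\<^esub> w)) \<longlonglongrightarrow> 0" for t v w
      proof -
        obtain x where x: "x \<in> tuples n E" "t = (\<lambda>v. A (x(m := v)))" using t by blast
        show ?thesis using closed[OF x(1) m v lim w(1)] w(2) unfolding x(2) by blast
      qed
      show "\<exists>B. \<forall>t\<in>?T. nrm F (t v) \<le> B" if v: "v \<in> carrier (E m)" for v
      proof -
        obtain B where B: "\<forall>x\<in>?X m (u(m := v)). nrm F (A x) \<le> B"
          using Suc.IH[OF _ upd_cl[OF Suc.prems(2) m v]] m by auto
        have mem: "x(m := v) \<in> ?X m (u(m := v))" if "x \<in> ?X (Suc m) u" for x
        proof -
          have "x \<in> tuples n E" using that by blast
          then show ?thesis using that upd_cl[OF _ m v, of x] by simp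
        qed
        show ?thesis
        proof (intro exI ballI)
          fix t assume "t \<in> ?T"
          then obtain x where x: "x \<in> ?X (Suc m) u" "t = (\<lambda>v. A (x(m := v)))" by (rule imageE)
          show "nrm F (t v) \<le> B" unfolding x(2) by (rule bspec[OF B mem[OF x(1)]])
        qed
      qed
    next
      fix C assume "\<And>t v. t \<in> ?T \<Longrightarrow> v \<in> carrier (E m) \<Longrightarrow> nrm (E m) v \<le> 1 \<Longrightarrow> nrm F (t v) \<le> C"
      then show thesis by (rule that)
    qed
    have "nrm F (A x) \<le> C" if x: "x \<in> ?X (Suc m) u" for x
    proof -
      have "x m \<in> carrier (E m)" "nrm (E m) (x m) \<le> 1" using x m by auto
      then have "nrm F (A (x(m := x m))) \<le> C"
        by (rule C[of "\<lambda>v. A (x(m := v))" "x m", OF imageI[OF x]])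
      then show ?thesis by simp
    qed
    then show ?case by blast
  qed
  from this[of n "\<lambda>i\<in>{..<n}. \<zero>\<^bsub>E i\<^esub>"] zero_tuple
  obtain B where B: "\<forall>x\<in>?X n (\<lambda>i\<in>{..<n}. \<zero>\<^bsub>E i\<^esub>). nrm F (A x) \<le> B" by blast
  have "bounded_by n E F A (max 0 B)"
  proof (rule bounded_by_unit_ball)
    fix x assume "x \<in> tuples n E" "\<And>i. i < n \<Longrightarrow> nrm (E i) (x i) \<le> 1"
    then have "nrm F (A x) \<le> B" using B by auto
    then show "nrm F (A x) \<le> max 0 B" by simp
  qed
  then show ?thesis using that[of "max 0 B"] by simp
qed

end

section \<open>Continuous homogeneous polynomials and their symmetric operators\<close>

lemma poly_space_simps:
  "carrier (poly_space n E F) = {P \<in> carrier E \<rightarrow>\<^sub>E carrier F.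
     (\<exists>A \<in> multilinear n (\<lambda>_. E) F. \<forall>x\<in>carrier E. P x = A (const_tuple n x)) \<and>
     continuous_map (ntop E) (ntop F) P}"
  "\<zero>\<^bsub>poly_space n E F\<^esub> = (\<lambda>x\<in>carrier E. \<zero>\<^bsub>F\<^esub>)"
  "P \<oplus>\<^bsub>poly_space n E F\<^esub> Q = (\<lambda>x\<in>carrier E. P x \<oplus>\<^bsub>F\<^esub> Q x)"
  "a \<odot>\<^bsub>poly_space n E F\<^esub> P = (\<lambda>x\<in>carrier E. a \<odot>\<^bsub>F\<^esub> P x)"
  "nrm (poly_space n E F) P = (SUP x \<in> {x \<in> carrier E. nrm E x \<le> 1}. nrm F (P x))"
  by (simp_all add: poly_space_def)

context multilinear_power
begin

lemma const_cl: "v \<in> carrier E \<Longrightarrow> const_tuple n v \<in> tuples n (\<lambda>_. E)"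
  by auto

text \<open>The diagonal map into the product is continuous, and so is its composition with
  \<open>A\<close>.\<close>

lemma poly_spaceI:
  assumes "bounded_by n (\<lambda>_. E) F A C" "0 \<le> C"
  shows "(\<lambda>v\<in>carrier E. A (const_tuple n v)) \<in> carrier (poly_space n E F)" (is "?P \<in> _")
proof -
  let ?T = "product_topology (\<lambda>_. ntop E) {..<n}"
  have "continuous_map ?T (ntop F) A"
    using bounded_by_imp_continuous[OF assms] by (simp add: cmultilinear_def)
  moreover have "continuous_map (ntop E) ?T (\<lambda>v. const_tuple n v)"
    unfolding continuous_map_componentwise by auto
  ultimately have "continuous_map (ntop E) (ntop F) (A \<circ> (\<lambda>v. const_tuple n v))"
    by (rule continuous_map_compose[rotated])
  then have "continuous_map (ntop E) (ntop F) ?P"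
    by (rule continuous_map_eq) (simp add: dom.topspace_ntop)
  moreover have "?P \<in> carrier E \<rightarrow>\<^sub>E carrier F"
    using op_cl[OF const_cl] by (intro restrict_PiE_iff[THEN iffD2]) blast
  moreover have "\<forall>x\<in>carrier E. ?P x = A (const_tuple n x)" by simp
  ultimately show ?thesis using multilinear unfolding poly_space_simps by blast
qed

lemma op_const_smult:
  "v \<in> carrier E \<Longrightarrow> A (const_tuple n (a \<odot>\<^bsub>E\<^esub> v)) = a ^ n \<odot>\<^bsub>F\<^esub> A (const_tuple n v)"
  using op_smult_all[OF const_cl, of v "\<lambda>_. a"] by (simp cong: restrict_cong)

end

lemma poly_cl: "P \<in> carrier (poly_space n E F) \<Longrightarrow> v \<in> carrier E \<Longrightarrow> P v \<in> carrier F"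
  by (auto simp: poly_space_simps)

lemma poly_ext: "P \<in> carrier (poly_space n E F) \<Longrightarrow> P \<in> extensional (carrier E)"
  by (auto simp: poly_space_simps PiE_def)

lemma poly_smult:
  assumes "banach_space E" "banach_space F" "P \<in> carrier (poly_space n E F)" "v \<in> carrier E"
  shows "P (a \<odot>\<^bsub>E\<^esub> v) = a ^ n \<odot>\<^bsub>F\<^esub> P v"
proof -
  interpret E: banach_space E by fact
  obtain A where A: "A \<in> multilinear n (\<lambda>_. E) F" "\<forall>x\<in>carrier E. P x = A (const_tuple n x)"
    using assms(3) unfolding poly_space_simps by blast
  interpret A: multilinear_power n E F A by (rule multilinear_powerI[OF assms(1,2) A(1)])
  show ?thesis using A(2) A.op_const_smult[OF assms(4)] assms(4) E.smult_cl[OF assms(4)] by simp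
qed

text \<open>The operator representing a polynomial is not assumed to be continuous, so the estimate
  has to come from the continuity of \<open>P\<close> at the origin together with
  homogeneity.\<close>

lemma poly_nrm_bound:
  fixes E :: "('k :: {real_normed_field, banach}, 'a) normed_module"
  assumes "banach_space E" "banach_space F" and P: "P \<in> carrier (poly_space n E F)"
  shows "0 \<le> nrm (poly_space n E F) P"
    and "v \<in> carrier E \<Longrightarrow> nrm F (P v) \<le> nrm (poly_space n E F) P * nrm E v ^ n"
proof -
  interpret E: banach_space E by fact
  interpret F: banach_space F by fact
  note cl = poly_cl[OF P]
  have "continuous_map (ntop E) F.met.mtopology P" using P by (simp add: poly_space_simps ntop_def)
  then obtain U where "openin (ntop E) U" "\<zero>\<^bsub>E\<^esub> \<in> U" and U: "\<forall>y\<in>U. P y \<in> F.met.mball (P \<zero>\<^bsub>E\<^esub>) 1"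
    unfolding F.met.continuous_map_to_metric E.topspace_ntop using E.zero_cl zero_less_one by meson
  then obtain r where r: "r > 0" "E.met.mball \<zero>\<^bsub>E\<^esub> r \<subseteq> U"
    by (auto simp: ntop_def E.met.openin_mtopology)
  have small: "nrm F (P v) \<le> 1 + nrm F (P \<zero>\<^bsub>E\<^esub>)" if v: "v \<in> carrier E" "nrm E v < r" for v
  proof -
    have "v \<in> E.met.mball \<zero>\<^bsub>E\<^esub> r"
      using v E.nrm_diff_commute[OF v(1) E.zero_cl] by (simp add: ndist_def E.diff_zero)
    then have "P v \<in> F.met.mball (P \<zero>\<^bsub>E\<^esub>) 1" using r U by blast
    then have "nrm F (P v \<ominus>\<^bsub>F\<^esub> P \<zero>\<^bsub>E\<^esub>) < 1"
      using F.nrm_diff_commute[OF cl[OF v(1)] cl[OF E.zero_cl]] by (auto simp: ndist_def split: if_splits)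
    then show ?thesis using F.nrm_le_diff[OF cl[OF v(1)] cl[OF E.zero_cl]] by simp
  qed
  \<comment> \<open>The factor \<open>r / 2\<close> keeps the scaled unit ball strictly inside the
    ball of radius \<open>r\<close> provided by continuity at the origin.\<close>
  define B where "B = (1 + nrm F (P \<zero>\<^bsub>E\<^esub>)) / (r / 2) ^ n"
  let ?U = "{x \<in> carrier E. nrm E x \<le> 1}"
  have B: "nrm F (P v) \<le> B" if v: "v \<in> ?U" for v
  proof -
    let ?s = "of_real (r / 2) :: 'k"
    have vc: "v \<in> carrier E" and v1: "nrm E v \<le> 1" using v by auto
    have s: "norm ?s = r / 2" using r by (simp only: norm_of_real)
    have "nrm E (?s \<odot>\<^bsub>E\<^esub> v) = r / 2 * nrm E v" by (simp only: E.nrm_smult[OF vc] s)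
    also have "\<dots> \<le> r / 2 * 1" using v1 r by (intro mult_left_mono) auto
    also have "\<dots> < r" using r by simp
    finally have "nrm F (P (?s \<odot>\<^bsub>E\<^esub> v)) \<le> 1 + nrm F (P \<zero>\<^bsub>E\<^esub>)"
      using small[OF E.smult_cl[OF vc]] by blast
    then have "(r / 2) ^ n * nrm F (P v) \<le> 1 + nrm F (P \<zero>\<^bsub>E\<^esub>)"
      by (simp only: poly_smult[OF assms vc] F.nrm_smult[OF cl[OF vc]] norm_power s)
    then show ?thesis using r(1) unfolding B_def
      by (subst pos_le_divide_eq) (auto simp: mult.commute)
  qed
  then have bdd: "bdd_above ((\<lambda>x. nrm F (P x)) ` ?U)" by (rule bdd_aboveI2)
  have ball: "nrm F (P v) \<le> nrm (poly_space n E F) P" if "v \<in> ?U" for v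
    unfolding poly_space_simps by (rule cSUP_upper[OF that bdd])
  have "\<zero>\<^bsub>E\<^esub> \<in> ?U" by (simp add: E.nrm_zero)
  from ball[OF this] show nn: "0 \<le> nrm (poly_space n E F) P"
    using F.nrm_nonneg[OF cl[OF E.zero_cl]] by linarith
  show "nrm F (P v) \<le> nrm (poly_space n E F) P * nrm E v ^ n" if v: "v \<in> carrier E"
  proof (cases "v = \<zero>\<^bsub>E\<^esub>")
    case False
    then have pos: "0 < nrm E v" using E.nrm_nonneg[OF v] E.nrm_eq_0_iff[OF v] by linarith
    let ?s = "of_real (inverse (nrm E v)) :: 'k"
    have s: "norm ?s = inverse (nrm E v)" using pos by (simp only: norm_of_real) simp
    have "nrm E (?s \<odot>\<^bsub>E\<^esub> v) = 1" using pos by (simp only: E.nrm_smult[OF v] s) simp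
    then have "nrm F (P (?s \<odot>\<^bsub>E\<^esub> v)) \<le> nrm (poly_space n E F) P"
      using E.smult_cl[OF v] by (intro ball) simp
    then have "inverse (nrm E v) ^ n * nrm F (P v) \<le> nrm (poly_space n E F) P"
      by (simp only: poly_smult[OF assms v] F.nrm_smult[OF cl[OF v]] norm_power s)
    then show ?thesis using pos by (simp add: power_inverse field_simps)
  next
    case True
    show ?thesis
    \<comment> \<open>For \<open>n = 0\<close> the power \<open>nrm E v ^ n\<close> is 1 even at the
      origin, and the value there is bounded by the supremum; for positive \<open>n\<close> it
      vanishes.\<close>
    proof (cases "n = 0")
      case True
      then show ?thesis using ball[OF \<open>\<zero>\<^bsub>E\<^esub> \<in> ?U\<close>] \<open>v = \<zero>\<^bsub>E\<^esub>\<close> by simp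
    next
      case n: False
      have "P (0 \<odot>\<^bsub>E\<^esub> v) = 0 ^ n \<odot>\<^bsub>F\<^esub> P v" by (rule poly_smult[OF assms v])
      moreover have "(0 :: 'k) ^ n = 0" using n by simp
      ultimately have "P v = \<zero>\<^bsub>F\<^esub>"
        by (simp only: True E.smult_zero F.smult_0[OF cl[OF E.zero_cl]])
      then show ?thesis using nn E.nrm_nonneg[OF v] by (simp add: F.nrm_zero)
    qed
  qed
qed

lemma symmetric_of_eqI:
  assumes A: "symmetric_power n E F A" and eq: "\<And>v. v \<in> carrier E \<Longrightarrow> A (const_tuple n v) = P v"
  shows "symmetric_of n E F P = A"
  unfolding symmetric_of_def
proof (rule the_equality)
  interpret A: symmetric_power n E F A by fact
  show "A \<in> multilinear n (\<lambda>_. E) F \<and> symmetric_operator n E A \<and> (\<forall>x\<in>carrier E. A (const_tuple n x) = P x)"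
    using A.multilinear A.symmetric eq by blast
  fix B assume B: "B \<in> multilinear n (\<lambda>_. E) F \<and> symmetric_operator n E B \<and> (\<forall>x\<in>carrier E. B (const_tuple n x) = P x)"
  then have "symmetric_power n E F B"
    by (intro symmetric_power.intro symmetric_power_axioms.intro multilinear_powerI
        A.dom.banach_space_axioms A.cod) auto
  then show "B = A" using B eq by (intro symmetric_power_unique[OF _ A]) auto
qed

text \<open>Symmetrizing any representing operator gives existence. Continuity of the polynomial
  bounds the symmetric operator through the polarization inequality, although the representing one
  may be unbounded.\<close>

lemma symmetric_of_poly:
  assumes E: "banach_space E" and F: "banach_space F" and P: "P \<in> carrier (poly_space n E F)"
  shows "symmetric_power n E F (symmetric_of n E F P)"
    and "v \<in> carrier E \<Longrightarrow> symmetric_of n E F P (const_tuple n v) = P v"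
    and "bounded_by n (\<lambda>_. E) F (symmetric_of n E F P) (real n ^ n / fact n * nrm (poly_space n E F) P)"
proof -
  obtain A where A: "A \<in> multilinear n (\<lambda>_. E) F" "\<forall>x\<in>carrier E. P x = A (const_tuple n x)"
    using P unfolding poly_space_simps by blast
  interpret A: multilinear_power n E F A by (rule multilinear_powerI[OF E F A(1)])
  have eq: "symmetric_of n E F P = symmetrize n E F A"
    by (rule symmetric_of_eqI[OF A.symmetrize_symmetric_power]) (simp add: A.symmetrize_const A(2))
  show sp: "symmetric_power n E F (symmetric_of n E F P)"
    unfolding eq by (rule A.symmetrize_symmetric_power)
  show const: "symmetric_of n E F P (const_tuple n v) = P v" if "v \<in> carrier E" for v
    unfolding eq using that by (simp add: A.symmetrize_const A(2))
  show "bounded_by n (\<lambda>_. E) F (symmetric_of n E F P) (real n ^ n / fact n * nrm (poly_space n E F) P)"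
    by (rule symmetric_power.bounded_by_polarization[OF sp])
      (simp_all add: const poly_nrm_bound[OF E F P])
qed

text \<open>Homogeneity with scalar 2 equates \<open>2 ^ m\<close> and \<open>2 ^ n\<close> times
  the same vector. This is what makes a norm computed in one chosen degree independent of the
  choice.\<close>

lemma poly_degree_unique:
  assumes E: "banach_space E" and F: "banach_space F"
    and Pm: "P \<in> carrier (poly_space m E F)" and Pn: "P \<in> carrier (poly_space n E F)" and "m \<noteq> n"
  shows "P = (\<lambda>v\<in>carrier E. \<zero>\<^bsub>F\<^esub>)"
proof (rule extensionalityI[OF poly_ext[OF Pn]])
  interpret F: banach_space F by fact
  fix v assume v: "v \<in> carrier E"
  note Pv = poly_cl[OF Pn v]
  have "2 ^ m \<odot>\<^bsub>F\<^esub> P v = 2 ^ n \<odot>\<^bsub>F\<^esub> P v"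
    using poly_smult[OF E F Pm v, of 2] poly_smult[OF E F Pn v, of 2] by simp
  then have "2 ^ m * nrm F (P v) = 2 ^ n * nrm F (P v)"
    using F.nrm_smult[OF Pv, of "2 ^ m"] F.nrm_smult[OF Pv, of "2 ^ n"]
    unfolding norm_power norm_numeral by metis
  then have "nrm F (P v) = 0" using \<open>m \<noteq> n\<close> by auto
  then show "P v = (\<lambda>v\<in>carrier E. \<zero>\<^bsub>F\<^esub>) v" using v F.nrm_eq_0_iff[OF Pv] by simp
qed simp

section \<open>Stable sequence classes\<close>

lemma scalar_space_simps:
  "carrier scalar_space = range Inl" "\<zero>\<^bsub>scalar_space\<^esub> = Inl 0"
  "x \<oplus>\<^bsub>scalar_space\<^esub> y = Inl (projl x + projl y)" "a \<odot>\<^bsub>scalar_space\<^esub> x = Inl (a * projl x)"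
  "nrm scalar_space x = norm (projl x)"
  by (simp_all add: scalar_space_def)

lemma banach_scalar_space: "banach_space (scalar_space :: ('k :: {real_normed_field, banach}, 'u) bspace)"
proof (rule banach_spaceI)
  fix u :: "nat \<Rightarrow> 'k + 'u"
  assume cauchy: "\<And>\<epsilon>. 0 < \<epsilon> \<Longrightarrow> \<exists>M. \<forall>k\<ge>M. \<forall>l\<ge>M. nrm scalar_space
    (u k \<oplus>\<^bsub>scalar_space\<^esub> (-1) \<odot>\<^bsub>scalar_space\<^esub> u l) < \<epsilon>"
  have "Cauchy (\<lambda>k. projl (u k))"
    by (rule CauchyI) (use cauchy in \<open>simp add: scalar_space_simps\<close>)
  then obtain c where "(\<lambda>k. projl (u k)) \<longlonglongrightarrow> c"
    using Cauchy_convergent convergent_def by blast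
  then have "(\<lambda>k. norm (projl (u k) - c)) \<longlonglongrightarrow> 0"
    by (simp add: LIM_zero tendsto_norm_zero)
  then show "\<exists>l\<in>carrier scalar_space. (\<lambda>k. nrm scalar_space
      (u k \<oplus>\<^bsub>scalar_space\<^esub> (-1) \<odot>\<^bsub>scalar_space\<^esub> l)) \<longlonglongrightarrow> 0"
    by (intro bexI[of _ "Inl c"]) (simp_all add: scalar_space_simps)
qed (auto simp: scalar_space_simps algebra_simps norm_mult norm_triangle_ineq)

locale seq_class =
  fixes X :: "('k :: {real_normed_field, banach}, 'u) seq_rule"
  assumes sequence_class: "sequence_class X"
begin

lemma
  assumes "banach_space E"
  shows banach: "banach_space (X E)" and c00: "c00 E \<subseteq> carrier (X E)"
    and embedded: "norm_embedded (X E) (linfty E)"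
  using sequence_class assms unfolding sequence_class_def by blast+

lemma nrm_unit_seq: "nrm (X scalar_space) (unit_seq j) = 1"
  using sequence_class unfolding sequence_class_def by blast

context
  fixes E :: "('k, 'u) bspace" assumes E: "banach_space E"
begin

interpretation E: banach_space E by (rule E)
interpretation XE: banach_space "X E" by (rule banach[OF E])

lemma mem_linfty: "x \<in> carrier (X E) \<Longrightarrow> x \<in> carrier (linfty E)"
  using embedded[OF E] by (auto simp: norm_embedded_def)

lemma coord_cl: "x \<in> carrier (X E) \<Longrightarrow> x j \<in> carrier E"
  using mem_linfty[of x] by (auto simp: linfty_def)

lemma nrm_coord_le: "x \<in> carrier (X E) \<Longrightarrow> nrm E (x j) \<le> nrm (X E) x"
proof -
  assume x: "x \<in> carrier (X E)"
  have "nrm E (x j) \<le> (SUP j. nrm E (x j))"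
    using mem_linfty[OF x] by (intro cSUP_upper) (auto simp: linfty_def)
  also have "\<dots> \<le> nrm (X E) x"
    using embedded[OF E] x by (simp add: norm_embedded_def linfty_def)
  finally show ?thesis .
qed

lemma zero_coord: "\<zero>\<^bsub>X E\<^esub> = (\<lambda>j. \<zero>\<^bsub>E\<^esub>)"
  using embedded[OF E] by (simp add: norm_embedded_def linfty_def)

lemma add_coord: "x \<in> carrier (X E) \<Longrightarrow> y \<in> carrier (X E) \<Longrightarrow> x \<oplus>\<^bsub>X E\<^esub> y = (\<lambda>j. x j \<oplus>\<^bsub>E\<^esub> y j)"
  using embedded[OF E] by (simp add: norm_embedded_def linfty_def)

lemma smult_coord: "x \<in> carrier (X E) \<Longrightarrow> a \<odot>\<^bsub>X E\<^esub> x = (\<lambda>j. a \<odot>\<^bsub>E\<^esub> x j)"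
  using embedded[OF E] by (simp add: norm_embedded_def linfty_def)

lemma diff_coord:
  assumes x: "x \<in> carrier (X E)" and y: "y \<in> carrier (X E)"
  shows "x \<ominus>\<^bsub>X E\<^esub> y = (\<lambda>j. x j \<ominus>\<^bsub>E\<^esub> y j)"
  unfolding XE.diff_eq[OF x y] add_coord[OF x XE.smult_cl[OF y]]
  by (simp only: smult_coord[OF y] E.diff_eq[OF coord_cl[OF x] coord_cl[OF y]])

lemma finsum_coord:
  assumes "finite I" "g \<in> I \<rightarrow> carrier (X E)"
  shows "finsum (X E) g I = (\<lambda>j. finsum E (\<lambda>i. g i j) I)"
  using assms
proof (induction I)
  case empty
  show ?case by (simp add: zero_coord)
next
  case (insert i I)
  then have g: "g i \<in> carrier (X E)" "g \<in> I \<rightarrow> carrier (X E)" by auto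
  then have "finsum (X E) g (insert i I) = g i \<oplus>\<^bsub>X E\<^esub> finsum (X E) g I"
    using insert by (intro XE.finsum_insert) auto
  also have "\<dots> = (\<lambda>j. g i j \<oplus>\<^bsub>E\<^esub> finsum (X E) g I j)"
    by (rule add_coord[OF g(1) XE.finsum_closed[OF g(2)]])
  also have "\<dots> = (\<lambda>j. g i j \<oplus>\<^bsub>E\<^esub> finsum E (\<lambda>i. g i j) I)"
    using insert.IH[OF g(2)] by simp
  also have "\<dots> = (\<lambda>j. finsum E (\<lambda>i. g i j) (insert i I))"
    using g insert.hyps coord_cl
    by (intro ext E.finsum_insert[symmetric]) (auto simp: Pi_def)
  finally show ?case .
qed

text \<open>The norm of \<open>X E\<close> dominates that of every coordinate, so limits in
  \<open>X E\<close> can be identified coordinate by coordinate.\<close>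

lemma tendsto_coord:
  assumes "\<And>k. u k \<in> carrier (X E)" "l \<in> carrier (X E)" "(\<lambda>k. nrm (X E) (u k \<ominus>\<^bsub>X E\<^esub> l)) \<longlonglongrightarrow> 0"
  shows "(\<lambda>k. nrm E (u k j \<ominus>\<^bsub>E\<^esub> l j)) \<longlonglongrightarrow> 0"
proof (rule tendsto_sandwich[OF _ _ tendsto_const assms(3)])
  have "nrm E (u k j \<ominus>\<^bsub>E\<^esub> l j) \<le> nrm (X E) (u k \<ominus>\<^bsub>X E\<^esub> l)" for k
    using nrm_coord_le[OF XE.diff_cl[OF assms(1)[of k] assms(2)], of j]
    by (simp add: diff_coord assms)
  then show "\<forall>\<^sub>F k in sequentially. nrm E (u k j \<ominus>\<^bsub>E\<^esub> l j) \<le> nrm (X E) (u k \<ominus>\<^bsub>X E\<^esub> l)"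
    by simp
  show "\<forall>\<^sub>F k in sequentially. 0 \<le> nrm E (u k j \<ominus>\<^bsub>E\<^esub> l j)"
    using E.nrm_nonneg[OF E.diff_cl[OF coord_cl[OF assms(1)] coord_cl[OF assms(2)]]] by simp
qed

end

lemma unit_seq_cl: "unit_seq j \<in> carrier (X scalar_space)"
proof -
  have "\<forall>\<^sub>F i in sequentially. i \<noteq> j"
    using eventually_gt_at_top[of j] by eventually_elim simp
  then have "unit_seq j \<in> c00 scalar_space"
    by (auto simp: c00_def unit_seq_def scalar_space_simps elim: eventually_mono)
  then show ?thesis using c00[OF banach_scalar_space] by blast
qed

end

section \<open>Coordinatewise action of operators with a constant\<close>

text \<open>One predicate with two classes and separate domain spaces covers both stability, where
  \<open>X\<close> and \<open>Y\<close> agree, and summability. The constant need not be the least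
  one, which spares suprema in all compositions.\<close>

definition summing_by ::
    "('k, 'u) seq_rule \<Rightarrow> ('k, 'u) seq_rule \<Rightarrow> nat \<Rightarrow> (nat \<Rightarrow> ('k, 'u) bspace) \<Rightarrow> ('k, 'u) bspace
      \<Rightarrow> ((nat \<Rightarrow> 'k + 'u) \<Rightarrow> 'k + 'u) \<Rightarrow> real \<Rightarrow> bool"
where
  "summing_by X Y n E F A C \<longleftrightarrow>
    (\<forall>x\<in>tuples n (\<lambda>m. X (E m)). (\<lambda>j. A (\<lambda>m\<in>{..<n}. x m j)) \<in> carrier (Y F) \<and>
       nrm (Y F) (\<lambda>j. A (\<lambda>m\<in>{..<n}. x m j)) \<le> C * (\<Prod>m<n. nrm (X (E m)) (x m)))"

lemma summing_byD:
  assumes "summing_by X Y n E F A C" "x \<in> tuples n (\<lambda>m. X (E m))"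
  shows "(\<lambda>j. A (\<lambda>m\<in>{..<n}. x m j)) \<in> carrier (Y F)"
    and "nrm (Y F) (\<lambda>j. A (\<lambda>m\<in>{..<n}. x m j)) \<le> C * (\<Prod>m<n. nrm (X (E m)) (x m))"
  using assms by (auto simp: summing_by_def)

lemma cmultilinear_multilinear: "A \<in> cmultilinear n E F \<Longrightarrow> A \<in> multilinear n E F"
  by (simp add: cmultilinear_def)

locale stable_seq_class = seq_class +
  assumes stable: "multilinearly_stable X"
begin

text \<open>Stability equates the norm of the induced operator with that of \<open>A\<close>, and
  \<open>C\<close> bounds the latter. Continuity of the induced operator turns its norm, a supremum,
  into an estimate at \<open>x\<close>.\<close>

lemma summing_by_stable:
  assumes "multilinear_operator n E F A" "1 \<le> n" "bounded_by n E F A C" "0 \<le> C"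
  shows "summing_by X X n E F A C"
  unfolding summing_by_def
proof
  fix x assume x: "x \<in> tuples n (\<lambda>m. X (E m))"
  interpret A: multilinear_operator n E F A by fact
  let ?T = "induced n (\<lambda>m. X (E m)) A"
  have "A \<in> cmultilinear n E F" using A.bounded_by_imp_continuous[OF assms(3,4)] .
  moreover have "\<forall>m<n. banach_space (E m)" using A.dom by blast
  ultimately have mem: "\<forall>x\<in>tuples n (\<lambda>m. X (E m)). (\<lambda>j. A (\<lambda>m\<in>{..<n}. x m j)) \<in> carrier (X F)"
    and T: "?T \<in> cmultilinear n (\<lambda>m. X (E m)) (X F)"
    and norm: "multilinear_norm n (\<lambda>m. X (E m)) (X F) ?T = multilinear_norm n E F A"
    using stable assms(2) A.cod unfolding multilinearly_stable_def by blast+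
  interpret T: multilinear_operator n "\<lambda>m. X (E m)" "X F" ?T
    by (intro multilinear_operator.intro banach A.dom A.cod cmultilinear_multilinear[OF T])
  obtain D where D: "0 \<le> D" "bounded_by n (\<lambda>m. X (E m)) (X F) ?T D"
    using T.continuous_imp_bounded_by[OF T] .
  have "bounded_by n (\<lambda>m. X (E m)) (X F) ?T (multilinear_norm n E F A)"
    using T.multilinear_norm_nonneg_bound(3)[OF D(2,1)] unfolding norm .
  from this[unfolded bounded_by_def, rule_format, OF x]
  have "nrm (X F) (?T x) \<le> multilinear_norm n E F A * (\<Prod>m<n. nrm (X (E m)) (x m))" .
  also have "\<dots> \<le> C * (\<Prod>m<n. nrm (X (E m)) (x m))"
    using A.multilinear_norm_nonneg_bound(1)[OF assms(3,4)] T.nrm_entry_nonneg[OF x]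
    by (intro mult_right_mono prod_nonneg) auto
  finally show "(\<lambda>j. A (\<lambda>m\<in>{..<n}. x m j)) \<in> carrier (X F) \<and>
      nrm (X F) (\<lambda>j. A (\<lambda>m\<in>{..<n}. x m j)) \<le> C * (\<Prod>m<n. nrm (X (E m)) (x m))"
    using mem x by (simp add: induced_def)
qed

end

lemma linear_multilinear:
  assumes "banach_space E" "banach_space F"
    and "\<And>v. v \<in> carrier E \<Longrightarrow> f v \<in> carrier F"
    and "\<And>v w. v \<in> carrier E \<Longrightarrow> w \<in> carrier E \<Longrightarrow> f (v \<oplus>\<^bsub>E\<^esub> w) = f v \<oplus>\<^bsub>F\<^esub> f w"
    and "\<And>a v. v \<in> carrier E \<Longrightarrow> f (a \<odot>\<^bsub>E\<^esub> v) = a \<odot>\<^bsub>F\<^esub> f v"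
  shows "multilinear_operator 1 (\<lambda>_. E) F (\<lambda>x\<in>tuples 1 (\<lambda>_. E). f (x 0))"
proof (intro multilinear_operator.intro assms(1,2))
  interpret E: banach_space E by fact
  let ?A = "\<lambda>x\<in>tuples 1 (\<lambda>_. E). f (x 0)"
  show "?A \<in> multilinear 1 (\<lambda>_. E) F"
    unfolding multilinear_def
  proof (intro CollectI conjI ballI allI impI)
    show "?A \<in> tuples 1 (\<lambda>_. E) \<rightarrow>\<^sub>E carrier F" by (auto intro!: assms(3))
    fix x i assume x: "x \<in> tuples 1 (\<lambda>_. E)" and "i < (1 :: nat)"
    then have i: "i = 0" by simp
    have x0: "x 0 \<in> carrier E" using x by auto
    have upd: "x(0 := v) \<in> tuples 1 (\<lambda>_. E)" if "v \<in> carrier E" for v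
      using x that by (auto simp: PiE_def extensional_def)
    show "?A (x(i := x i \<oplus>\<^bsub>E\<^esub> y)) = ?A x \<oplus>\<^bsub>F\<^esub> ?A (x(i := y))" if y: "y \<in> carrier E" for y
      unfolding i restrict_apply'[OF x] restrict_apply'[OF upd[OF y]] restrict_apply'[OF upd[OF E.add_cl[OF x0 y]]]
      by (simp add: assms(4) x0 y)
    show "?A (x(i := a \<odot>\<^bsub>E\<^esub> x i)) = a \<odot>\<^bsub>F\<^esub> ?A x" for a
      unfolding i restrict_apply'[OF x] restrict_apply'[OF upd[OF E.smult_cl[OF x0]]]
      by (simp add: assms(5) x0)
  qed
qed

context stable_seq_class
begin

text \<open>Stability in one variable, the map being wrapped as an operator on tuples of length
  1.\<close>

lemma linear_image:
  assumes "banach_space E" "banach_space F"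
    and cl: "\<And>v. v \<in> carrier E \<Longrightarrow> f v \<in> carrier F"
    and "\<And>v w. v \<in> carrier E \<Longrightarrow> w \<in> carrier E \<Longrightarrow> f (v \<oplus>\<^bsub>E\<^esub> w) = f v \<oplus>\<^bsub>F\<^esub> f w"
    and "\<And>a v. v \<in> carrier E \<Longrightarrow> f (a \<odot>\<^bsub>E\<^esub> v) = a \<odot>\<^bsub>F\<^esub> f v"
    and bound: "\<And>v. v \<in> carrier E \<Longrightarrow> nrm F (f v) \<le> C * nrm E v" and C: "0 \<le> C"
    and s: "s \<in> carrier (X E)"
  shows "(\<lambda>j. f (s j)) \<in> carrier (X F)" "nrm (X F) (\<lambda>j. f (s j)) \<le> C * nrm (X E) s"
proof -
  let ?A = "\<lambda>x\<in>tuples 1 (\<lambda>_. E). f (x 0)"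
  have "bounded_by 1 (\<lambda>_. E) F ?A C"
    unfolding bounded_by_def using bound by auto
  then have sum: "summing_by X X 1 (\<lambda>_. E) F ?A C"
    by (intro summing_by_stable linear_multilinear assms) simp_all
  have t: "const_tuple 1 s \<in> tuples 1 (\<lambda>_. X E)" using s by auto
  have "(\<lambda>m\<in>{..<1}. const_tuple 1 s m j) \<in> tuples 1 (\<lambda>_. E)" for j
    using coord_cl[OF assms(1) s] by auto
  then have eq: "(\<lambda>j. ?A (\<lambda>m\<in>{..<1}. const_tuple 1 s m j)) = (\<lambda>j. f (s j))"
    by simp
  show "(\<lambda>j. f (s j)) \<in> carrier (X F)"
    using summing_byD(1)[OF sum t] unfolding eq .
  show "nrm (X F) (\<lambda>j. f (s j)) \<le> C * nrm (X E) s"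
    using summing_byD(2)[OF sum t] unfolding eq by simp
qed

lemma single:
  assumes "banach_space E" and v: "v \<in> carrier E"
  shows "(\<lambda>j. if j = 0 then v else \<zero>\<^bsub>E\<^esub>) \<in> carrier (X E)"
    and "nrm (X E) (\<lambda>j. if j = 0 then v else \<zero>\<^bsub>E\<^esub>) \<le> nrm E v"
proof -
  interpret E: banach_space E by fact
  let ?f = "\<lambda>s. projl s \<odot>\<^bsub>E\<^esub> v"
  have eq: "(\<lambda>j. ?f (unit_seq 0 j)) = (\<lambda>j. if j = 0 then v else \<zero>\<^bsub>E\<^esub>)"
    using v by (auto simp: unit_seq_def E.smult_1 E.smult_0 fun_eq_iff)
  note * = linear_image[OF banach_scalar_space assms(1), of ?f "nrm E v" "unit_seq 0"]
  show "(\<lambda>j. if j = 0 then v else \<zero>\<^bsub>E\<^esub>) \<in> carrier (X E)"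
    using *(1) v unit_seq_cl E.nrm_nonneg[OF v]
    by (simp add: eq scalar_space_simps E.smult_cl E.smult_add_left E.smult_smult E.nrm_smult mult.commute)
  show "nrm (X E) (\<lambda>j. if j = 0 then v else \<zero>\<^bsub>E\<^esub>) \<le> nrm E v"
    using *(2) v unit_seq_cl E.nrm_nonneg[OF v]
    by (simp add: eq scalar_space_simps E.smult_cl E.smult_add_left E.smult_smult E.nrm_smult mult.commute nrm_unit_seq)
qed

end

text \<open>Each vector is placed in coordinate 0 of a sequence of no larger norm. Coordinate 0 of
  the image is then \<open>A x\<close>, and the norm of \<open>Y F\<close> dominates it.\<close>

lemma summing_imp_bounded_by:
  assumes X: "stable_seq_class X" and Y: "seq_class Y"
    and dom: "\<And>i. i < n \<Longrightarrow> banach_space (E i)" and F: "banach_space F" and C: "0 \<le> C"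
    and sum: "summing_by X Y n E F A C"
  shows "bounded_by n E F A C"
  unfolding bounded_by_def
proof
  interpret X: stable_seq_class X by fact
  interpret Y: seq_class Y by fact
  fix x assume x: "x \<in> tuples n E"
  let ?s = "\<lambda>m\<in>{..<n}. \<lambda>j. if j = (0::nat) then x m else \<zero>\<^bsub>E m\<^esub>"
  have xm: "x m \<in> carrier (E m)" if "m < n" for m using x that by auto
  have t: "?s \<in> tuples n (\<lambda>m. X (E m))"
    using X.single(1)[OF dom xm] by auto
  have "(\<lambda>m\<in>{..<n}. ?s m 0) = x" using x by (auto simp: fun_eq_iff PiE_def extensional_def)
  then have "nrm F (A x) = nrm F ((\<lambda>j. A (\<lambda>m\<in>{..<n}. ?s m j)) 0)" by simp
  also have "\<dots> \<le> nrm (Y F) (\<lambda>j. A (\<lambda>m\<in>{..<n}. ?s m j))"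
    by (rule Y.nrm_coord_le[OF F summing_byD(1)[OF sum t]])
  also have "\<dots> \<le> C * (\<Prod>m<n. nrm (X (E m)) (?s m))"
    by (rule summing_byD(2)[OF sum t])
  also have "\<dots> \<le> C * (\<Prod>m<n. nrm (E m) (x m))"
  proof (intro mult_left_mono prod_mono conjI C)
    fix m assume "m \<in> {..<n}"
    then have m: "m < n" by simp
    show "0 \<le> nrm (X (E m)) (?s m)"
      using t m banach_space.nrm_nonneg[OF X.banach[OF dom[OF m]]] by blast
    show "nrm (X (E m)) (?s m) \<le> nrm (E m) (x m)"
      using X.single(2)[OF dom[OF m] xm[OF m]] m by simp
  qed
  finally show "nrm F (A x) \<le> C * (\<Prod>m<n. nrm (E m) (x m))" .
qed

section \<open>Summing operators\<close>

text \<open>The operator whose diagonal is the composition of the diagonals: the slots are cut into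
  \<open>q\<close> consecutive blocks of length \<open>p\<close>. It need not be symmetric even if
  \<open>A\<close> and \<open>B\<close> are.\<close>

definition compose_op ::
    "nat \<Rightarrow> nat \<Rightarrow> ('k, 'a) normed_module \<Rightarrow> ((nat \<Rightarrow> 'a) \<Rightarrow> 'b) \<Rightarrow> ((nat \<Rightarrow> 'b) \<Rightarrow> 'c) \<Rightarrow> (nat \<Rightarrow> 'a) \<Rightarrow> 'c"
where
  "compose_op q p E A B = (\<lambda>x\<in>tuples (q * p) (\<lambda>_. E). B (\<lambda>i\<in>{..<q}. A (\<lambda>k\<in>{..<p}. x (i * p + k))))"

lemma index_less: "i < q \<Longrightarrow> k < p \<Longrightarrow> i * p + k < q * (p :: nat)"
proof -
  assume "i < q" "k < p"
  then have "i * p + k < Suc i * p" by simp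
  also have "\<dots> \<le> q * p" using \<open>i < q\<close> by (intro mult_right_mono) auto
  finally show ?thesis .
qed

lemma prod_lessThan_mult:
  fixes p q :: nat
  shows "(\<Prod>i<q. \<Prod>k<p. f (i * p + k)) = (\<Prod>l<q * p. f l :: 'c :: comm_monoid_mult)"
proof -
  have "(\<Prod>k<p. f (i * p + k)) = prod f {i * p..<i * p + p}" for i
    using prod.shift_bounds_nat_ivl[of f 0 "i * p" p] by (simp add: lessThan_atLeast0 add.commute)
  then show ?thesis by (simp add: prod.nat_group)
qed

lemma block_cl:
  assumes "x \<in> tuples (q * p) (\<lambda>_. E)" "i < q"
  shows "(\<lambda>k\<in>{..<p}. x (i * p + k)) \<in> tuples p (\<lambda>_. E)"
proof -
  have "x (i * p + k) \<in> carrier E" if "k < p" for k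
    using PiE_mem[OF assms(1), of "i * p + k"] index_less[OF assms(2) that] by simp
  then show ?thesis by auto
qed

text \<open>Division with remainder by \<open>p\<close> locates slot \<open>l\<close> in block
  \<open>i0\<close> at position \<open>k0\<close>. Changing it affects only slot \<open>i0\<close>
  of the argument of \<open>B\<close>, and that linearly through slot \<open>k0\<close> of
  \<open>A\<close>.\<close>

lemma compose_op_multilinear:
  assumes A: "multilinear_power p E F A" and B: "multilinear_power q F H B"
  shows "multilinear_power (q * p) E H (compose_op q p E A B)" (is "multilinear_power _ _ _ ?D")
proof -
  interpret A: multilinear_power p E F A by fact
  interpret B: multilinear_power q F H B by fact
  let ?in = "\<lambda>x i. \<lambda>k\<in>{..<p}. x (i * p + k)"
  let ?out = "\<lambda>x. \<lambda>i\<in>{..<q}. A (?in x i)"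
  have out_cl: "?out x \<in> tuples q (\<lambda>_. F)" if "x \<in> tuples (q * p) (\<lambda>_. E)" for x
    using A.op_cl[OF block_cl[OF that]] by auto
  have D: "?D x = B (?out x)" if "x \<in> tuples (q * p) (\<lambda>_. E)" for x
    unfolding compose_op_def by (rule restrict_apply'[OF that])
  have "?D \<in> multilinear (q * p) (\<lambda>_. E) H"
    unfolding multilinear_def
  proof (intro CollectI conjI ballI allI impI)
    show "?D \<in> tuples (q * p) (\<lambda>_. E) \<rightarrow>\<^sub>E carrier H"
    proof
      show "?D x \<in> carrier H" if "x \<in> tuples (q * p) (\<lambda>_. E)" for x
        unfolding D[OF that] by (rule B.op_cl[OF out_cl[OF that]])
    qed (auto simp: compose_op_def)
    fix x l assume x: "x \<in> tuples (q * p) (\<lambda>_. E)" and l: "l < q * p"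
    have p: "0 < p" using l by (cases p) auto
    define i0 k0 where "i0 = l div p" and "k0 = l mod p"
    have i0: "i0 < q" using l by (simp add: i0_def less_mult_imp_div_less)
    have k0: "k0 < p" using p by (simp add: k0_def)
    have l_eq: "l = i0 * p + k0" by (simp add: i0_def k0_def)
    have eq_iff: "i * p + k = l \<longleftrightarrow> i = i0 \<and> k = k0" if "k < p" for i k
      using that by (auto simp: i0_def k0_def)
    have xl: "x l \<in> carrier E" using x l by auto
    note in_cl = block_cl[OF x i0]
    have upd_cl: "x(l := v) \<in> tuples (q * p) (\<lambda>_. E)" if "v \<in> carrier E" for v
      using x l that by (auto simp: PiE_def extensional_def)
    have in_upd: "?in (x(l := v)) i = (if i = i0 then (?in x i0)(k0 := v) else ?in x i)" for v i
    proof
      fix k show "?in (x(l := v)) i k = (if i = i0 then (?in x i0)(k0 := v) else ?in x i) k"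
        using eq_iff[of k i] k0 by (cases "k < p") auto
    qed
    have out_upd: "?out (x(l := v)) = (?out x)(i0 := A ((?in x i0)(k0 := v)))" for v
      unfolding in_upd using i0 by (auto simp: fun_eq_iff)
    have in_same: "(?in x i0)(k0 := x l) = ?in x i0"
      using k0 by (auto simp: fun_eq_iff l_eq)
    have out_same: "(?out x)(i0 := A ((?in x i0)(k0 := x l))) = ?out x"
      unfolding in_same using i0 by (auto simp: fun_eq_iff)
    have A_cl: "A ((?in x i0)(k0 := v)) \<in> carrier F" if "v \<in> carrier E" for v
      by (rule A.op_cl[OF A.upd_cl[OF in_cl k0 that]])
    have D_upd: "?D (x(l := v)) = B ((?out x)(i0 := A ((?in x i0)(k0 := v))))" if "v \<in> carrier E" for v
      unfolding D[OF upd_cl[OF that]] out_upd ..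
    have D_same: "?D x = B ((?out x)(i0 := A ((?in x i0)(k0 := x l))))"
      unfolding D[OF x] out_same ..
    show "?D (x(l := x l \<oplus>\<^bsub>E\<^esub> y)) = ?D x \<oplus>\<^bsub>H\<^esub> ?D (x(l := y))" if y: "y \<in> carrier E" for y
      unfolding D_upd[OF A.dom.add_cl[OF xl y]] D_upd[OF y] D_same A.op_add[OF in_cl k0 xl y]
      by (rule B.op_add[OF out_cl[OF x] i0 A_cl[OF xl] A_cl[OF y]])
    show "?D (x(l := a \<odot>\<^bsub>E\<^esub> x l)) = a \<odot>\<^bsub>H\<^esub> ?D x" for a
      unfolding D_upd[OF A.dom.smult_cl[OF xl]] D_same A.op_smult[OF in_cl k0 xl]
      by (rule B.op_smult[OF out_cl[OF x] i0 A_cl[OF xl]])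
  qed
  then show ?thesis
    by (intro multilinear_powerI A.dom.banach_space_axioms B.cod)
qed

lemma compose_op_const:
  assumes "multilinear_power p E F A" "v \<in> carrier E"
  shows "compose_op q p E A B (const_tuple (q * p) v) = B (const_tuple q (A (const_tuple p v)))"
proof -
  have t: "const_tuple (q * p) v \<in> tuples (q * p) (\<lambda>_. E)" using assms(2) by auto
  have "(\<lambda>k\<in>{..<p}. const_tuple (q * p) v (i * p + k)) = const_tuple p v" if "i < q" for i
    using index_less[OF that] by (auto simp: fun_eq_iff)
  then show ?thesis
    unfolding compose_op_def restrict_apply'[OF t] by (intro arg_cong[of _ _ B]) auto
qed

text \<open>The outer constant enters once and the inner one once per block, hence
  \<open>C ^ q\<close>. Three classes make room for both uses: a factor acting within
  \<open>X\<close> before the summing operator, or within \<open>Y\<close> after it.\<close>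

lemma compose_op_summing_by:
  fixes X Y Z :: "('k :: {real_normed_field, banach}, 'u) seq_rule"
  assumes seq: "seq_class X" "seq_class Y" "seq_class Z"
    and ban: "banach_space E" "banach_space F" "banach_space H"
    and A: "summing_by X Y p (\<lambda>_. E) F A C" and B: "summing_by Y Z q (\<lambda>_. F) H B D" and D: "0 \<le> D"
  shows "summing_by X Z (q * p) (\<lambda>_. E) H (compose_op q p E A B) (D * C ^ q)"
  unfolding summing_by_def
proof
  interpret X: seq_class X by fact
  interpret Y: seq_class Y by fact
  interpret XE: banach_space "X E" by (rule X.banach[OF ban(1)])
  interpret YF: banach_space "Y F" by (rule Y.banach[OF ban(2)])
  fix x assume x: "x \<in> tuples (q * p) (\<lambda>_. X E)"
  let ?b = "\<lambda>i. \<lambda>k\<in>{..<p}. x (i * p + k)"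
  let ?y = "\<lambda>i\<in>{..<q}. \<lambda>j. A (\<lambda>k\<in>{..<p}. ?b i k j)"
  have b: "?b i \<in> tuples p (\<lambda>_. X E)" if "i < q" for i by (rule block_cl[OF x that])
  have y: "?y \<in> tuples q (\<lambda>_. Y F)"
    using summing_byD(1)[OF A b] by auto
  have eq: "(\<lambda>j. B (\<lambda>i\<in>{..<q}. ?y i j)) = (\<lambda>j. compose_op q p E A B (\<lambda>m\<in>{..<q * p}. x m j))"
  proof
    fix j
    have t: "(\<lambda>m\<in>{..<q * p}. x m j) \<in> tuples (q * p) (\<lambda>_. E)"
      using X.coord_cl[OF ban(1)] x by auto
    have "(\<lambda>k\<in>{..<p}. (\<lambda>m\<in>{..<q * p}. x m j) (i * p + k)) = (\<lambda>k\<in>{..<p}. ?b i k j)" if "i < q" for i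
      using index_less[OF that] by (auto simp: fun_eq_iff)
    then have "?y i j = A (\<lambda>k\<in>{..<p}. (\<lambda>m\<in>{..<q * p}. x m j) (i * p + k))" if "i \<in> {..<q}" for i
      unfolding restrict_apply'[OF that] using that by (simp only: lessThan_iff)
    then show "B (\<lambda>i\<in>{..<q}. ?y i j) = compose_op q p E A B (\<lambda>m\<in>{..<q * p}. x m j)"
      unfolding compose_op_def restrict_apply'[OF t] by (intro arg_cong[of _ _ B] restrict_ext)
  qed
  have "nrm (Z H) (\<lambda>j. B (\<lambda>i\<in>{..<q}. ?y i j)) \<le> D * (\<Prod>i<q. nrm (Y F) (?y i))"
    by (rule summing_byD(2)[OF B y])
  also have "\<dots> \<le> D * (\<Prod>i<q. C * (\<Prod>k<p. nrm (X E) (?b i k)))"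
  proof (intro mult_left_mono prod_mono conjI D)
    fix i assume i': "i \<in> {..<q}"
    then have i: "i < q" by simp
    show "0 \<le> nrm (Y F) (?y i)" by (rule YF.nrm_nonneg[OF PiE_mem[OF y i']])
    show "nrm (Y F) (?y i) \<le> C * (\<Prod>k<p. nrm (X E) (?b i k))"
      using summing_byD(2)[OF A b[OF i]] unfolding restrict_apply'[OF i'] .
  qed
  also have "\<dots> = D * C ^ q * (\<Prod>i<q. \<Prod>k<p. nrm (X E) (x (i * p + k)))"
    by (simp add: prod.distrib)
  also have "(\<Prod>i<q. \<Prod>k<p. nrm (X E) (x (i * p + k))) = (\<Prod>l<q * p. nrm (X E) (x l))"
    by (rule prod_lessThan_mult)
  finally have "nrm (Z H) (\<lambda>j. B (\<lambda>i\<in>{..<q}. ?y i j)) \<le> D * C ^ q * (\<Prod>l<q * p. nrm (X E) (x l))" .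
  then show "(\<lambda>j. compose_op q p E A B (\<lambda>m\<in>{..<q * p}. x m j)) \<in> carrier (Z H) \<and>
      nrm (Z H) (\<lambda>j. compose_op q p E A B (\<lambda>m\<in>{..<q * p}. x m j)) \<le> D * C ^ q * (\<Prod>m<q * p. nrm (X E) (x m))"
    using summing_byD(1)[OF B y] unfolding eq by blast
qed

section \<open>Symmetrization and polarization on sequences\<close>

lemma (in seq_class) restrict_coord_cl:
  assumes "banach_space E" "x \<in> tuples n (\<lambda>_. X E)"
  shows "(\<lambda>m\<in>{..<n}. x m j) \<in> tuples n (\<lambda>_. E)"
  using coord_cl[OF assms(1)] assms(2) by auto

text \<open>The average is formed in the normed space \<open>Y F\<close>, where the triangle
  inequality applies, and is identified coordinatewise. Every summand keeps the bound of the
  original because a product of norms is invariant under permutation of its factors.\<close>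

lemma symmetrize_summing_by:
  fixes X Y :: "('k :: {real_normed_field, banach}, 'u) seq_rule"
  assumes X: "seq_class X" and Y: "seq_class Y" and A: "multilinear_power n E F A"
    and sum: "summing_by X Y n (\<lambda>_. E) F A C"
  shows "summing_by X Y n (\<lambda>_. E) F (symmetrize n E F A) C"
  unfolding summing_by_def
proof
  interpret A: multilinear_power n E F A by fact
  interpret X: seq_class X by fact
  interpret Y: seq_class Y by fact
  interpret YF: banach_space "Y F" by (rule Y.banach[OF A.cod])
  fix x assume x: "x \<in> tuples n (\<lambda>_. X E)"
  let ?P = "{\<sigma>. \<sigma> permutes {..<n}}"
  let ?s = "\<lambda>\<sigma> j. A (\<lambda>m\<in>{..<n}. (x \<circ> \<sigma>) m j)"
  let ?c = "inverse (fact n) :: 'k"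
  have x\<sigma>: "x \<circ> \<sigma> \<in> tuples n (\<lambda>_. X E)" if "\<sigma> \<in> ?P" for \<sigma>
    using x that permutes_in_image[of \<sigma> "{..<n}"] by (auto simp: PiE_iff extensional_def)
  have s: "?s \<in> ?P \<rightarrow> carrier (Y F)"
    using summing_byD(1)[OF sum x\<sigma>] by blast
  let ?S = "?c \<odot>\<^bsub>Y F\<^esub> finsum (Y F) ?s ?P"
  have S: "?S \<in> carrier (Y F)" by (intro YF.smult_cl YF.finsum_closed s)
  have "?S = (\<lambda>j. symmetrize n E F A (\<lambda>m\<in>{..<n}. x m j))"
  proof -
    have "?S = (\<lambda>j. ?c \<odot>\<^bsub>F\<^esub> finsum F (\<lambda>\<sigma>. ?s \<sigma> j) ?P)"
      unfolding Y.smult_coord[OF A.cod YF.finsum_closed[OF s]]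
      unfolding Y.finsum_coord[OF A.cod A.finite_perms s] ..
    also have "\<dots> = (\<lambda>j. symmetrize n E F A (\<lambda>m\<in>{..<n}. x m j))"
    proof
      fix j
      note t = X.restrict_coord_cl[OF A.dom.banach_space_axioms x, of j]
      have "finsum F (\<lambda>\<sigma>. ?s \<sigma> j) ?P = finsum F (\<lambda>\<sigma>. A ((\<lambda>m\<in>{..<n}. x m j) \<circ> \<sigma>)) ?P"
      proof (rule A.cod.finsum_cong'[OF refl])
        show "(\<lambda>\<sigma>. A ((\<lambda>m\<in>{..<n}. x m j) \<circ> \<sigma>)) \<in> ?P \<rightarrow> carrier F"
          by (rule Pi_I, rule A.op_perm_cl[OF _ t]) simp
        fix \<sigma> assume "\<sigma> \<in> ?P"
        then have "(\<lambda>m\<in>{..<n}. (x \<circ> \<sigma>) m j) = (\<lambda>m\<in>{..<n}. x m j) \<circ> \<sigma>"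
          using permutes_in_image[of \<sigma> "{..<n}"] by (auto simp: fun_eq_iff)
        then show "?s \<sigma> j = A ((\<lambda>m\<in>{..<n}. x m j) \<circ> \<sigma>)" by (simp only:)
      qed
      then show "?c \<odot>\<^bsub>F\<^esub> finsum F (\<lambda>\<sigma>. ?s \<sigma> j) ?P = symmetrize n E F A (\<lambda>m\<in>{..<n}. x m j)"
        unfolding symmetrize_def restrict_apply'[OF t] by (simp only:)
    qed
    finally show ?thesis .
  qed
  moreover have "nrm (Y F) ?S \<le> C * (\<Prod>m<n. nrm (X E) (x m))"
  proof -
    have "nrm (Y F) (finsum (Y F) ?s ?P) \<le> (\<Sum>\<sigma>\<in>?P. nrm (Y F) (?s \<sigma>))"
      by (rule YF.nrm_finsum_le[OF A.finite_perms s])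
    also have "\<dots> \<le> (\<Sum>\<sigma>\<in>?P. C * (\<Prod>m<n. nrm (X E) (x m)))"
    proof (rule sum_mono)
      fix \<sigma> assume \<sigma>: "\<sigma> \<in> ?P"
      have "(\<Prod>m<n. nrm (X E) ((x \<circ> \<sigma>) m)) = (\<Prod>m<n. nrm (X E) (x m))"
        using prod.permute[of \<sigma> "{..<n}" "\<lambda>m. nrm (X E) (x m)"] \<sigma> by (simp add: o_def)
      then show "nrm (Y F) (?s \<sigma>) \<le> C * (\<Prod>m<n. nrm (X E) (x m))"
        using summing_byD(2)[OF sum x\<sigma>[OF \<sigma>]] by (simp only:)
    qed
    also have "\<dots> = fact n * (C * (\<Prod>m<n. nrm (X E) (x m)))"
      by (simp add: card_permutations[of _ n])
    finally have le: "nrm (Y F) (finsum (Y F) ?s ?P) \<le> fact n * (C * (\<Prod>m<n. nrm (X E) (x m)))" .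
    have c: "norm ?c = inverse (fact n)" by (simp add: norm_inverse)
    have "inverse (fact n) * nrm (Y F) (finsum (Y F) ?s ?P)
        \<le> inverse (fact n) * (fact n * (C * (\<Prod>m<n. nrm (X E) (x m))))"
      by (rule mult_left_mono[OF le]) simp
    also have "\<dots> = C * (\<Prod>m<n. nrm (X E) (x m))" by simp
    finally show ?thesis
      unfolding YF.nrm_smult[OF YF.finsum_closed[OF s]] c .
  qed
  ultimately show "(\<lambda>j. symmetrize n E F A (\<lambda>m\<in>{..<n}. x m j)) \<in> carrier (Y F) \<and>
      nrm (Y F) (\<lambda>j. symmetrize n E F A (\<lambda>m\<in>{..<n}. x m j)) \<le> C * (\<Prod>m<n. nrm (X E) (x m))"
    using S by (simp only:)
qed

lemma polynomial_summing_imp_operator_summing: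
  fixes X Y :: "('k :: {real_normed_field, banach}, 'u) seq_rule"
  assumes X: "seq_class X" and Y: "seq_class Y" and A: "symmetric_power n E F A"
    and sum: "\<And>x. x \<in> carrier (X E) \<Longrightarrow> (\<lambda>j. A (const_tuple n (x j))) \<in> carrier (Y F)"
    and x: "x \<in> tuples n (\<lambda>_. X E)"
  shows "(\<lambda>j. A (\<lambda>m\<in>{..<n}. x m j)) \<in> carrier (Y F)"
proof -
  interpret A: symmetric_power n E F A by fact
  interpret X: seq_class X by fact
  interpret Y: seq_class Y by fact
  interpret XE: banach_space "X E" by (rule X.banach[OF A.dom.banach_space_axioms])
  interpret YF: banach_space "Y F" by (rule Y.banach[OF A.cod])
  let ?S = "{..<n} \<rightarrow>\<^sub>E {1, -1 :: 'k}"
  let ?s = "\<lambda>\<epsilon>. finsum (X E) (\<lambda>i. \<epsilon> i \<odot>\<^bsub>X E\<^esub> x i) {..<n}"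
  \<comment> \<open>The polynomial along a signed sum of the given sequences, which is again an
    element of \<open>X E\<close>.\<close>
  let ?p = "\<lambda>\<epsilon> j. A (const_tuple n (?s \<epsilon> j))"
  have fin: "finite ?S" by (auto intro!: finite_PiE)
  have xi: "x i \<in> carrier (X E)" if "i < n" for i using x that by auto
  have ei: "(\<lambda>i. \<epsilon> i \<odot>\<^bsub>X E\<^esub> x i) \<in> {..<n} \<rightarrow> carrier (X E)" for \<epsilon>
    using xi by (auto intro: XE.smult_cl)
  have p: "?p \<epsilon> \<in> carrier (Y F)" for \<epsilon>
    by (rule sum[OF XE.finsum_closed[OF ei]])
  have pe: "(\<lambda>\<epsilon>. (\<Prod>i<n. \<epsilon> i) \<odot>\<^bsub>Y F\<^esub> ?p \<epsilon>) \<in> ?S \<rightarrow> carrier (Y F)"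
    by (intro Pi_I YF.smult_cl p)
  have "inverse (2 ^ n * fact n) \<odot>\<^bsub>Y F\<^esub> finsum (Y F) (\<lambda>\<epsilon>. (\<Prod>i<n. \<epsilon> i) \<odot>\<^bsub>Y F\<^esub> ?p \<epsilon>) ?S
      = (\<lambda>j. inverse (2 ^ n * fact n) \<odot>\<^bsub>F\<^esub> finsum F (\<lambda>\<epsilon>. (\<Prod>i<n. \<epsilon> i) \<odot>\<^bsub>F\<^esub> ?p \<epsilon> j) ?S)"
    unfolding Y.smult_coord[OF A.cod YF.finsum_closed[OF pe]]
    unfolding Y.finsum_coord[OF A.cod fin pe] unfolding Y.smult_coord[OF A.cod p] ..
  also have "\<dots> = (\<lambda>j. A (\<lambda>m\<in>{..<n}. x m j))"
  proof
    fix j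
    note t = X.restrict_coord_cl[OF A.dom.banach_space_axioms x, of j]
    have sj: "?s \<epsilon> j = finsum E (\<lambda>i. \<epsilon> i \<odot>\<^bsub>E\<^esub> (\<lambda>m\<in>{..<n}. x m j) i) {..<n}" for \<epsilon>
    proof -
      have "?s \<epsilon> j = finsum E (\<lambda>i. (\<epsilon> i \<odot>\<^bsub>X E\<^esub> x i) j) {..<n}"
        unfolding X.finsum_coord[OF A.dom.banach_space_axioms finite_lessThan ei] ..
      also have "\<dots> = finsum E (\<lambda>i. \<epsilon> i \<odot>\<^bsub>E\<^esub> (\<lambda>m\<in>{..<n}. x m j) i) {..<n}"
      proof (rule A.dom.finsum_cong'[OF refl])
        show "(\<lambda>i. \<epsilon> i \<odot>\<^bsub>E\<^esub> (\<lambda>m\<in>{..<n}. x m j) i) \<in> {..<n} \<rightarrow> carrier E"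
          by (intro Pi_I A.dom.smult_cl PiE_mem[OF t])
        fix i assume "i \<in> {..<n}"
        then show "(\<epsilon> i \<odot>\<^bsub>X E\<^esub> x i) j = \<epsilon> i \<odot>\<^bsub>E\<^esub> (\<lambda>m\<in>{..<n}. x m j) i"
          using X.smult_coord[OF A.dom.banach_space_axioms xi] by simp
      qed
      finally show ?thesis .
    qed
    show "inverse (2 ^ n * fact n) \<odot>\<^bsub>F\<^esub> finsum F (\<lambda>\<epsilon>. (\<Prod>i<n. \<epsilon> i) \<odot>\<^bsub>F\<^esub> ?p \<epsilon> j) ?S
        = A (\<lambda>m\<in>{..<n}. x m j)"
      unfolding sj by (rule A.op_eq_polar[OF t, symmetric])
  qed
  finally show ?thesis
    using YF.smult_cl[OF YF.finsum_closed[OF pe], of "inverse (2 ^ n * fact n)"] by (simp only:)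
qed

section \<open>Boundedness of the induced operator\<close>

lemma induced_multilinear:
  fixes X Y :: "('k :: {real_normed_field, banach}, 'u) seq_rule"
  assumes X: "seq_class X" and Y: "seq_class Y" and A: "multilinear_power n E F A"
    and mem: "\<And>x. x \<in> tuples n (\<lambda>_. X E) \<Longrightarrow> (\<lambda>j. A (\<lambda>m\<in>{..<n}. x m j)) \<in> carrier (Y F)"
  shows "multilinear_power n (X E) (Y F) (induced n (\<lambda>_. X E) A)" (is "multilinear_power _ _ _ ?T")
proof -
  interpret A: multilinear_power n E F A by fact
  interpret X: seq_class X by fact
  interpret Y: seq_class Y by fact
  note E = A.dom.banach_space_axioms
  interpret XE: banach_space "X E" by (rule X.banach[OF E])
  have "?T \<in> multilinear n (\<lambda>_. X E) (Y F)"
    unfolding multilinear_def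
  proof (intro CollectI conjI ballI allI impI)
    show "?T \<in> tuples n (\<lambda>_. X E) \<rightarrow>\<^sub>E carrier (Y F)"
      unfolding induced_def by (rule restrict_PiE_iff[THEN iffD2]) (blast intro: mem)
    fix x i assume x: "x \<in> tuples n (\<lambda>_. X E)" and i: "i < n"
    have xi: "x i \<in> carrier (X E)" using x i by auto
    have T: "?T z = (\<lambda>j. A (\<lambda>m\<in>{..<n}. z m j))" if "z \<in> tuples n (\<lambda>_. X E)" for z
      unfolding induced_def by (rule restrict_apply'[OF that])
    have upd_cl: "x(i := v) \<in> tuples n (\<lambda>_. X E)" if "v \<in> carrier (X E)" for v
      using x i that by (auto simp: PiE_def extensional_def)
    have upd: "(\<lambda>m\<in>{..<n}. (x(i := v)) m j) = (\<lambda>m\<in>{..<n}. x m j)(i := v j)" for v j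
      using i by (auto simp: fun_eq_iff)
    have same: "(\<lambda>m\<in>{..<n}. x m j)(i := x i j) = (\<lambda>m\<in>{..<n}. x m j)" for j
      using i by (auto simp: fun_eq_iff)
    note t = X.restrict_coord_cl[OF A.dom.banach_space_axioms x]
    show "?T (x(i := x i \<oplus>\<^bsub>X E\<^esub> y)) = ?T x \<oplus>\<^bsub>Y F\<^esub> ?T (x(i := y))" if y: "y \<in> carrier (X E)" for y
      unfolding T[OF x] T[OF upd_cl[OF y]] T[OF upd_cl[OF XE.add_cl[OF xi y]]]
      unfolding Y.add_coord[OF A.cod mem[OF x] mem[OF upd_cl[OF y]]]
      unfolding upd X.add_coord[OF E xi y]
        A.op_add[OF t i X.coord_cl[OF E xi] X.coord_cl[OF E y]] same ..
    show "?T (x(i := a \<odot>\<^bsub>X E\<^esub> x i)) = a \<odot>\<^bsub>Y F\<^esub> ?T x" for a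
      unfolding T[OF x] T[OF upd_cl[OF XE.smult_cl[OF xi]]]
      unfolding Y.smult_coord[OF A.cod mem[OF x]]
      unfolding upd X.smult_coord[OF E xi]
        A.op_smult[OF t i X.coord_cl[OF E xi]] same ..
  qed
  then show ?thesis by (intro multilinear_powerI X.banach[OF E] Y.banach[OF A.cod])
qed

text \<open>
  The graph of the induced operator is closed in each variable because convergence in \<open>X E\<close> and in
  \<open>Y F\<close> implies coordinatewise convergence.
\<close>

lemma induced_bounded_by:
  fixes X Y :: "('k :: {real_normed_field, banach}, 'u) seq_rule"
  assumes X: "seq_class X" and Y: "seq_class Y" and A: "multilinear_power n E F A"
    and bound: "bounded_by n (\<lambda>_. E) F A C" and C: "0 \<le> C"
    and mem: "\<And>x. x \<in> tuples n (\<lambda>_. X E) \<Longrightarrow> (\<lambda>j. A (\<lambda>m\<in>{..<n}. x m j)) \<in> carrier (Y F)"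
  obtains D where "0 \<le> D" "bounded_by n (\<lambda>_. X E) (Y F) (induced n (\<lambda>_. X E) A) D"
proof -
  let ?T = "induced n (\<lambda>_. X E) A"
  interpret A: multilinear_power n E F A by fact
  interpret X: seq_class X by fact
  interpret Y: seq_class Y by fact
  note E = A.dom.banach_space_axioms
  interpret T: multilinear_power n "X E" "Y F" ?T by (rule induced_multilinear[OF X Y A mem])
  show ?thesis
  proof (rule T.closed_graph_bounded_by)
    fix x i u w
    assume x: "x \<in> tuples n (\<lambda>_. X E)" and i: "i < n" and u: "\<And>k. u k \<in> carrier (X E)"
      and u0: "(\<lambda>k. nrm (X E) (u k)) \<longlonglongrightarrow> 0" and w: "w \<in> carrier (Y F)"
      and lim: "(\<lambda>k. nrm (Y F) (?T (x(i := u k)) \<ominus>\<^bsub>Y F\<^esub> w)) \<longlonglongrightarrow> 0"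
    have upd_cl: "x(i := u k) \<in> tuples n (\<lambda>_. X E)" for k by (rule T.upd_cl[OF x i u])
    have Tj: "?T (x(i := u k)) j = A ((\<lambda>m\<in>{..<n}. x m j)(i := u k j))" for k j
    proof -
      have "(\<lambda>m\<in>{..<n}. (x(i := u k)) m j) = (\<lambda>m\<in>{..<n}. x m j)(i := u k j)"
        using i by (auto simp: fun_eq_iff)
      then show ?thesis unfolding induced_def restrict_apply'[OF upd_cl] by (simp only:)
    qed
    have "w j = \<zero>\<^bsub>F\<^esub>" for j
    proof -
      note t = X.restrict_coord_cl[OF A.dom.banach_space_axioms x, of j]
      note uj = X.coord_cl[OF E u, of _ j]
      note tu = A.upd_cl[OF t i uj]
      \<comment> \<open>With the other slots frozen, the operator in coordinate \<open>j\<close> is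
        linear in slot \<open>i\<close> with bound \<open>C * ?M\<close>. Its values therefore tend
        to 0, and uniqueness of limits forces \<open>w j\<close> to be 0.\<close>
      let ?M = "\<Prod>m\<in>{..<n} - {i}. nrm E (x m j)"
      have M: "0 \<le> ?M"
        using x by (intro prod_nonneg) (auto intro!: A.dom.nrm_nonneg X.coord_cl[OF E])
      have le: "nrm F (A ((\<lambda>m\<in>{..<n}. x m j)(i := u k j))) \<le> C * ?M * nrm (X E) (u k)" for k
      proof -
        have "nrm F (A ((\<lambda>m\<in>{..<n}. x m j)(i := u k j)))
            \<le> C * (\<Prod>m<n. nrm E (((\<lambda>m\<in>{..<n}. x m j)(i := u k j)) m))"
          by (rule bound[unfolded bounded_by_def, rule_format, OF tu])
        also have "(\<Prod>m<n. nrm E (((\<lambda>m\<in>{..<n}. x m j)(i := u k j)) m)) = nrm E (u k j) * ?M"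
          using i by (subst prod.remove[of _ i]) auto
        also have "C * (nrm E (u k j) * ?M) \<le> C * (nrm (X E) (u k) * ?M)"
          by (intro mult_left_mono mult_right_mono X.nrm_coord_le[OF E u] M C)
        also have "\<dots> = C * ?M * nrm (X E) (u k)" by simp
        finally show ?thesis .
      qed
      have "(\<lambda>k. nrm F (A ((\<lambda>m\<in>{..<n}. x m j)(i := u k j)))) \<longlonglongrightarrow> 0"
      proof (rule tendsto_sandwich[OF _ _ tendsto_const])
        show "(\<lambda>k. C * ?M * nrm (X E) (u k)) \<longlonglongrightarrow> 0"
          by (rule tendsto_mult_right_zero[OF u0])
        show "\<forall>\<^sub>F k in sequentially. 0 \<le> nrm F (A ((\<lambda>m\<in>{..<n}. x m j)(i := u k j)))"
          using A.cod.nrm_nonneg[OF A.op_cl[OF tu]] by (intro always_eventually allI)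
        show "\<forall>\<^sub>F k in sequentially. nrm F (A ((\<lambda>m\<in>{..<n}. x m j)(i := u k j))) \<le> C * ?M * nrm (X E) (u k)"
          using le by (intro always_eventually allI)
      qed
      then have "(\<lambda>k. nrm F (?T (x(i := u k)) j \<ominus>\<^bsub>F\<^esub> \<zero>\<^bsub>F\<^esub>)) \<longlonglongrightarrow> 0"
        unfolding Tj A.cod.diff_zero[OF A.op_cl[OF tu]] .
      moreover have "(\<lambda>k. nrm F (?T (x(i := u k)) j \<ominus>\<^bsub>F\<^esub> w j)) \<longlonglongrightarrow> 0"
        by (rule Y.tendsto_coord[OF A.cod T.op_cl[OF upd_cl] w lim])
      ultimately show ?thesis
        by (intro A.cod.tendsto_unique[OF Y.coord_cl[OF A.cod T.op_cl[OF upd_cl]] Y.coord_cl[OF A.cod w] A.cod.zero_cl])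
    qed
    then show "w = \<zero>\<^bsub>Y F\<^esub>" unfolding Y.zero_coord[OF A.cod] by (rule ext)
  qed (rule that)
qed

lemma summing_by_iff_induced:
  assumes "\<And>x. x \<in> tuples n (\<lambda>_. X E) \<Longrightarrow> (\<lambda>j. A (\<lambda>m\<in>{..<n}. x m j)) \<in> carrier (Y F)"
  shows "summing_by X Y n (\<lambda>_. E) F A C \<longleftrightarrow> bounded_by n (\<lambda>_. X E) (Y F) (induced n (\<lambda>_. X E) A) C"
  using assms by (simp add: summing_by_def bounded_by_def induced_def)

section \<open>The components of the ideal\<close>

text \<open>Sums of polynomials are traced at the level of symmetric operators, because that is
  where their norm is computed.\<close>

definition add_op ::
    "nat \<Rightarrow> ('k, 'a) normed_module \<Rightarrow> ('k, 'b) normed_module \<Rightarrow> ((nat \<Rightarrow> 'a) \<Rightarrow> 'b) \<Rightarrow> ((nat \<Rightarrow> 'a) \<Rightarrow> 'b)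
      \<Rightarrow> (nat \<Rightarrow> 'a) \<Rightarrow> 'b"
where "add_op n E F A B = (\<lambda>x\<in>tuples n (\<lambda>_. E). A x \<oplus>\<^bsub>F\<^esub> B x)"

definition smult_op ::
    "nat \<Rightarrow> ('k, 'a) normed_module \<Rightarrow> ('k, 'b) normed_module \<Rightarrow> 'k \<Rightarrow> ((nat \<Rightarrow> 'a) \<Rightarrow> 'b) \<Rightarrow> (nat \<Rightarrow> 'a) \<Rightarrow> 'b"
where "smult_op n E F a A = (\<lambda>x\<in>tuples n (\<lambda>_. E). a \<odot>\<^bsub>F\<^esub> A x)"

definition zero_op ::
    "nat \<Rightarrow> ('k, 'a) normed_module \<Rightarrow> ('k, 'b) normed_module \<Rightarrow> (nat \<Rightarrow> 'a) \<Rightarrow> 'b"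
where "zero_op n E F = (\<lambda>x\<in>tuples n (\<lambda>_. E). \<zero>\<^bsub>F\<^esub>)"

lemma symmetric_powerI:
  assumes "banach_space E" "banach_space F"
    and cl: "\<And>x. x \<in> tuples n (\<lambda>_. E) \<Longrightarrow> A x \<in> carrier F"
    and ext: "A \<in> extensional (tuples n (\<lambda>_. E))"
    and add: "\<And>x i y. x \<in> tuples n (\<lambda>_. E) \<Longrightarrow> i < n \<Longrightarrow> y \<in> carrier E \<Longrightarrow>
      A (x(i := x i \<oplus>\<^bsub>E\<^esub> y)) = A x \<oplus>\<^bsub>F\<^esub> A (x(i := y))"
    and smult: "\<And>x i a. x \<in> tuples n (\<lambda>_. E) \<Longrightarrow> i < n \<Longrightarrow> A (x(i := a \<odot>\<^bsub>E\<^esub> x i)) = a \<odot>\<^bsub>F\<^esub> A x"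
    and perm: "\<And>x \<sigma>. \<sigma> permutes {..<n} \<Longrightarrow> x \<in> tuples n (\<lambda>_. E) \<Longrightarrow> A (x \<circ> \<sigma>) = A x"
  shows "symmetric_power n E F A"
proof (intro symmetric_power.intro symmetric_power_axioms.intro multilinear_powerI assms(1,2))
  show "A \<in> multilinear n (\<lambda>_. E) F"
    unfolding multilinear_def
  proof (intro CollectI conjI ballI allI impI)
    show "A \<in> tuples n (\<lambda>_. E) \<rightarrow>\<^sub>E carrier F"
      by (rule PiE_I) (use cl ext in \<open>auto simp: extensional_def\<close>)
  qed (rule add smult; assumption)+
  show "symmetric_operator n E A"
    unfolding symmetric_operator_def using perm by blast
qed

lemma symmetric_power_add_op:
  assumes "symmetric_power n E F A" "symmetric_power n E F B"
  shows "symmetric_power n E F (add_op n E F A B)"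
proof -
  interpret A: symmetric_power n E F A by fact
  interpret B: symmetric_power n E F B by fact
  have eq: "add_op n E F A B x = A x \<oplus>\<^bsub>F\<^esub> B x" if "x \<in> tuples n (\<lambda>_. E)" for x
    unfolding add_op_def by (rule restrict_apply'[OF that])
  show ?thesis
  proof (rule symmetric_powerI[OF A.dom.banach_space_axioms A.cod])
    show "add_op n E F A B \<in> extensional (tuples n (\<lambda>_. E))" by (simp add: add_op_def)
    fix x assume x: "x \<in> tuples n (\<lambda>_. E)"
    note Ax = A.op_cl[OF x] and Bx = B.op_cl[OF x]
    show "add_op n E F A B x \<in> carrier F" unfolding eq[OF x] by (rule A.cod.add_cl[OF Ax Bx])
    show "add_op n E F A B (x \<circ> \<sigma>) = add_op n E F A B x" if "\<sigma> permutes {..<n}" for \<sigma>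
      unfolding eq[OF x] eq[OF A.perm_cl[OF that x]] A.op_perm[OF that x] B.op_perm[OF that x] ..
    fix i assume i: "i < n"
    have xi: "x i \<in> carrier E" by (rule A.entry_cl[OF x i])
    have same: "x(i := x i) = x" by simp
    show "add_op n E F A B (x(i := a \<odot>\<^bsub>E\<^esub> x i)) = a \<odot>\<^bsub>F\<^esub> add_op n E F A B x" for a
      unfolding eq[OF x] eq[OF A.upd_cl[OF x i A.dom.smult_cl[OF xi]]]
        A.op_smult[OF x i xi] B.op_smult[OF x i xi] same A.cod.smult_add_right[OF Ax Bx] ..
    fix y assume y: "y \<in> carrier E"
    note Ay = A.op_cl[OF A.upd_cl[OF x i y]] and By = B.op_cl[OF A.upd_cl[OF x i y]]
    show "add_op n E F A B (x(i := x i \<oplus>\<^bsub>E\<^esub> y)) = add_op n E F A B x \<oplus>\<^bsub>F\<^esub> add_op n E F A B (x(i := y))"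
      unfolding eq[OF x] eq[OF A.upd_cl[OF x i y]] eq[OF A.upd_cl[OF x i A.dom.add_cl[OF xi y]]]
        A.op_add[OF x i xi y] B.op_add[OF x i xi y] same
      using Ax Bx Ay By by (simp add: A.cod.M.a_ac)
  qed
qed

lemma symmetric_power_smult_op:
  assumes "symmetric_power n E F A"
  shows "symmetric_power n E F (smult_op n E F c A)"
proof -
  interpret A: symmetric_power n E F A by fact
  have eq: "smult_op n E F c A x = c \<odot>\<^bsub>F\<^esub> A x" if "x \<in> tuples n (\<lambda>_. E)" for x
    unfolding smult_op_def by (rule restrict_apply'[OF that])
  show ?thesis
  proof (rule symmetric_powerI[OF A.dom.banach_space_axioms A.cod])
    show "smult_op n E F c A \<in> extensional (tuples n (\<lambda>_. E))" by (simp add: smult_op_def)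
    fix x assume x: "x \<in> tuples n (\<lambda>_. E)"
    note Ax = A.op_cl[OF x]
    show "smult_op n E F c A x \<in> carrier F" unfolding eq[OF x] by (rule A.cod.smult_cl[OF Ax])
    show "smult_op n E F c A (x \<circ> \<sigma>) = smult_op n E F c A x" if "\<sigma> permutes {..<n}" for \<sigma>
      unfolding eq[OF x] eq[OF A.perm_cl[OF that x]] A.op_perm[OF that x] ..
    fix i assume i: "i < n"
    have xi: "x i \<in> carrier E" by (rule A.entry_cl[OF x i])
    have same: "x(i := x i) = x" by simp
    show "smult_op n E F c A (x(i := a \<odot>\<^bsub>E\<^esub> x i)) = a \<odot>\<^bsub>F\<^esub> smult_op n E F c A x" for a
      unfolding eq[OF x] eq[OF A.upd_cl[OF x i A.dom.smult_cl[OF xi]]]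
        A.op_smult[OF x i xi] same A.cod.smult_smult[OF Ax] by (simp only: mult.commute)
    fix y assume y: "y \<in> carrier E"
    show "smult_op n E F c A (x(i := x i \<oplus>\<^bsub>E\<^esub> y)) = smult_op n E F c A x \<oplus>\<^bsub>F\<^esub> smult_op n E F c A (x(i := y))"
      unfolding eq[OF x] eq[OF A.upd_cl[OF x i y]] eq[OF A.upd_cl[OF x i A.dom.add_cl[OF xi y]]]
        A.op_add[OF x i xi y] same by (rule A.cod.smult_add_right[OF Ax A.op_cl[OF A.upd_cl[OF x i y]]])
  qed
qed

lemma symmetric_power_zero_op:
  assumes E: "banach_space E" and F: "banach_space F"
  shows "symmetric_power n E F (zero_op n E F)"
proof -
  interpret E: banach_space E by fact
  interpret F: banach_space F by fact
  have eq: "zero_op n E F x = \<zero>\<^bsub>F\<^esub>" if "x \<in> tuples n (\<lambda>_. E)" for x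
    unfolding zero_op_def by (rule restrict_apply'[OF that])
  have upd_cl: "x(i := v) \<in> tuples n (\<lambda>_. E)" if "x \<in> tuples n (\<lambda>_. E)" "i < n" "v \<in> carrier E" for x i v
    using that by (auto simp: PiE_def extensional_def)
  show ?thesis
  proof (rule symmetric_powerI[OF E F])
    show "zero_op n E F \<in> extensional (tuples n (\<lambda>_. E))" by (simp add: zero_op_def)
    fix x assume x: "x \<in> tuples n (\<lambda>_. E)"
    show "zero_op n E F x \<in> carrier F" unfolding eq[OF x] by (rule F.zero_cl)
    show "zero_op n E F (x \<circ> \<sigma>) = zero_op n E F x" if "\<sigma> permutes {..<n}" for \<sigma>
    proof -
      have "x \<circ> \<sigma> \<in> tuples n (\<lambda>_. E)"
        using x permutes_in_image[OF that] by (auto simp: PiE_iff extensional_def)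
      then show ?thesis by (simp only: eq x)
    qed
    fix i assume i: "i < n"
    have xi: "x i \<in> carrier E" using x i by auto
    show "zero_op n E F (x(i := a \<odot>\<^bsub>E\<^esub> x i)) = a \<odot>\<^bsub>F\<^esub> zero_op n E F x" for a
      unfolding eq[OF x] eq[OF upd_cl[OF x i E.smult_cl[OF xi]]] F.smult_zero ..
    fix y assume y: "y \<in> carrier E"
    show "zero_op n E F (x(i := x i \<oplus>\<^bsub>E\<^esub> y)) = zero_op n E F x \<oplus>\<^bsub>F\<^esub> zero_op n E F (x(i := y))"
      unfolding eq[OF x] eq[OF upd_cl[OF x i y]] eq[OF upd_cl[OF x i E.add_cl[OF xi y]]] by simp
  qed
qed

context
  fixes X Y :: "('k :: {real_normed_field, banach}, 'u) seq_rule" and n :: nat and E F :: "('k, 'u) bspace"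
  assumes X: "seq_class X" and Y: "seq_class Y" and E: "banach_space E" and F: "banach_space F"
begin

interpretation X: seq_class X by (rule X)
interpretation Y: seq_class Y by (rule Y)
interpretation XE: banach_space "X E" by (rule X.banach[OF E])
interpretation YF: banach_space "Y F" by (rule Y.banach[OF F])
interpretation F: banach_space F by (rule F)

lemma add_op_seq:
  assumes "summing_by X Y n (\<lambda>_. E) F A C" "summing_by X Y n (\<lambda>_. E) F B D" "x \<in> tuples n (\<lambda>_. X E)"
  shows "(\<lambda>j. add_op n E F A B (\<lambda>m\<in>{..<n}. x m j))
    = (\<lambda>j. A (\<lambda>m\<in>{..<n}. x m j)) \<oplus>\<^bsub>Y F\<^esub> (\<lambda>j. B (\<lambda>m\<in>{..<n}. x m j))"
  unfolding Y.add_coord[OF F summing_byD(1)[OF assms(1,3)] summing_byD(1)[OF assms(2,3)]]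
    add_op_def restrict_apply'[OF X.restrict_coord_cl[OF E assms(3)]] ..

lemma smult_op_seq:
  assumes "summing_by X Y n (\<lambda>_. E) F A C" "x \<in> tuples n (\<lambda>_. X E)"
  shows "(\<lambda>j. smult_op n E F a A (\<lambda>m\<in>{..<n}. x m j)) = a \<odot>\<^bsub>Y F\<^esub> (\<lambda>j. A (\<lambda>m\<in>{..<n}. x m j))"
  unfolding Y.smult_coord[OF F summing_byD(1)[OF assms]]
    smult_op_def restrict_apply'[OF X.restrict_coord_cl[OF E assms(2)]] ..

lemma summing_by_add_op:
  assumes A: "summing_by X Y n (\<lambda>_. E) F A C" and B: "summing_by X Y n (\<lambda>_. E) F B D"
  shows "summing_by X Y n (\<lambda>_. E) F (add_op n E F A B) (C + D)"
  unfolding summing_by_def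
proof
  fix x assume x: "x \<in> tuples n (\<lambda>_. X E)"
  note a = summing_byD[OF A x] and b = summing_byD[OF B x]
  show "(\<lambda>j. add_op n E F A B (\<lambda>m\<in>{..<n}. x m j)) \<in> carrier (Y F) \<and>
      nrm (Y F) (\<lambda>j. add_op n E F A B (\<lambda>m\<in>{..<n}. x m j)) \<le> (C + D) * (\<Prod>m<n. nrm (X E) (x m))"
    unfolding add_op_seq[OF A B x]
  proof (intro conjI YF.add_cl[OF a(1) b(1)])
    show "nrm (Y F) ((\<lambda>j. A (\<lambda>m\<in>{..<n}. x m j)) \<oplus>\<^bsub>Y F\<^esub> (\<lambda>j. B (\<lambda>m\<in>{..<n}. x m j)))
        \<le> (C + D) * (\<Prod>m<n. nrm (X E) (x m))"
      unfolding distrib_right by (rule order_trans[OF YF.nrm_triangle[OF a(1) b(1)] add_mono[OF a(2) b(2)]])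
  qed
qed

lemma summing_by_smult_op:
  assumes A: "summing_by X Y n (\<lambda>_. E) F A C"
  shows "summing_by X Y n (\<lambda>_. E) F (smult_op n E F a A) (norm a * C)"
  unfolding summing_by_def
proof
  fix x assume x: "x \<in> tuples n (\<lambda>_. X E)"
  note s = summing_byD[OF A x]
  show "(\<lambda>j. smult_op n E F a A (\<lambda>m\<in>{..<n}. x m j)) \<in> carrier (Y F) \<and>
      nrm (Y F) (\<lambda>j. smult_op n E F a A (\<lambda>m\<in>{..<n}. x m j)) \<le> norm a * C * (\<Prod>m<n. nrm (X E) (x m))"
    unfolding smult_op_seq[OF A x] YF.nrm_smult[OF s(1)]
    using YF.smult_cl[OF s(1)] mult_left_mono[OF s(2) norm_ge_zero[of a]] by (simp only: mult.assoc)
qed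

lemma summing_by_zero_op: "summing_by X Y n (\<lambda>_. E) F (zero_op n E F) 0"
  unfolding summing_by_def
proof
  fix x assume x: "x \<in> tuples n (\<lambda>_. X E)"
  have "(\<lambda>j. zero_op n E F (\<lambda>m\<in>{..<n}. x m j)) = \<zero>\<^bsub>Y F\<^esub>"
    unfolding zero_op_def restrict_apply'[OF X.restrict_coord_cl[OF E x]] Y.zero_coord[OF F] ..
  then show "(\<lambda>j. zero_op n E F (\<lambda>m\<in>{..<n}. x m j)) \<in> carrier (Y F) \<and>
      nrm (Y F) (\<lambda>j. zero_op n E F (\<lambda>m\<in>{..<n}. x m j)) \<le> 0 * (\<Prod>m<n. nrm (X E) (x m))"
    using YF.zero_cl YF.nrm_zero by simp
qed

text \<open>Once some constant is known, the norm is the least nonnegative one: it is admissible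
  itself, and every other lies above it.\<close>

lemma summing_operator_norm_bounds:
  assumes A: "multilinear_power n E F A" and sum: "summing_by X Y n (\<lambda>_. E) F A C" and C: "0 \<le> C"
  shows "0 \<le> summing_operator_norm X Y n E F A" "summing_operator_norm X Y n E F A \<le> C"
    "summing_by X Y n (\<lambda>_. E) F A (summing_operator_norm X Y n E F A)"
proof -
  interpret T: multilinear_power n "X E" "Y F" "induced n (\<lambda>_. X E) A"
    by (rule induced_multilinear[OF X Y A summing_byD(1)[OF sum]])
  have iff: "summing_by X Y n (\<lambda>_. E) F A D \<longleftrightarrow> bounded_by n (\<lambda>_. X E) (Y F) (induced n (\<lambda>_. X E) A) D" for D
    by (rule summing_by_iff_induced) (rule summing_byD(1)[OF sum])
  note bounds = T.multilinear_norm_nonneg_bound[OF iffD1[OF iff sum] C]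
  show "0 \<le> summing_operator_norm X Y n E F A" "summing_operator_norm X Y n E F A \<le> C"
    unfolding summing_operator_norm_def by (fact bounds)+
  show "summing_by X Y n (\<lambda>_. E) F A (summing_operator_norm X Y n E F A)"
    unfolding iff summing_operator_norm_def by (fact bounds)
qed

end

lemma component_simps:
  "carrier (component Q q n E F) = carrier (poly_space n E F) \<inter> Q E F"
  "\<zero>\<^bsub>component Q q n E F\<^esub> = (\<lambda>x\<in>carrier E. \<zero>\<^bsub>F\<^esub>)"
  "P \<oplus>\<^bsub>component Q q n E F\<^esub> P' = (\<lambda>x\<in>carrier E. P x \<oplus>\<^bsub>F\<^esub> P' x)"
  "a \<odot>\<^bsub>component Q q n E F\<^esub> P = (\<lambda>x\<in>carrier E. a \<odot>\<^bsub>F\<^esub> P x)"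
  "nrm (component Q q n E F) = q E F"
  by (simp_all add: component_def poly_space_def)

section \<open>Each component is a Banach space\<close>

locale summing_ideal =
  X: stable_seq_class X + Y: stable_seq_class Y
  for X Y :: "('k :: {real_normed_field, banach}, 'u) seq_rule" +
  assumes power_embedded: "\<And>n. n \<ge> 1 \<Longrightarrow> power_embedded n X Y"
begin

abbreviation comp :: "nat \<Rightarrow> ('k, 'u) bspace \<Rightarrow> ('k, 'u) bspace \<Rightarrow> ('k, 'k + 'u \<Rightarrow> 'k + 'u) normed_module" where
  "comp n E F \<equiv> component (summing_polys X Y) (summing_poly_norm X Y) n E F"

context
  fixes n :: nat and E F :: "('k, 'u) bspace"
  assumes n: "1 \<le> n" and E: "banach_space E" and F: "banach_space F"
begin

interpretation XE: banach_space "X E" by (rule X.banach[OF E])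
interpretation YF: banach_space "Y F" by (rule Y.banach[OF F])
interpretation E: banach_space E by (rule E)
interpretation F: banach_space F by (rule F)

lemmas seq = X.seq_class_axioms Y.seq_class_axioms

lemma component_mem:
  "P \<in> carrier (comp n E F) \<longleftrightarrow>
    P \<in> carrier (poly_space n E F) \<and> (\<forall>x\<in>carrier (X E). (\<lambda>j. P (x j)) \<in> carrier (Y F))"
  using n by (auto simp: component_simps summing_polys_def homogeneous_polys_def)

text \<open>The norm is computed in the least degree of \<open>P\<close>. If that differs from
  \<open>n\<close>, then \<open>P\<close> is zero, its symmetric operator is the zero operator in
  every degree, and both sides vanish.\<close>

lemma summing_poly_norm_eq:
  assumes P: "P \<in> carrier (poly_space n E F)"
  shows "summing_poly_norm X Y E F P = summing_operator_norm X Y n E F (symmetric_of n E F P)"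
proof -
  let ?d = "poly_degree E F P"
  have d: "P \<in> carrier (poly_space ?d E F)"
    unfolding poly_degree_def by (rule LeastI2[of _ n]) (use P n in auto)
  show ?thesis
  proof (cases "?d = n")
    case True
    then show ?thesis by (simp add: summing_poly_norm_def)
  next
    case False
    then have zero: "P = (\<lambda>v\<in>carrier E. \<zero>\<^bsub>F\<^esub>)"
      by (rule poly_degree_unique[OF E F d P])
    have "summing_operator_norm X Y m E F (symmetric_of m E F P) = 0" for m
    proof -
      note sp = symmetric_power_zero_op[OF E F, of m]
      have "zero_op m E F (const_tuple m v) = P v" if "v \<in> carrier E" for v
      proof -
        have "const_tuple m v \<in> tuples m (\<lambda>_. E)" using that by auto
        then show ?thesis unfolding zero zero_op_def by (simp only: restrict_apply' that)
      qed
      then have "symmetric_of m E F P = zero_op m E F"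
        by (rule symmetric_of_eqI[OF sp])
      then show ?thesis
        using summing_operator_norm_bounds(1,2)[OF seq E F symmetric_power.axioms(1)[OF sp] summing_by_zero_op[OF seq E F]]
        by simp
    qed
    then show ?thesis by (simp add: summing_poly_norm_def)
  qed
qed

text \<open>The summing constant also bounds the operator itself, which makes the diagonal
  continuous; uniqueness then identifies \<open>A\<close> as the symmetric operator of
  \<open>P\<close>.\<close>

lemma componentI:
  assumes A: "symmetric_power n E F A" and sum: "summing_by X Y n (\<lambda>_. E) F A C" and C: "0 \<le> C"
    and P: "P = (\<lambda>v\<in>carrier E. A (const_tuple n v))"
  shows "P \<in> carrier (comp n E F)" "symmetric_of n E F P = A" "summing_poly_norm X Y E F P \<le> C"
proof -
  interpret A: symmetric_power n E F A by fact
  have bound: "bounded_by n (\<lambda>_. E) F A C"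
    by (rule summing_imp_bounded_by[OF X.stable_seq_class_axioms seq(2) E F C sum])
  have P_cl: "P \<in> carrier (poly_space n E F)" unfolding P by (rule A.poly_spaceI[OF bound C])
  show sym: "symmetric_of n E F P = A"
    by (rule symmetric_of_eqI[OF A]) (simp add: P)
  have "(\<lambda>j. P (x j)) \<in> carrier (Y F)" if x: "x \<in> carrier (X E)" for x
  proof -
    have "const_tuple n x \<in> tuples n (\<lambda>_. X E)" using x by auto
    from summing_byD(1)[OF sum this]
    have "(\<lambda>j. A (\<lambda>m\<in>{..<n}. const_tuple n x m j)) \<in> carrier (Y F)" .
    also have "(\<lambda>j. A (\<lambda>m\<in>{..<n}. const_tuple n x m j)) = (\<lambda>j. P (x j))"
    proof
      fix j
      have "(\<lambda>m\<in>{..<n}. const_tuple n x m j) = const_tuple n (x j)" by (auto simp: fun_eq_iff)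
      then show "A (\<lambda>m\<in>{..<n}. const_tuple n x m j) = P (x j)"
        unfolding P restrict_apply'[OF X.coord_cl[OF E x]] by (simp only:)
    qed
    finally show ?thesis .
  qed
  then show "P \<in> carrier (comp n E F)" using P_cl by (simp add: component_mem)
  show "summing_poly_norm X Y E F P \<le> C"
    unfolding summing_poly_norm_eq[OF P_cl] sym
    by (rule summing_operator_norm_bounds(2)[OF seq E F A.multilinear_power_axioms sum C])
qed

text \<open>Polarization on sequences carries summability from \<open>P\<close> to its symmetric
  operator, and the closed graph theorem provides some constant; after that the norm is an
  admissible constant as well.\<close>

lemma componentD:
  assumes P: "P \<in> carrier (comp n E F)"
  shows "P \<in> carrier (poly_space n E F)" "symmetric_power n E F (symmetric_of n E F P)"
    and "v \<in> carrier E \<Longrightarrow> symmetric_of n E F P (const_tuple n v) = P v"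
    and "0 \<le> summing_poly_norm X Y E F P"
    and "summing_by X Y n (\<lambda>_. E) F (symmetric_of n E F P) (summing_poly_norm X Y E F P)"
proof -
  let ?A = "symmetric_of n E F P"
  show P_cl: "P \<in> carrier (poly_space n E F)" using P by (simp add: component_mem)
  note sym = symmetric_of_poly[OF E F P_cl]
  show A: "symmetric_power n E F ?A" and "v \<in> carrier E \<Longrightarrow> ?A (const_tuple n v) = P v"
    by (fact sym)+
  interpret A: symmetric_power n E F ?A by (rule A)
  have const: "(\<lambda>j. ?A (const_tuple n (x j))) \<in> carrier (Y F)" if x: "x \<in> carrier (X E)" for x
    unfolding sym(2)[OF X.coord_cl[OF E x]] using P x by (simp add: component_mem)
  note mem = polynomial_summing_imp_operator_summing[OF seq A const]
  have "0 \<le> real n ^ n / fact n * nrm (poly_space n E F) P"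
    using poly_nrm_bound(1)[OF E F P_cl] by simp
  from induced_bounded_by[OF seq A.multilinear_power_axioms sym(3) this mem]
  obtain D where D: "0 \<le> D" "bounded_by n (\<lambda>_. X E) (Y F) (induced n (\<lambda>_. X E) ?A) D" .
  have iff: "summing_by X Y n (\<lambda>_. E) F ?A D \<longleftrightarrow> bounded_by n (\<lambda>_. X E) (Y F) (induced n (\<lambda>_. X E) ?A) D"
    by (rule summing_by_iff_induced) (rule mem)
  have "summing_by X Y n (\<lambda>_. E) F ?A D" by (rule iffD2[OF iff D(2)])
  note bounds = summing_operator_norm_bounds[OF seq E F A.multilinear_power_axioms this D(1)]
  show "0 \<le> summing_poly_norm X Y E F P" "summing_by X Y n (\<lambda>_. E) F ?A (summing_poly_norm X Y E F P)"
    unfolding summing_poly_norm_eq[OF P_cl] by (fact bounds)+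
qed

lemma const_cl: "v \<in> carrier E \<Longrightarrow> const_tuple n v \<in> tuples n (\<lambda>_. E)"
  by auto

lemma component_add:
  assumes P: "P \<in> carrier (comp n E F)" and Q: "Q \<in> carrier (comp n E F)"
  defines "A \<equiv> add_op n E F (symmetric_of n E F P) (symmetric_of n E F Q)"
  shows "P \<oplus>\<^bsub>comp n E F\<^esub> Q = (\<lambda>v\<in>carrier E. A (const_tuple n v))"
    and "symmetric_power n E F A"
    and "summing_by X Y n (\<lambda>_. E) F A (summing_poly_norm X Y E F P + summing_poly_norm X Y E F Q)"
proof -
  note DP = componentD[OF P] and DQ = componentD[OF Q]
  show "P \<oplus>\<^bsub>comp n E F\<^esub> Q = (\<lambda>v\<in>carrier E. A (const_tuple n v))"
    unfolding component_simps
    by (rule restrict_ext) (simp only: A_def add_op_def restrict_apply' const_cl DP(3) DQ(3))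
  show "symmetric_power n E F A" unfolding A_def by (rule symmetric_power_add_op[OF DP(2) DQ(2)])
  show "summing_by X Y n (\<lambda>_. E) F A (summing_poly_norm X Y E F P + summing_poly_norm X Y E F Q)"
    unfolding A_def by (rule summing_by_add_op[OF seq E F DP(5) DQ(5)])
qed

lemma component_smult:
  fixes a :: 'k
  assumes P: "P \<in> carrier (comp n E F)"
  defines "A \<equiv> smult_op n E F a (symmetric_of n E F P)"
  shows "a \<odot>\<^bsub>comp n E F\<^esub> P = (\<lambda>v\<in>carrier E. A (const_tuple n v))"
    and "symmetric_power n E F A"
    and "summing_by X Y n (\<lambda>_. E) F A (norm a * summing_poly_norm X Y E F P)"
proof -
  note DP = componentD[OF P]
  show "a \<odot>\<^bsub>comp n E F\<^esub> P = (\<lambda>v\<in>carrier E. A (const_tuple n v))"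
    unfolding component_simps
    by (rule restrict_ext) (simp only: A_def smult_op_def restrict_apply' const_cl DP(3))
  show "symmetric_power n E F A" unfolding A_def by (rule symmetric_power_smult_op[OF DP(2)])
  show "summing_by X Y n (\<lambda>_. E) F A (norm a * summing_poly_norm X Y E F P)"
    unfolding A_def by (rule summing_by_smult_op[OF seq E F DP(5)])
qed

lemma component_add_cl:
  assumes P: "P \<in> carrier (comp n E F)" and Q: "Q \<in> carrier (comp n E F)"
  shows "P \<oplus>\<^bsub>comp n E F\<^esub> Q \<in> carrier (comp n E F)"
    and "summing_poly_norm X Y E F (P \<oplus>\<^bsub>comp n E F\<^esub> Q) \<le> summing_poly_norm X Y E F P + summing_poly_norm X Y E F Q"
  using componentI(1,3)[OF component_add(2,3)[OF P Q] _ component_add(1)[OF P Q]]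
    componentD(4)[OF P] componentD(4)[OF Q] by simp_all

lemma component_smult_cl:
  assumes P: "P \<in> carrier (comp n E F)"
  shows "a \<odot>\<^bsub>comp n E F\<^esub> P \<in> carrier (comp n E F)"
    and "summing_poly_norm X Y E F (a \<odot>\<^bsub>comp n E F\<^esub> P) \<le> norm a * summing_poly_norm X Y E F P"
  using componentI(1,3)[OF component_smult(2,3)[OF P] _ component_smult(1)[OF P]]
    componentD(4)[OF P] by simp_all

lemma component_zero:
  "\<zero>\<^bsub>comp n E F\<^esub> \<in> carrier (comp n E F)" "summing_poly_norm X Y E F \<zero>\<^bsub>comp n E F\<^esub> = 0"
proof -
  have eq: "\<zero>\<^bsub>comp n E F\<^esub> = (\<lambda>v\<in>carrier E. zero_op n E F (const_tuple n v))"
    unfolding component_simps by (rule restrict_ext) (simp only: zero_op_def restrict_apply' const_cl)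
  note I = componentI[OF symmetric_power_zero_op[OF E F] summing_by_zero_op[OF seq E F] order_refl eq]
  show "\<zero>\<^bsub>comp n E F\<^esub> \<in> carrier (comp n E F)" by (rule I(1))
  show "summing_poly_norm X Y E F \<zero>\<^bsub>comp n E F\<^esub> = 0"
    using I(3) componentD(4)[OF I(1)] by (rule antisym)
qed

text \<open>The norm of the difference is the least constant in a uniform estimate between the
  induced operators. Both directions serve completeness: from norms to estimates in
  \<open>Y F\<close>, and from such estimates back to norms.\<close>

lemma component_diff:
  fixes P Q
  defines "W \<equiv> P \<oplus>\<^bsub>comp n E F\<^esub> (-1) \<odot>\<^bsub>comp n E F\<^esub> Q"
    and "t \<equiv> \<lambda>P x j. symmetric_of n E F P (\<lambda>m\<in>{..<n}. x m j)"
  assumes P: "P \<in> carrier (comp n E F)" and Q: "Q \<in> carrier (comp n E F)"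
  shows "x \<in> tuples n (\<lambda>_. X E) \<Longrightarrow>
      nrm (Y F) (t P x \<ominus>\<^bsub>Y F\<^esub> t Q x) \<le> summing_poly_norm X Y E F W * (\<Prod>m<n. nrm (X E) (x m))"
    and "0 \<le> C \<Longrightarrow> (\<And>x. x \<in> tuples n (\<lambda>_. X E) \<Longrightarrow>
      nrm (Y F) (t P x \<ominus>\<^bsub>Y F\<^esub> t Q x) \<le> C * (\<Prod>m<n. nrm (X E) (x m))) \<Longrightarrow> summing_poly_norm X Y E F W \<le> C"
proof -
  note Q' = component_smult_cl(1)[OF Q, of "-1"]
  note DP = componentD[OF P] and DQ = componentD[OF Q] and DQ' = componentD[OF Q']
  define D where "D = add_op n E F (symmetric_of n E F P) (smult_op n E F (-1) (symmetric_of n E F Q))"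
  have symQ': "symmetric_of n E F ((-1) \<odot>\<^bsub>comp n E F\<^esub> Q) = smult_op n E F (-1) (symmetric_of n E F Q)"
    using componentI(2)[OF component_smult(2,3)[OF Q] _ component_smult(1)[OF Q]] DQ(4) by simp
  note W = component_add[OF P Q', folded W_def, unfolded symQ', folded D_def]
  have W_cl: "W \<in> carrier (comp n E F)" unfolding W_def by (rule component_add_cl(1)[OF P Q'])
  have symW: "symmetric_of n E F W = D"
    using componentI(2)[OF W(2,3) _ W(1)] DP(4) DQ'(4) by simp
  have seqD: "(\<lambda>j. D (\<lambda>m\<in>{..<n}. x m j)) = t P x \<ominus>\<^bsub>Y F\<^esub> t Q x" if x: "x \<in> tuples n (\<lambda>_. X E)" for x
    unfolding D_def add_op_seq[OF seq E F DP(5) summing_by_smult_op[OF seq E F DQ(5)] x]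
      smult_op_seq[OF seq E F DQ(5) x] t_def
    by (rule YF.diff_eq[OF summing_byD(1)[OF DP(5) x] summing_byD(1)[OF DQ(5) x], symmetric])
  show "nrm (Y F) (t P x \<ominus>\<^bsub>Y F\<^esub> t Q x) \<le> summing_poly_norm X Y E F W * (\<Prod>m<n. nrm (X E) (x m))"
    if x: "x \<in> tuples n (\<lambda>_. X E)"
    using summing_byD(2)[OF componentD(5)[OF W_cl] x] unfolding symW seqD[OF x] .
  assume C: "0 \<le> C" and le: "\<And>x. x \<in> tuples n (\<lambda>_. X E) \<Longrightarrow>
      nrm (Y F) (t P x \<ominus>\<^bsub>Y F\<^esub> t Q x) \<le> C * (\<Prod>m<n. nrm (X E) (x m))"
  have "summing_by X Y n (\<lambda>_. E) F D C"
    unfolding summing_by_def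
  proof (intro ballI conjI)
    fix x assume x: "x \<in> tuples n (\<lambda>_. X E)"
    show "(\<lambda>j. D (\<lambda>m\<in>{..<n}. x m j)) \<in> carrier (Y F)" by (rule summing_byD(1)[OF W(3) x])
    show "nrm (Y F) (\<lambda>j. D (\<lambda>m\<in>{..<n}. x m j)) \<le> C * (\<Prod>m<n. nrm (X E) (x m))"
      unfolding seqD[OF x] by (rule le[OF x])
  qed
  then show "summing_poly_norm X Y E F W \<le> C" by (rule componentI(3)[OF W(2) _ C W(1)])
qed

text \<open>For each \<open>x\<close> the induced values form a Cauchy sequence in
  \<open>Y F\<close> with a limit \<open>B x\<close>. The limit operator \<open>L\<close> on vectors
  is read off in coordinate 0 of sequences concentrated there. Coordinatewise limits show that
  \<open>B\<close> is induced by \<open>L\<close>, and the Cauchy estimate, uniform relative to the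
  product of norms, upgrades pointwise convergence to convergence in norm.\<close>

lemma component_complete:
  assumes u: "\<And>k. u k \<in> carrier (comp n E F)"
    and cauchy: "\<And>\<epsilon>. 0 < \<epsilon> \<Longrightarrow> \<exists>M. \<forall>k\<ge>M. \<forall>l\<ge>M. summing_poly_norm X Y E F
      (u k \<oplus>\<^bsub>comp n E F\<^esub> (-1) \<odot>\<^bsub>comp n E F\<^esub> u l) < \<epsilon>"
  shows "\<exists>p\<in>carrier (comp n E F). (\<lambda>k. summing_poly_norm X Y E F
      (u k \<oplus>\<^bsub>comp n E F\<^esub> (-1) \<odot>\<^bsub>comp n E F\<^esub> p)) \<longlonglongrightarrow> 0"
proof -
  define A where "A k = symmetric_of n E F (u k)" for k
  define t where "t k x = (\<lambda>j. A k (\<lambda>m\<in>{..<n}. x m j))" for k and x :: "nat \<Rightarrow> nat \<Rightarrow> 'k + 'u"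
  let ?N = "\<lambda>x. \<Prod>m<n. nrm (X E) (x m)"
  note Du = componentD[OF u, folded A_def]
  interpret A: symmetric_power n E F "A k" for k by (rule Du(2))
  have t_cl: "t k x \<in> carrier (Y F)" if "x \<in> tuples n (\<lambda>_. X E)" for k x
    unfolding t_def by (rule summing_byD(1)[OF Du(5) that])
  have N: "0 \<le> ?N x" if "x \<in> tuples n (\<lambda>_. X E)" for x
    by (rule prod_nonneg) (rule XE.nrm_nonneg[OF PiE_mem[OF that]])
  have diff: "nrm (Y F) (t k x \<ominus>\<^bsub>Y F\<^esub> t l x)
      \<le> summing_poly_norm X Y E F (u k \<oplus>\<^bsub>comp n E F\<^esub> (-1) \<odot>\<^bsub>comp n E F\<^esub> u l) * ?N x"
    if "x \<in> tuples n (\<lambda>_. X E)" for k l x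
    unfolding t_def A_def by (rule component_diff(1)[OF u u that])
  have diff_small: "\<exists>M. \<forall>k\<ge>M. \<forall>l\<ge>M. \<forall>x\<in>tuples n (\<lambda>_. X E). nrm (Y F) (t k x \<ominus>\<^bsub>Y F\<^esub> t l x) \<le> \<epsilon> * ?N x"
    if \<epsilon>: "0 < \<epsilon>" for \<epsilon>
  proof -
    obtain M where M: "\<forall>k\<ge>M. \<forall>l\<ge>M. summing_poly_norm X Y E F
        (u k \<oplus>\<^bsub>comp n E F\<^esub> (-1) \<odot>\<^bsub>comp n E F\<^esub> u l) < \<epsilon>"
      using cauchy[OF \<epsilon>] ..
    show ?thesis
    proof (intro exI allI impI ballI)
      fix k l x assume "M \<le> k" "M \<le> l" and x: "x \<in> tuples n (\<lambda>_. X E)"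
      then have "summing_poly_norm X Y E F (u k \<oplus>\<^bsub>comp n E F\<^esub> (-1) \<odot>\<^bsub>comp n E F\<^esub> u l) \<le> \<epsilon>"
        using M by (simp add: less_imp_le)
      then show "nrm (Y F) (t k x \<ominus>\<^bsub>Y F\<^esub> t l x) \<le> \<epsilon> * ?N x"
        by (rule order_trans[OF diff[OF x] mult_right_mono[OF _ N[OF x]]])
    qed
  qed
  have "\<exists>b. b \<in> carrier (Y F) \<and> (\<lambda>k. nrm (Y F) (t k x \<ominus>\<^bsub>Y F\<^esub> b)) \<longlonglongrightarrow> 0"
    if x: "x \<in> tuples n (\<lambda>_. X E)" for x
  proof -
    have "\<exists>M. \<forall>k\<ge>M. \<forall>l\<ge>M. nrm (Y F) (t k x \<ominus>\<^bsub>Y F\<^esub> t l x) < \<eta>" if \<eta>: "0 < \<eta>" for \<eta>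
    proof -
      \<comment> \<open>The summand 1 guards against a zero product of norms.\<close>
      have pos: "0 < \<eta> / (1 + ?N x)" using \<eta> N[OF x] by simp
      obtain M where M: "\<forall>k\<ge>M. \<forall>l\<ge>M. \<forall>z\<in>tuples n (\<lambda>_. X E).
          nrm (Y F) (t k z \<ominus>\<^bsub>Y F\<^esub> t l z) \<le> \<eta> / (1 + ?N x) * ?N z"
        using diff_small[OF pos] ..
      have less: "\<eta> / (1 + ?N x) * ?N x < \<eta>" using \<eta> N[OF x] by (simp add: field_simps)
      show ?thesis
      proof (intro exI allI impI)
        fix k l assume "M \<le> k" "M \<le> l"
        then have "nrm (Y F) (t k x \<ominus>\<^bsub>Y F\<^esub> t l x) \<le> \<eta> / (1 + ?N x) * ?N x"
          using M x by simp
        then show "nrm (Y F) (t k x \<ominus>\<^bsub>Y F\<^esub> t l x) < \<eta>" using less by (rule le_less_trans)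
      qed
    qed
    then obtain b where "b \<in> carrier (Y F)" "(\<lambda>k. nrm (Y F) (t k x \<ominus>\<^bsub>Y F\<^esub> b)) \<longlonglongrightarrow> 0"
      using YF.cauchy_convergent[of "\<lambda>k. t k x", OF t_cl[OF x]] by blast
    then show ?thesis by blast
  qed
  then obtain B where B: "\<And>x. x \<in> tuples n (\<lambda>_. X E) \<Longrightarrow> B x \<in> carrier (Y F)"
    and B_lim: "\<And>x. x \<in> tuples n (\<lambda>_. X E) \<Longrightarrow> (\<lambda>k. nrm (Y F) (t k x \<ominus>\<^bsub>Y F\<^esub> B x)) \<longlonglongrightarrow> 0"
    by metis
  define single where "single x = (\<lambda>m\<in>{..<n}. \<lambda>j. if j = (0::nat) then x m else \<zero>\<^bsub>E\<^esub>)" for x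
  have single_cl: "single x \<in> tuples n (\<lambda>_. X E)" if "x \<in> tuples n (\<lambda>_. E)" for x
    unfolding single_def by (rule restrict_PiE_iff[THEN iffD2], rule ballI, rule X.single(1)[OF E PiE_mem[OF that]])
  define L where "L = (\<lambda>x\<in>tuples n (\<lambda>_. E). B (single x) 0)"
  have L: "L x = B (single x) 0" if "x \<in> tuples n (\<lambda>_. E)" for x
    unfolding L_def by (rule restrict_apply'[OF that])
  have L_cl: "L x \<in> carrier F" if "x \<in> tuples n (\<lambda>_. E)" for x
    unfolding L[OF that] by (rule Y.coord_cl[OF F B[OF single_cl[OF that]]])
  have L_lim: "(\<lambda>k. nrm F (A k x \<ominus>\<^bsub>F\<^esub> L x)) \<longlonglongrightarrow> 0" if x: "x \<in> tuples n (\<lambda>_. E)" for x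
  proof -
    have "(\<lambda>m\<in>{..<n}. single x m 0) = x"
      using x by (auto simp: single_def fun_eq_iff PiE_def extensional_def)
    then have "t k (single x) 0 = A k x" for k by (simp only: t_def)
    then show ?thesis
      using Y.tendsto_coord[OF F t_cl[OF single_cl[OF x]] B[OF single_cl[OF x]] B_lim[OF single_cl[OF x]], of 0]
      by (simp only: L[OF x])
  qed
  have L_eqI: "L x = l" if x: "x \<in> tuples n (\<lambda>_. E)" and "l \<in> carrier F"
    "(\<lambda>k. nrm F (A k x \<ominus>\<^bsub>F\<^esub> l)) \<longlonglongrightarrow> 0" for x l
    by (rule F.tendsto_unique[OF A.op_cl[OF x] L_cl[OF x] that(2) L_lim[OF x] that(3)])
  have L_sym: "symmetric_power n E F L"
  proof (rule symmetric_powerI[OF E F L_cl])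
    show "L \<in> extensional (tuples n (\<lambda>_. E))" by (simp add: L_def)
    fix x assume x: "x \<in> tuples n (\<lambda>_. E)"
    show "L (x \<circ> \<sigma>) = L x" if "\<sigma> permutes {..<n}" for \<sigma>
    proof (rule L_eqI[OF A.perm_cl[OF that x] L_cl[OF x]])
      show "(\<lambda>k. nrm F (A k (x \<circ> \<sigma>) \<ominus>\<^bsub>F\<^esub> L x)) \<longlonglongrightarrow> 0"
        unfolding A.op_perm[OF that x] by (rule L_lim[OF x])
    qed
    fix i assume i: "i < n"
    have xi: "x i \<in> carrier E" by (rule A.entry_cl[OF x i])
    have same: "x(i := x i) = x" by simp
    show "L (x(i := a \<odot>\<^bsub>E\<^esub> x i)) = a \<odot>\<^bsub>F\<^esub> L x" for a
    proof (rule L_eqI[OF A.upd_cl[OF x i E.smult_cl[OF xi]] F.smult_cl[OF L_cl[OF x]]])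
      show "(\<lambda>k. nrm F (A k (x(i := a \<odot>\<^bsub>E\<^esub> x i)) \<ominus>\<^bsub>F\<^esub> a \<odot>\<^bsub>F\<^esub> L x)) \<longlonglongrightarrow> 0"
        unfolding A.op_smult[OF x i xi] same
        by (rule F.tendsto_smult[OF A.op_cl[OF x] L_cl[OF x] L_lim[OF x]])
    qed
    fix y assume y: "y \<in> carrier E"
    note xy = A.upd_cl[OF x i y]
    show "L (x(i := x i \<oplus>\<^bsub>E\<^esub> y)) = L x \<oplus>\<^bsub>F\<^esub> L (x(i := y))"
    proof (rule L_eqI[OF A.upd_cl[OF x i E.add_cl[OF xi y]] F.add_cl[OF L_cl[OF x] L_cl[OF xy]]])
      show "(\<lambda>k. nrm F (A k (x(i := x i \<oplus>\<^bsub>E\<^esub> y)) \<ominus>\<^bsub>F\<^esub> (L x \<oplus>\<^bsub>F\<^esub> L (x(i := y))))) \<longlonglongrightarrow> 0"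
        unfolding A.op_add[OF x i xi y] same
        by (rule F.tendsto_add[OF A.op_cl[OF x] A.op_cl[OF xy] L_cl[OF x] L_cl[OF xy] L_lim[OF x] L_lim[OF xy]])
    qed
  qed
  \<comment> \<open>In coordinate \<open>j\<close> both sides are limits of the values of
    \<open>A k\<close> at the \<open>j\<close>-th entries of \<open>x\<close>: on the left by the
    choice of \<open>L\<close>, on the right because convergence in \<open>Y F\<close> is
    coordinatewise.\<close>
  have B_eq: "(\<lambda>j. L (\<lambda>m\<in>{..<n}. x m j)) = B x" if x: "x \<in> tuples n (\<lambda>_. X E)" for x
  proof
    fix j
    have "(\<lambda>k. nrm F (t k x j \<ominus>\<^bsub>F\<^esub> B x j)) \<longlonglongrightarrow> 0"
      by (rule Y.tendsto_coord[OF F t_cl[OF x] B[OF x] B_lim[OF x]])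
    then show "L (\<lambda>m\<in>{..<n}. x m j) = B x j"
      unfolding t_def by (rule L_eqI[OF X.restrict_coord_cl[OF E x] Y.coord_cl[OF F B[OF x]]])
  qed
  \<comment> \<open>Letting the other index tend to infinity in the Cauchy estimate keeps the same
    \<open>\<epsilon>\<close> and \<open>M\<close> for all \<open>x\<close>.\<close>
  have close: "\<exists>M. \<forall>k\<ge>M. \<forall>x\<in>tuples n (\<lambda>_. X E). nrm (Y F) (t k x \<ominus>\<^bsub>Y F\<^esub> B x) \<le> \<epsilon> * ?N x"
    if \<epsilon>: "0 < \<epsilon>" for \<epsilon>
  proof -
    obtain M where M: "\<forall>k\<ge>M. \<forall>l\<ge>M. \<forall>x\<in>tuples n (\<lambda>_. X E).
        nrm (Y F) (t k x \<ominus>\<^bsub>Y F\<^esub> t l x) \<le> \<epsilon> * ?N x"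
      using diff_small[OF \<epsilon>] ..
    show ?thesis
    proof (intro exI allI impI ballI)
      fix k x assume k: "M \<le> k" and x: "x \<in> tuples n (\<lambda>_. X E)"
      have "nrm (Y F) (t l x \<ominus>\<^bsub>Y F\<^esub> t k x) \<le> \<epsilon> * ?N x" if "M \<le> l" for l
        using M k that x by blast
      then have "nrm (Y F) (B x \<ominus>\<^bsub>Y F\<^esub> t k x) \<le> \<epsilon> * ?N x"
        by (rule YF.tendsto_nrm_diff_le[OF t_cl[OF x] B[OF x] t_cl[OF x] B_lim[OF x]])
      then show "nrm (Y F) (t k x \<ominus>\<^bsub>Y F\<^esub> B x) \<le> \<epsilon> * ?N x"
        by (simp only: YF.nrm_diff_commute[OF t_cl[OF x] B[OF x]])
    qed
  qed
  \<comment> \<open>Accuracy 1 is enough for \<open>L\<close> to inherit a summing constant from the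
    single polynomial \<open>u M\<close>.\<close>
  obtain M where M: "\<forall>k\<ge>M. \<forall>x\<in>tuples n (\<lambda>_. X E). nrm (Y F) (t k x \<ominus>\<^bsub>Y F\<^esub> B x) \<le> 1 * ?N x"
    using close[OF zero_less_one] ..
  let ?C = "1 + summing_poly_norm X Y E F (u M)"
  have L_sum: "summing_by X Y n (\<lambda>_. E) F L ?C"
    unfolding summing_by_def
  proof (intro ballI conjI)
    fix x assume x: "x \<in> tuples n (\<lambda>_. X E)"
    show "(\<lambda>j. L (\<lambda>m\<in>{..<n}. x m j)) \<in> carrier (Y F)" unfolding B_eq[OF x] by (rule B[OF x])
    have "nrm (Y F) (B x) \<le> nrm (Y F) (B x \<ominus>\<^bsub>Y F\<^esub> t M x) + nrm (Y F) (t M x)"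
      by (rule YF.nrm_le_diff[OF B[OF x] t_cl[OF x]])
    also have "nrm (Y F) (B x \<ominus>\<^bsub>Y F\<^esub> t M x) \<le> 1 * ?N x"
      unfolding YF.nrm_diff_commute[OF B[OF x] t_cl[OF x]] using M x by blast
    also have "nrm (Y F) (t M x) \<le> summing_poly_norm X Y E F (u M) * ?N x"
      unfolding t_def by (rule summing_byD(2)[OF Du(5) x])
    finally show "nrm (Y F) (\<lambda>j. L (\<lambda>m\<in>{..<n}. x m j)) \<le> ?C * ?N x"
      unfolding B_eq[OF x] by (simp add: distrib_right)
  qed
  define p where "p = (\<lambda>v\<in>carrier E. L (const_tuple n v))"
  have C: "0 \<le> ?C" using Du(4)[of M] by simp
  note p = componentI[OF L_sym L_sum C p_def]
  have "(\<lambda>k. summing_poly_norm X Y E F (u k \<oplus>\<^bsub>comp n E F\<^esub> (-1) \<odot>\<^bsub>comp n E F\<^esub> p)) \<longlonglongrightarrow> 0"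
  proof (rule LIMSEQ_I)
    fix r :: real assume r: "0 < r"
    then have r2: "0 < r / 2" by simp
    obtain M where M: "\<forall>k\<ge>M. \<forall>x\<in>tuples n (\<lambda>_. X E). nrm (Y F) (t k x \<ominus>\<^bsub>Y F\<^esub> B x) \<le> r / 2 * ?N x"
      using close[OF r2] ..
    have "norm (summing_poly_norm X Y E F (u k \<oplus>\<^bsub>comp n E F\<^esub> (-1) \<odot>\<^bsub>comp n E F\<^esub> p) - 0) < r" if k: "M \<le> k" for k
    proof -
      have "summing_poly_norm X Y E F (u k \<oplus>\<^bsub>comp n E F\<^esub> (-1) \<odot>\<^bsub>comp n E F\<^esub> p) \<le> r / 2"
      proof (rule component_diff(2)[OF u p(1)])
        show "0 \<le> r / 2" using r by simp
        fix x assume x: "x \<in> tuples n (\<lambda>_. X E)"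
        have "nrm (Y F) (t k x \<ominus>\<^bsub>Y F\<^esub> B x) \<le> r / 2 * ?N x" using M k x by blast
        then show "nrm (Y F) ((\<lambda>j. symmetric_of n E F (u k) (\<lambda>m\<in>{..<n}. x m j)) \<ominus>\<^bsub>Y F\<^esub>
            (\<lambda>j. symmetric_of n E F p (\<lambda>m\<in>{..<n}. x m j))) \<le> r / 2 * ?N x"
          unfolding p(2) B_eq[OF x] t_def A_def .
      qed
      moreover have "0 \<le> summing_poly_norm X Y E F (u k \<oplus>\<^bsub>comp n E F\<^esub> (-1) \<odot>\<^bsub>comp n E F\<^esub> p)"
        by (rule componentD(4)[OF component_add_cl(1)[OF u component_smult_cl(1)[OF p(1)]]])
      ultimately show ?thesis using r by simp
    qed
    then show "\<exists>M. \<forall>k\<ge>M. norm (summing_poly_norm X Y E F (u k \<oplus>\<^bsub>comp n E F\<^esub> (-1) \<odot>\<^bsub>comp n E F\<^esub> p) - 0) < r"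
      by blast
  qed
  then show ?thesis using p(1) by blast
qed

text \<open>The linear laws hold pointwise in \<open>F\<close>. Definiteness holds because a
  vanishing summing norm forces the operator norm, and with it all diagonal values, to
  vanish.\<close>

lemma component_banach: "banach_space (comp n E F)"
proof (rule banach_spaceI)
  note cl = poly_cl[OF componentD(1)]
  show "\<zero>\<^bsub>comp n E F\<^esub> \<in> carrier (comp n E F)" by (rule component_zero(1))
  fix P assume P: "P \<in> carrier (comp n E F)"
  note Pv = cl[OF P]
  have ext: "P = (\<lambda>v\<in>carrier E. P v)"
    by (rule extensional_restrict[OF poly_ext[OF componentD(1)[OF P]], symmetric])
  show "a \<odot>\<^bsub>comp n E F\<^esub> P \<in> carrier (comp n E F)" for a by (rule component_smult_cl(1)[OF P])
  show "\<zero>\<^bsub>comp n E F\<^esub> \<oplus>\<^bsub>comp n E F\<^esub> P = P"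
    by (subst (2) ext, unfold component_simps, rule restrict_ext) (simp add: Pv)
  show "(a + b) \<odot>\<^bsub>comp n E F\<^esub> P = a \<odot>\<^bsub>comp n E F\<^esub> P \<oplus>\<^bsub>comp n E F\<^esub> b \<odot>\<^bsub>comp n E F\<^esub> P" for a b
    unfolding component_simps by (rule restrict_ext) (simp add: Pv F.smult_add_left)
  show "(a * b) \<odot>\<^bsub>comp n E F\<^esub> P = a \<odot>\<^bsub>comp n E F\<^esub> (b \<odot>\<^bsub>comp n E F\<^esub> P)" for a b
    unfolding component_simps by (rule restrict_ext) (simp add: Pv F.smult_smult)
  show one: "1 \<odot>\<^bsub>comp n E F\<^esub> P = P"
    by (subst (2) ext, unfold component_simps, rule restrict_ext) (simp add: Pv F.smult_1)
  show zero: "0 \<odot>\<^bsub>comp n E F\<^esub> P = \<zero>\<^bsub>comp n E F\<^esub>"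
    unfolding component_simps by (rule restrict_ext) (simp add: Pv F.smult_0)
  show nn: "0 \<le> nrm (comp n E F) P" unfolding component_simps by (rule componentD(4)[OF P])
  show "nrm (comp n E F) P = 0 \<longleftrightarrow> P = \<zero>\<^bsub>comp n E F\<^esub>"
  proof
    assume "nrm (comp n E F) P = 0"
    then have "summing_by X Y n (\<lambda>_. E) F (symmetric_of n E F P) 0"
      using componentD(5)[OF P] unfolding component_simps by simp
    then have bound: "bounded_by n (\<lambda>_. E) F (symmetric_of n E F P) 0"
      by (rule summing_imp_bounded_by[OF X.stable_seq_class_axioms seq(2) E F order_refl])
    have "P v = \<zero>\<^bsub>F\<^esub>" if v: "v \<in> carrier E" for v
    proof -
      have "nrm F (P v) \<le> 0"
        using bound[unfolded bounded_by_def, rule_format, OF const_cl[OF v]] componentD(3)[OF P v] by simp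
      then show ?thesis using F.nrm_nonneg[OF Pv[OF v]] F.nrm_eq_0_iff[OF Pv[OF v]] by simp
    qed
    then show "P = \<zero>\<^bsub>comp n E F\<^esub>"
      by (subst ext, unfold component_simps, intro restrict_ext)
  next
    assume "P = \<zero>\<^bsub>comp n E F\<^esub>"
    then show "nrm (comp n E F) P = 0" using component_zero(2) by (simp add: component_simps(5))
  qed
  \<comment> \<open>So far one inequality is available for scalar multiples; the other results from
    applying it to \<open>inverse a\<close> and the multiple of \<open>P\<close> by
    \<open>a\<close>.\<close>
  show "nrm (comp n E F) (a \<odot>\<^bsub>comp n E F\<^esub> P) = norm a * nrm (comp n E F) P" for a
  proof (cases "a = 0")
    case True
    then show ?thesis unfolding component_simps(5) by (simp add: zero component_zero(2))
  next
    case False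
    note aP = component_smult_cl[OF P, of a]
    have "inverse a \<odot>\<^bsub>comp n E F\<^esub> (a \<odot>\<^bsub>comp n E F\<^esub> P) = P"
    proof -
      have "inverse a \<odot>\<^bsub>comp n E F\<^esub> (a \<odot>\<^bsub>comp n E F\<^esub> P) = (inverse a * a) \<odot>\<^bsub>comp n E F\<^esub> P"
        unfolding component_simps by (rule restrict_ext) (simp add: Pv F.smult_smult)
      then show ?thesis using False one by simp
    qed
    then have "summing_poly_norm X Y E F P
        \<le> norm (inverse a) * summing_poly_norm X Y E F (a \<odot>\<^bsub>comp n E F\<^esub> P)"
      using component_smult_cl(2)[OF aP(1), of "inverse a"] by simp
    then have "norm a * summing_poly_norm X Y E F P \<le> summing_poly_norm X Y E F (a \<odot>\<^bsub>comp n E F\<^esub> P)"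
      unfolding norm_inverse using False by (simp add: field_simps)
    then show ?thesis using aP(2) unfolding component_simps(5) by simp
  qed
  fix Q assume Q: "Q \<in> carrier (comp n E F)"
  note Qv = cl[OF Q]
  show "P \<oplus>\<^bsub>comp n E F\<^esub> Q \<in> carrier (comp n E F)" by (rule component_add_cl(1)[OF P Q])
  show "P \<oplus>\<^bsub>comp n E F\<^esub> Q = Q \<oplus>\<^bsub>comp n E F\<^esub> P"
    unfolding component_simps by (rule restrict_ext) (simp add: Pv Qv F.M.a_comm)
  show "a \<odot>\<^bsub>comp n E F\<^esub> (P \<oplus>\<^bsub>comp n E F\<^esub> Q) = a \<odot>\<^bsub>comp n E F\<^esub> P \<oplus>\<^bsub>comp n E F\<^esub> a \<odot>\<^bsub>comp n E F\<^esub> Q" for a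
    unfolding component_simps by (rule restrict_ext) (simp add: Pv Qv F.smult_add_right)
  show "nrm (comp n E F) (P \<oplus>\<^bsub>comp n E F\<^esub> Q) \<le> nrm (comp n E F) P + nrm (comp n E F) Q"
    unfolding component_simps(5) by (rule component_add_cl(2)[OF P Q])
  show "(P \<oplus>\<^bsub>comp n E F\<^esub> Q) \<oplus>\<^bsub>comp n E F\<^esub> R = P \<oplus>\<^bsub>comp n E F\<^esub> (Q \<oplus>\<^bsub>comp n E F\<^esub> R)"
    if R: "R \<in> carrier (comp n E F)" for R
    unfolding component_simps by (rule restrict_ext) (simp add: Pv Qv cl[OF R] F.M.a_assoc)
next
  show "\<exists>p\<in>carrier (comp n E F). (\<lambda>k. nrm (comp n E F) (u k \<oplus>\<^bsub>comp n E F\<^esub> (-1) \<odot>\<^bsub>comp n E F\<^esub> p)) \<longlonglongrightarrow> 0"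
    if "\<And>k. u k \<in> carrier (comp n E F)"
      "\<And>\<epsilon>. 0 < \<epsilon> \<Longrightarrow> \<exists>M. \<forall>k\<ge>M. \<forall>l\<ge>M. nrm (comp n E F) (u k \<oplus>\<^bsub>comp n E F\<^esub> (-1) \<odot>\<^bsub>comp n E F\<^esub> u l) < \<epsilon>" for u
    using component_complete[of u] that unfolding component_simps(5) by blast
qed

end

end

section \<open>The ideal property\<close>

text \<open>The symmetric operator of the polynomial with value \<open>\<phi> v ^ n\<close> times
  \<open>b\<close> at \<open>v\<close>, given in closed form.\<close>

definition product_op ::
    "nat \<Rightarrow> ('k :: {real_normed_field, banach}, 'a) normed_module \<Rightarrow> ('k, 'b) normed_module \<Rightarrow> ('a \<Rightarrow> 'k) \<Rightarrow> 'b
      \<Rightarrow> (nat \<Rightarrow> 'a) \<Rightarrow> 'b"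
where "product_op n E F \<phi> b = (\<lambda>x\<in>tuples n (\<lambda>_. E). (\<Prod>i<n. \<phi> (x i)) \<odot>\<^bsub>F\<^esub> b)"

lemma symmetric_power_product_op:
  assumes E: "banach_space E" and F: "banach_space F" and b: "b \<in> carrier F"
    and add: "\<And>v w. v \<in> carrier E \<Longrightarrow> w \<in> carrier E \<Longrightarrow> \<phi> (v \<oplus>\<^bsub>E\<^esub> w) = \<phi> v + \<phi> w"
    and smult: "\<And>a v. v \<in> carrier E \<Longrightarrow> \<phi> (a \<odot>\<^bsub>E\<^esub> v) = a * \<phi> v"
  shows "symmetric_power n E F (product_op n E F \<phi> b)"
proof -
  interpret E: banach_space E by fact
  interpret F: banach_space F by fact
  have eq: "product_op n E F \<phi> b x = (\<Prod>i<n. \<phi> (x i)) \<odot>\<^bsub>F\<^esub> b" if "x \<in> tuples n (\<lambda>_. E)" for x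
    unfolding product_op_def by (rule restrict_apply'[OF that])
  have upd_cl: "x(i := v) \<in> tuples n (\<lambda>_. E)" if "x \<in> tuples n (\<lambda>_. E)" "i < n" "v \<in> carrier E" for x i v
    using that by (auto simp: PiE_def extensional_def)
  have split: "(\<Prod>k<n. \<phi> ((x(i := v)) k)) = \<phi> v * (\<Prod>k\<in>{..<n} - {i}. \<phi> (x k))" if "i < n" for x i v
    using that by (subst prod.remove[of _ i]) auto
  show ?thesis
  proof (rule symmetric_powerI[OF E F])
    show "product_op n E F \<phi> b \<in> extensional (tuples n (\<lambda>_. E))" by (simp add: product_op_def)
    fix x assume x: "x \<in> tuples n (\<lambda>_. E)"
    show "product_op n E F \<phi> b x \<in> carrier F" unfolding eq[OF x] by (rule F.smult_cl[OF b])
    show "product_op n E F \<phi> b (x \<circ> \<sigma>) = product_op n E F \<phi> b x" if \<sigma>: "\<sigma> permutes {..<n}" for \<sigma>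
    proof -
      have "x \<circ> \<sigma> \<in> tuples n (\<lambda>_. E)"
        using x permutes_in_image[OF \<sigma>] by (auto simp: PiE_iff extensional_def)
      moreover have "(\<Prod>i<n. \<phi> ((x \<circ> \<sigma>) i)) = (\<Prod>i<n. \<phi> (x i))"
        using prod.permute[OF \<sigma>, of "\<lambda>i. \<phi> (x i)"] by (simp add: o_def)
      ultimately show ?thesis by (simp only: eq x)
    qed
    fix i assume i: "i < n"
    have xi: "x i \<in> carrier E" using x i by auto
    have same: "(\<Prod>k<n. \<phi> (x k)) = \<phi> (x i) * (\<Prod>k\<in>{..<n} - {i}. \<phi> (x k))"
      using split[OF i, of x "x i"] by simp
    show "product_op n E F \<phi> b (x(i := a \<odot>\<^bsub>E\<^esub> x i)) = a \<odot>\<^bsub>F\<^esub> product_op n E F \<phi> b x" for a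
      unfolding eq[OF x] eq[OF upd_cl[OF x i E.smult_cl[OF xi]]] split[OF i] same smult[OF xi]
        F.smult_smult[OF b] by (simp only: mult.assoc)
    fix y assume y: "y \<in> carrier E"
    show "product_op n E F \<phi> b (x(i := x i \<oplus>\<^bsub>E\<^esub> y)) = product_op n E F \<phi> b x \<oplus>\<^bsub>F\<^esub> product_op n E F \<phi> b (x(i := y))"
      unfolding eq[OF x] eq[OF upd_cl[OF x i y]] eq[OF upd_cl[OF x i E.add_cl[OF xi y]]]
        split[OF i] same add[OF xi y] distrib_right by (rule F.smult_add_left[OF b])
  qed
qed

lemma product_op_const:
  assumes "v \<in> carrier E"
  shows "product_op n E F \<phi> b (const_tuple n v) = (\<phi> v ^ n) \<odot>\<^bsub>F\<^esub> b"
proof -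
  have t: "const_tuple n v \<in> tuples n (\<lambda>_. E)" using assms by auto
  show ?thesis unfolding product_op_def restrict_apply'[OF t] by simp
qed

lemma bounded_by_product_op:
  assumes E: "banach_space E" and F: "banach_space F" and b: "b \<in> carrier F"
    and bound: "\<And>v. v \<in> carrier E \<Longrightarrow> norm (\<phi> v) \<le> C * nrm E v"
  shows "bounded_by n (\<lambda>_. E) F (product_op n E F \<phi> b) (C ^ n * nrm F b)"
  unfolding bounded_by_def
proof
  interpret E: banach_space E by fact
  interpret F: banach_space F by fact
  fix x assume x: "x \<in> tuples n (\<lambda>_. E)"
  have "nrm F (product_op n E F \<phi> b x) = (\<Prod>i<n. norm (\<phi> (x i))) * nrm F b"
    unfolding product_op_def restrict_apply'[OF x] F.nrm_smult[OF b] prod_norm ..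
  also have "\<dots> \<le> (\<Prod>i<n. C * nrm E (x i)) * nrm F b"
    by (intro mult_right_mono prod_mono conjI norm_ge_zero bound PiE_mem[OF x] F.nrm_nonneg[OF b])
  also have "\<dots> = C ^ n * nrm F b * (\<Prod>i<n. nrm E (x i))" by (simp add: prod.distrib)
  finally show "nrm F (product_op n E F \<phi> b x) \<le> C ^ n * nrm F b * (\<Prod>i<n. nrm E (x i))" .
qed

text \<open>Elements of \<open>dual\<close> take values in the scalar type itself and not in
  \<open>scalar_space\<close>, so the argument for multilinear operators is repeated: the preimage
  of the unit ball contains a ball of radius \<open>r\<close>, and scaling a vector to norm
  \<open>r / 2\<close> gives the constant \<open>2 / r\<close>.\<close>

lemma dual_bounded:
  fixes E :: "('k :: {real_normed_field, banach}, 'a) normed_module"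
  assumes E: "banach_space E" and \<phi>: "\<phi> \<in> dual E"
  obtains C where "0 \<le> C" "\<And>v. v \<in> carrier E \<Longrightarrow> norm (\<phi> v) \<le> C * nrm E v"
proof -
  interpret E: banach_space E by fact
  have smult: "\<phi> (a \<odot>\<^bsub>E\<^esub> v) = a * \<phi> v" if "v \<in> carrier E" for a v
    using \<phi> that by (simp add: dual_def)
  have zero: "\<phi> \<zero>\<^bsub>E\<^esub> = 0"
    using smult[OF E.zero_cl, of 0] by (simp only: E.smult_zero mult_zero_left)
  have "continuous_map (ntop E) euclidean \<phi>" using \<phi> by (simp add: dual_def)
  then have "openin (ntop E) {v \<in> topspace (ntop E). \<phi> v \<in> ball 0 1}"
    by (rule openin_continuous_map_preimage) simp
  then have "openin E.met.mtopology {v \<in> carrier E. \<phi> v \<in> ball 0 1}"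
    unfolding E.topspace_ntop unfolding ntop_def .
  moreover have "\<zero>\<^bsub>E\<^esub> \<in> {v \<in> carrier E. \<phi> v \<in> ball 0 1}" by (simp add: zero)
  ultimately obtain r where r: "r > 0" "E.met.mball \<zero>\<^bsub>E\<^esub> r \<subseteq> {v \<in> carrier E. \<phi> v \<in> ball 0 1}"
    unfolding E.met.openin_mtopology by meson
  have small: "norm (\<phi> v) < 1" if v: "v \<in> carrier E" "nrm E v < r" for v
  proof -
    have "v \<in> E.met.mball \<zero>\<^bsub>E\<^esub> r"
      using v E.nrm_diff_commute[OF v(1) E.zero_cl] by (simp add: ndist_def E.diff_zero)
    then show ?thesis using r(2) by auto
  qed
  have "norm (\<phi> v) \<le> 2 / r * nrm E v" if v: "v \<in> carrier E" for v
  proof (cases "v = \<zero>\<^bsub>E\<^esub>")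
    case True
    then show ?thesis by (simp add: zero E.nrm_zero)
  next
    case False
    then have pos: "0 < nrm E v" using E.nrm_nonneg[OF v] E.nrm_eq_0_iff[OF v] by linarith
    let ?s = "of_real (r / (2 * nrm E v)) :: 'k"
    have s: "norm ?s = r / (2 * nrm E v)" unfolding norm_of_real using pos r(1) by simp
    have "nrm E (?s \<odot>\<^bsub>E\<^esub> v) = r / 2" unfolding E.nrm_smult[OF v] s using pos by simp
    then have "norm (\<phi> (?s \<odot>\<^bsub>E\<^esub> v)) < 1" using r(1) by (intro small E.smult_cl[OF v]) simp
    then have "r / (2 * nrm E v) * norm (\<phi> v) < 1" unfolding smult[OF v] norm_mult s .
    then show ?thesis using pos r(1) by (simp add: field_simps)
  qed
  moreover have "0 \<le> 2 / r" using r(1) by simp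
  ultimately show ?thesis using that by blast
qed

text \<open>\<open>finite_type_polys\<close> takes its sums in \<open>poly_space\<close>, and the
  laws of finite sums presuppose a commutative monoid. Continuity of a sum is derived from bounds on
  the symmetric operators.\<close>

lemma poly_space_abelian_monoid:
  assumes E: "banach_space E" and F: "banach_space F"
  shows "abelian_monoid (poly_space n E F)"
proof (rule abelian_monoidI)
  interpret F: banach_space F by fact
  note cl = poly_cl[of _ n E F]
  have const_cl: "const_tuple n v \<in> tuples n (\<lambda>_. E)" if "v \<in> carrier E" for v using that by auto
  interpret Z: symmetric_power n E F "zero_op n E F" by (rule symmetric_power_zero_op[OF E F])
  have "bounded_by n (\<lambda>_. E) F (zero_op n E F) 0"
    unfolding bounded_by_def zero_op_def by (simp add: F.nrm_zero)
  note Z_cl = Z.poly_spaceI[OF this order_refl]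
  show "\<zero>\<^bsub>poly_space n E F\<^esub> \<in> carrier (poly_space n E F)"
  proof -
    have "\<zero>\<^bsub>poly_space n E F\<^esub> = (\<lambda>v\<in>carrier E. zero_op n E F (const_tuple n v))"
      unfolding poly_space_simps(2) by (rule restrict_ext) (simp only: zero_op_def restrict_apply' const_cl)
    then show ?thesis
      using Z_cl by (simp only:)
  qed
  fix P assume P: "P \<in> carrier (poly_space n E F)"
  have ext: "P = (\<lambda>v\<in>carrier E. P v)" by (rule extensional_restrict[OF poly_ext[OF P], symmetric])
  show "\<zero>\<^bsub>poly_space n E F\<^esub> \<oplus>\<^bsub>poly_space n E F\<^esub> P = P"
    by (subst (2) ext, unfold poly_space_simps, rule restrict_ext) (simp add: cl[OF P])
  fix Q assume Q: "Q \<in> carrier (poly_space n E F)"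
  show "P \<oplus>\<^bsub>poly_space n E F\<^esub> Q = Q \<oplus>\<^bsub>poly_space n E F\<^esub> P"
    unfolding poly_space_simps by (rule restrict_ext) (simp add: cl[OF P] cl[OF Q] F.M.a_comm)
  show "(P \<oplus>\<^bsub>poly_space n E F\<^esub> Q) \<oplus>\<^bsub>poly_space n E F\<^esub> R = P \<oplus>\<^bsub>poly_space n E F\<^esub> (Q \<oplus>\<^bsub>poly_space n E F\<^esub> R)"
    if R: "R \<in> carrier (poly_space n E F)" for R
    unfolding poly_space_simps by (rule restrict_ext) (simp add: cl[OF P] cl[OF Q] cl[OF R] F.M.a_assoc)
  show "P \<oplus>\<^bsub>poly_space n E F\<^esub> Q \<in> carrier (poly_space n E F)"
  proof -
    note SP = symmetric_of_poly[OF E F P] and SQ = symmetric_of_poly[OF E F Q]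
    let ?A = "symmetric_of n E F P" and ?B = "symmetric_of n E F Q"
    let ?C = "real n ^ n / fact n * nrm (poly_space n E F) P" and ?D = "real n ^ n / fact n * nrm (poly_space n E F) Q"
    interpret A: symmetric_power n E F ?A by (rule SP(1))
    interpret B: symmetric_power n E F ?B by (rule SQ(1))
    interpret S: symmetric_power n E F "add_op n E F ?A ?B" by (rule symmetric_power_add_op[OF SP(1) SQ(1)])
    have "bounded_by n (\<lambda>_. E) F (add_op n E F ?A ?B) (?C + ?D)"
      unfolding bounded_by_def
    proof
      fix x assume x: "x \<in> tuples n (\<lambda>_. E)"
      show "nrm F (add_op n E F ?A ?B x) \<le> (?C + ?D) * (\<Prod>i<n. nrm E (x i))"
        unfolding add_op_def restrict_apply'[OF x] distrib_right[of ?C ?D]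
        by (rule order_trans[OF F.nrm_triangle[OF A.op_cl[OF x] B.op_cl[OF x]]])
          (rule add_mono[OF SP(3)[unfolded bounded_by_def, rule_format, OF x] SQ(3)[unfolded bounded_by_def, rule_format, OF x]])
    qed
    moreover have "0 \<le> ?C + ?D"
      using poly_nrm_bound(1)[OF E F P] poly_nrm_bound(1)[OF E F Q] by simp
    ultimately have "(\<lambda>v\<in>carrier E. add_op n E F ?A ?B (const_tuple n v)) \<in> carrier (poly_space n E F)"
      by (rule S.poly_spaceI)
    moreover have "P \<oplus>\<^bsub>poly_space n E F\<^esub> Q = (\<lambda>v\<in>carrier E. add_op n E F ?A ?B (const_tuple n v))"
      unfolding poly_space_simps(3)
      by (rule restrict_ext) (simp only: add_op_def restrict_apply' const_cl SP(2) SQ(2))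
    ultimately show ?thesis by (simp only:)
  qed
qed

context summing_ideal
begin

lemma power_embeddedD:
  fixes n :: nat
  assumes "1 \<le> n" "\<And>m. m < n \<Longrightarrow> l m \<in> carrier (X scalar_space)"
  shows "(\<lambda>j. Inl (\<Prod>m<n. projl (l m j))) \<in> carrier (Y scalar_space)"
    and "nrm (Y scalar_space) (\<lambda>j. Inl (\<Prod>m<n. projl (l m j))) \<le> (\<Prod>m<n. nrm (X scalar_space) (l m))"
  using power_embedded[OF assms(1)] assms(2) unfolding power_embedded_def by blast+

text \<open>Three steps along a sequence: stability of \<open>X\<close> for \<open>\<phi>\<close>
  gives scalars in the class \<open>X\<close>, the compatibility of the classes puts their
  \<open>n\<close>-th powers into the class \<open>Y\<close>, and stability of \<open>Y\<close> for
  multiplication by \<open>b\<close> leads to \<open>Y F\<close>.\<close>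

lemma power_functional_component:
  assumes n: "1 \<le> n" and E: "banach_space E" and F: "banach_space F" and \<phi>: "\<phi> \<in> dual E" and b: "b \<in> carrier F"
  shows "(\<lambda>v\<in>carrier E. (\<phi> v ^ n) \<odot>\<^bsub>F\<^esub> b) \<in> carrier (comp n E F)" (is "?P \<in> _")
proof -
  interpret F: banach_space F by fact
  have add: "\<phi> (v \<oplus>\<^bsub>E\<^esub> w) = \<phi> v + \<phi> w" if "v \<in> carrier E" "w \<in> carrier E" for v w
    using \<phi> that by (simp add: dual_def)
  have smult: "\<phi> (a \<odot>\<^bsub>E\<^esub> v) = a * \<phi> v" if "v \<in> carrier E" for a v
    using \<phi> that by (simp add: dual_def)
  obtain C where C: "0 \<le> C" "\<And>v. v \<in> carrier E \<Longrightarrow> norm (\<phi> v) \<le> C * nrm E v"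
    using dual_bounded[OF E \<phi>] by blast
  interpret A: symmetric_power n E F "product_op n E F \<phi> b"
    by (rule symmetric_power_product_op[OF E F b add smult])
  have nb: "0 \<le> nrm F b" by (rule F.nrm_nonneg[OF b])
  have "?P = (\<lambda>v\<in>carrier E. product_op n E F \<phi> b (const_tuple n v))"
    by (rule restrict_ext) (simp only: product_op_const)
  moreover have "\<dots> \<in> carrier (poly_space n E F)"
    by (rule A.poly_spaceI[OF bounded_by_product_op[OF E F b C(2)]]) (use C(1) nb in simp_all)
  moreover have "(\<lambda>j. ?P (x j)) \<in> carrier (Y F)" if x: "x \<in> carrier (X E)" for x
  proof -
    note xj = X.coord_cl[OF E x]
    let ?s = "\<lambda>j. Inl (\<phi> (x j)) :: 'k + 'u"
    have "?s \<in> carrier (X scalar_space)"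
      by (rule X.linear_image(1)[OF E banach_scalar_space, where f = "\<lambda>v. Inl (\<phi> v)" and C = C])
        (simp_all add: scalar_space_simps add smult C x)
    then have "(\<lambda>j. Inl (\<Prod>m<n. projl (?s j))) \<in> carrier (Y scalar_space)"
      by (intro power_embeddedD(1)[OF n])
    then have "(\<lambda>j. projl (Inl (\<Prod>m<n. projl (?s j)) :: 'k + 'u) \<odot>\<^bsub>F\<^esub> b) \<in> carrier (Y F)"
      by (intro Y.linear_image(1)[OF banach_scalar_space F, where f = "\<lambda>z. projl z \<odot>\<^bsub>F\<^esub> b" and C = "nrm F b"])
        (simp_all add: scalar_space_simps b nb F.smult_cl F.smult_add_left F.smult_smult F.nrm_smult)
    also have "(\<lambda>j. projl (Inl (\<Prod>m<n. projl (?s j)) :: 'k + 'u) \<odot>\<^bsub>F\<^esub> b) = (\<lambda>j. ?P (x j))"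
      by (simp add: xj)
    finally show ?thesis .
  qed
  ultimately show ?thesis by (simp only: component_mem[OF n E F]) blast
qed

text \<open>The sums are formed in \<open>poly_space\<close>, whose zero and addition are those of
  the component; the closure laws of the component thus apply to one summand at a time.\<close>

lemma finite_type_component:
  assumes n: "1 \<le> n" and E: "banach_space E" and F: "banach_space F"
  shows "finite_type_polys n E F \<subseteq> carrier (comp n E F)"
proof
  interpret P: abelian_monoid "poly_space n E F" by (rule poly_space_abelian_monoid[OF E F])
  have sum: "finsum (poly_space n E F) g {..<N} \<in> carrier (comp n E F)"
    if "\<And>i. i < N \<Longrightarrow> g i \<in> carrier (comp n E F)" for g and N :: nat
    using that
  proof (induction N)
    case 0
    show ?case
      using component_zero(1)[OF n E F] unfolding lessThan_0 P.finsum_empty component_simps(2) poly_space_simps(2) .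
  next
    case (Suc N)
    have g: "g i \<in> carrier (poly_space n E F)" if "i < Suc N" for i
      by (rule componentD(1)[OF n E F Suc.prems[OF that]])
    have "finsum (poly_space n E F) g {..<Suc N} = g N \<oplus>\<^bsub>poly_space n E F\<^esub> finsum (poly_space n E F) g {..<N}"
      unfolding lessThan_Suc using g by (intro P.finsum_insert) auto
    also have "\<dots> = g N \<oplus>\<^bsub>comp n E F\<^esub> finsum (poly_space n E F) g {..<N}"
      by (simp only: component_simps(3) poly_space_simps(3))
    also have "\<dots> \<in> carrier (comp n E F)"
      using Suc by (intro component_add_cl(1)[OF n E F]) auto
    finally show ?case .
  qed
  fix R assume "R \<in> finite_type_polys n E F"
  then obtain N :: nat and c \<phi> b where R: "R = finsum (poly_space n E F)
      (\<lambda>i. c i \<odot>\<^bsub>poly_space n E F\<^esub> (\<lambda>x\<in>carrier E. (\<phi> i x ^ n) \<odot>\<^bsub>F\<^esub> b i)) {..<N}"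
    and \<phi>b: "\<forall>i<N. \<phi> i \<in> dual E \<and> b i \<in> carrier F"
    unfolding finite_type_polys_def by blast
  show "R \<in> carrier (comp n E F)"
    unfolding R
  proof (rule sum)
    fix i assume "i < N"
    then have "(\<lambda>x\<in>carrier E. (\<phi> i x ^ n) \<odot>\<^bsub>F\<^esub> b i) \<in> carrier (comp n E F)"
      using \<phi>b by (intro power_functional_component[OF n E F]) auto
    from component_smult_cl(1)[OF n E F this, of "c i"]
    show "c i \<odot>\<^bsub>poly_space n E F\<^esub> (\<lambda>x\<in>carrier E. (\<phi> i x ^ n) \<odot>\<^bsub>F\<^esub> b i) \<in> carrier (comp n E F)"
      by (simp only: component_simps(4) poly_space_simps(4))
  qed
qed

section \<open>Power polynomials and compositions\<close>

text \<open>The upper bound is the compatibility of the classes. For the lower bound the first unit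
  sequence is put into every slot: it is reproduced by the product and has norm 1 in both
  classes.\<close>

lemma summing_poly_norm_power_poly:
  assumes n: "1 \<le> n"
  shows "summing_poly_norm X Y scalar_space scalar_space (power_poly n) = 1"
proof -
  let ?K = "scalar_space :: ('k, 'u) bspace"
  note K = banach_scalar_space[where 'k = 'k and 'u = 'u]
  let ?A = "product_op n ?K ?K projl (Inl 1)"
  interpret A: symmetric_power n ?K ?K ?A
    by (rule symmetric_power_product_op[OF K K]) (simp_all add: scalar_space_simps)
  have seq: "(\<lambda>j. ?A (\<lambda>m\<in>{..<n}. x m j)) = (\<lambda>j. Inl (\<Prod>m<n. projl (x m j)))"
    if x: "x \<in> tuples n (\<lambda>_. X ?K)" for x
    unfolding product_op_def restrict_apply'[OF X.restrict_coord_cl[OF K x]]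
    by (simp add: scalar_space_simps)
  have sum: "summing_by X Y n (\<lambda>_. ?K) ?K ?A 1"
    unfolding summing_by_def
  proof
    fix x assume x: "x \<in> tuples n (\<lambda>_. X ?K)"
    have xm: "x m \<in> carrier (X ?K)" if "m < n" for m using x that by auto
    show "(\<lambda>j. ?A (\<lambda>m\<in>{..<n}. x m j)) \<in> carrier (Y ?K) \<and>
        nrm (Y ?K) (\<lambda>j. ?A (\<lambda>m\<in>{..<n}. x m j)) \<le> 1 * (\<Prod>m<n. nrm (X ?K) (x m))"
      unfolding seq[OF x] using power_embeddedD[OF n xm] by simp
  qed
  have eq: "power_poly n = (\<lambda>v\<in>carrier ?K. ?A (const_tuple n v))"
    unfolding power_poly_def
    by (rule restrict_ext) (simp only: product_op_const scalar_space_simps(4) sum.sel mult_1_right)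
  note I = componentI[OF n K K A.symmetric_power_axioms sum zero_le_one eq]
  let ?e = "unit_seq 0 :: nat \<Rightarrow> 'k + 'u"
  have t: "const_tuple n ?e \<in> tuples n (\<lambda>_. X ?K)" using X.unit_seq_cl by auto
  have "(\<lambda>j. Inl (\<Prod>m<n. projl (const_tuple n ?e m j))) = ?e"
    using n by (auto simp: unit_seq_def fun_eq_iff)
  then have "1 \<le> summing_poly_norm X Y ?K ?K (power_poly n)"
    using summing_byD(2)[OF componentD(5)[OF n K K I(1), unfolded I(2)] t] seq[OF t] Y.nrm_unit_seq[of 0]
      X.nrm_unit_seq[of 0] by simp
  with I(3) show ?thesis by (rule antisym)
qed

text \<open>The operator of \<open>S\<close> goes into each of the \<open>n\<close> slots of that of
  \<open>P\<close>, and the result into each of the \<open>r\<close> slots of that of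
  \<open>R\<close>. So the constant of \<open>S\<close> is raised to the power \<open>n\<close> and
  then \<open>r\<close>, and the norm of \<open>P\<close> to the power \<open>r\<close>.
  Polarization is paid for \<open>S\<close> and \<open>R\<close> only, since the norm of
  \<open>P\<close> already refers to its symmetric operator.\<close>

lemma component_compose:
  assumes m: "1 \<le> m" and n: "1 \<le> n" and r: "1 \<le> r"
    and E: "banach_space E" and F: "banach_space F" and G: "banach_space G" and H: "banach_space H"
    and P: "P \<in> carrier (comp n E F)" and S: "S \<in> carrier (poly_space m G E)" and R: "R \<in> carrier (poly_space r F H)"
  defines "T \<equiv> compose (carrier G) R (compose (carrier G) P S)"
  shows "T \<in> carrier (comp (r * m * n) G H)"
    and "summing_poly_norm X Y G H T
      \<le> real r ^ r / fact r * (real m ^ m / fact m) ^ (r * n) * nrm (poly_space r F H) R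
        * summing_poly_norm X Y E F P ^ r * nrm (poly_space m G E) S ^ (r * n)"
proof -
  note SS = symmetric_of_poly[OF G E S] and SR = symmetric_of_poly[OF F H R] and DP = componentD[OF n E F P]
  let ?S = "symmetric_of m G E S" and ?R = "symmetric_of r F H R" and ?P = "symmetric_of n E F P"
  let ?cS = "real m ^ m / fact m * nrm (poly_space m G E) S" and ?cR = "real r ^ r / fact r * nrm (poly_space r F H) R"
  let ?p = "summing_poly_norm X Y E F P"
  have cS: "0 \<le> ?cS" using poly_nrm_bound(1)[OF G E S] by simp
  have cR: "0 \<le> ?cR" using poly_nrm_bound(1)[OF F H R] by simp
  interpret S: symmetric_power m G E ?S by (rule SS(1))
  interpret R: symmetric_power r F H ?R by (rule SR(1))
  interpret P: symmetric_power n E F ?P by (rule DP(2))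
  have sumS: "summing_by X X m (\<lambda>_. G) E ?S ?cS"
    by (rule X.summing_by_stable[OF S.multilinear_operator_axioms m SS(3) cS])
  have sumR: "summing_by Y Y r (\<lambda>_. F) H ?R ?cR"
    by (rule Y.summing_by_stable[OF R.multilinear_operator_axioms r SR(3) cR])
  let ?D1 = "compose_op n m G ?S ?P"
  let ?D = "compose_op r (n * m) G ?D1 ?R"
  let ?C = "?cR * (?p * ?cS ^ n) ^ r"
  note ml1 = compose_op_multilinear[OF S.multilinear_power_axioms P.multilinear_power_axioms]
  note ml = compose_op_multilinear[OF ml1 R.multilinear_power_axioms]
  have sum1: "summing_by X Y (n * m) (\<lambda>_. G) F ?D1 (?p * ?cS ^ n)"
    by (rule compose_op_summing_by[OF X.seq_class_axioms X.seq_class_axioms Y.seq_class_axioms G E F sumS DP(5) DP(4)])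
  have sum: "summing_by X Y (r * (n * m)) (\<lambda>_. G) H ?D ?C"
    by (rule compose_op_summing_by[OF X.seq_class_axioms Y.seq_class_axioms Y.seq_class_axioms G F H sum1 sumR cR])
  \<comment> \<open>The composed operator is not symmetric in general, while the norm of
    \<open>T\<close> refers to the symmetric one; averaging keeps the constant.\<close>
  have symsum: "summing_by X Y (r * (n * m)) (\<lambda>_. G) H (symmetrize (r * (n * m)) G H ?D) ?C"
    by (rule symmetrize_summing_by[OF X.seq_class_axioms Y.seq_class_axioms ml sum])
  have T: "T = (\<lambda>v\<in>carrier G. symmetrize (r * (n * m)) G H ?D (const_tuple (r * (n * m)) v))"
    unfolding T_def compose_def
  proof (rule restrict_ext)
    fix v assume v: "v \<in> carrier G"
    note Sv = poly_cl[OF S v] and PSv = poly_cl[OF DP(1) poly_cl[OF S v]]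
    have "symmetrize (r * (n * m)) G H ?D (const_tuple (r * (n * m)) v) = ?D (const_tuple (r * (n * m)) v)"
      by (rule multilinear_power.symmetrize_const[OF ml v])
    also have "\<dots> = ?R (const_tuple r (?D1 (const_tuple (n * m) v)))"
      by (rule compose_op_const[OF ml1 v])
    also have "?D1 (const_tuple (n * m) v) = ?P (const_tuple n (?S (const_tuple m v)))"
      by (rule compose_op_const[OF S.multilinear_power_axioms v])
    also have "\<dots> = P (S v)" unfolding SS(2)[OF v] by (rule DP(3)[OF Sv])
    also have "?R (const_tuple r (P (S v))) = R (P (S v))" by (rule SR(2)[OF PSv])
    finally show "R ((\<lambda>x\<in>carrier G. P (S x)) v) = symmetrize (r * (n * m)) G H ?D (const_tuple (r * (n * m)) v)"
      unfolding restrict_apply'[OF v] by (rule sym)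
  qed
  have C: "0 \<le> ?C" 
    by (rule mult_nonneg_nonneg[OF cR zero_le_power[OF mult_nonneg_nonneg[OF DP(4) zero_le_power[OF cS]]]])
  have d: "1 \<le> r * (n * m)" using m n r by simp
  note I = componentI[OF d G H multilinear_power.symmetrize_symmetric_power[OF ml] symsum C T]
  have "r * m * n = r * (n * m)" by simp
  then show "T \<in> carrier (comp (r * m * n) G H)" using I(1) by (simp only:)
  have "k * a * (p * (c * b) ^ n) ^ r = k * c ^ (r * n) * a * p ^ r * b ^ (r * n)" for k a p c b :: real
    by (simp add: power_mult_distrib power_mult[symmetric] mult.commute[of n r])
  then have "?C = real r ^ r / fact r * (real m ^ m / fact m) ^ (r * n) * nrm (poly_space r F H) R
        * ?p ^ r * nrm (poly_space m G E) S ^ (r * n)"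
    by (simp only:)
  then show "summing_poly_norm X Y G H T
      \<le> real r ^ r / fact r * (real m ^ m / fact m) ^ (r * n) * nrm (poly_space r F H) R
        * ?p ^ r * nrm (poly_space m G E) S ^ (r * n)"
    using I(3) by (simp only:)
qed

end

theorem theorem3p7:
  fixes X Y :: "('k :: {real_normed_field, banach}, 'u) seq_rule"
  assumes "sequence_class X" and "sequence_class Y"
    and "multilinearly_stable X" and "multilinearly_stable Y"
    and "\<And>n. n \<ge> 1 \<Longrightarrow> power_embedded n X Y"
  shows "polynomial_banach_two_sided_ideal
           (\<lambda>n. real n ^ n / fact n) (\<lambda>n. real n ^ n / fact n)
           (summing_polys X Y) (summing_poly_norm X Y)"
proof -
  interpret summing_ideal X Y
    by (intro summing_ideal.intro stable_seq_class.intro seq_class.intro stable_seq_class_axioms.intro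
        summing_ideal_axioms.intro assms)
  \<comment> \<open>The lower bound required of the constants amounts to
    \<open>fact n \<le> n ^ n\<close>.\<close>
  have "1 \<le> real n ^ n / fact n" if "n \<ge> 1" for n
    using fact_le_power[of n, where 'a = real] by (simp add: le_divide_eq)
  then show ?thesis
    unfolding polynomial_banach_two_sided_ideal_def
  proof (intro conjI allI impI ballI)
    show "summing_polys X Y E F \<subseteq> homogeneous_polys E F" for E F
      by (auto simp: summing_polys_def)
  qed ((rule component_banach finite_type_component summing_poly_norm_power_poly component_compose; assumption) | simp)+
qed

end
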